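(* Let $\alpha\in DC(\gamma,\sigma)$ with $\gamma,\sigma>0$, and let $V=V_1$ (the generalized Aubry–André potential with $\lambda\in\mathbb R$, $|\tau|<1$) or $V=V_2$ (the quasi-periodic mosaic potential with $\lambda\in\mathbb R\setminus\{0\}$, $\kappa=2$). Then for every $\theta\in\Theta$, the operator $H_{V,\alpha,\theta}$ has Anderson localization in the set $$\mathcal P=\Sigma(V)\cap\{E\in\mathbb R: L(E)>0\},$$ where $$\Theta=\bigcup_{\eta>0}\Big\{\theta\in\mathbb R:\ \|2\theta-k\alpha\|\ge\frac{\eta}{|k|^\sigma}\ \text{ for all integers } k\neq0\Big\}$$ and $L(E)$ is the Lyapunov exponent of the Schrödinger cocycle of $H_{V,\alpha,\theta}$ at energy $E$.
   Context: $\|x\|=\inf_{p\in\mathbb Z}|x-p|$. $DC(\gamma,\sigma)$ is the set of $\alpha$ with $\|k\alpha\|\ge\gamma|k|^{-\sigma}$ for all integers $k\ne0$. The operators act on $\ell^2(\mathbb Z)$ by $(H_{V,\alpha,\theta}u)_n=u_{n+1}+u_{n-1}+V_\theta(n)u_n$, where: for $V=V_1$, $V_\theta(n)=2\lambda\frac{\cos2\pi(\theta+n\alpha)}{1-\tau\cos2\pi(\theta+n\alpha)}$; for $V=V_2$ with $\kappa=2$, $V_\theta(n)=2\lambda\cos2\pi(\theta+n\alpha)$ if $n$ is even and $V_\theta(n)=0$ if $n$ is odd. $\Sigma(V)$ is the ($\theta$-independent) spectrum. With $A_n(\theta)=S(n-1)\cdots S(0)$, $S(j)=\begin{pmatrix}E-V_\theta(j)&-1\\1&0\end{pmatrix}$,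 the Lyapunov exponent is $L(E)=\lim_{n\to\infty}\frac1n\int_0^1\ln\|A_n(\theta)\|\,d\theta$ (for $V_2$ this equals the Lyapunov exponent of the cocycle over $(\theta,n)\mapsto(\theta+\alpha,n+1)$ on $\mathbb T\times\mathbb Z_2$). Anderson localization in a set $S$ means that the spectrum in $S$ is pure point (spectral measures restricted to $S$ are pure point) with exponentially decaying eigenfunctions. *)

theory Defs
  imports "HOL-Analysis.Analysis"
begin

section \<open>Arithmetic conditions\<close>

definition dist_int :: "real \<Rightarrow> real" where
  "dist_int x = (INF p::int. \<bar>x - of_int p\<bar>)"

definition DC :: "real \<Rightarrow> real \<Rightarrow> real set" where
  "DC \<gamma> \<sigma> =
    {\<alpha>. \<forall>k::int. k \<noteq> 0 \<longrightarrow> dist_int (of_int k * \<alpha>) \<ge> \<gamma> * \<bar>of_int k\<bar> powr (- \<sigma>)}"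

definition Theta :: "real \<Rightarrow> real \<Rightarrow> real set" where
  "Theta \<alpha> \<sigma> = (\<Union>\<eta>\<in>{0<..}.
    {\<theta>. \<forall>k::int. k \<noteq> 0 \<longrightarrow> dist_int (2 * \<theta> - of_int k * \<alpha>) \<ge> \<eta> / \<bar>of_int k\<bar> powr \<sigma>})"


section \<open>Bounded operators on the complex Hilbert space of square-summable sequences\<close>

text \<open>Operators are functions on all sequences \<^typ>\<open>int \<Rightarrow> complex\<close>; only their
  values on \<open>ell2\<close> matter.\<close>

definition ell2 :: "(int \<Rightarrow> complex) set" where
  "ell2 = {u. (\<lambda>n. (cmod (u n))\<^sup>2) summable_on UNIV}"

definition ell2_inner :: "(int \<Rightarrow> complex) \<Rightarrow> (int \<Rightarrow> complex) \<Rightarrow> complex" where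
  "ell2_inner u v = (\<Sum>\<^sub>\<infinity>n. cnj (u n) * v n)"

definition ell2_norm :: "(int \<Rightarrow> complex) \<Rightarrow> real" where
  "ell2_norm u = sqrt (\<Sum>\<^sub>\<infinity>n. (cmod (u n))\<^sup>2)"

definition bounded_op :: "((int \<Rightarrow> complex) \<Rightarrow> (int \<Rightarrow> complex)) \<Rightarrow> bool" where
  "bounded_op T \<longleftrightarrow>
    (\<forall>u\<in>ell2. T u \<in> ell2) \<and>
    (\<forall>u\<in>ell2. \<forall>v\<in>ell2. T (\<lambda>n. u n + v n) = (\<lambda>n. T u n + T v n)) \<and>
    (\<forall>c. \<forall>u\<in>ell2. T (\<lambda>n. c * u n) = (\<lambda>n. c * T u n)) \<and>
    (\<exists>C. \<forall>u\<in>ell2. ell2_norm (T u) \<le> C * ell2_norm u)"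

definition spectrum :: "((int \<Rightarrow> complex) \<Rightarrow> (int \<Rightarrow> complex)) \<Rightarrow> complex set" where
  "spectrum T = {z. \<not> (\<exists>R. bounded_op R \<and>
    (\<forall>u\<in>ell2. R (\<lambda>n. T u n - z * u n) = u \<and> (\<lambda>n. T (R u) n - z * R u n) = u))}"

definition orthogonal_projection :: "((int \<Rightarrow> complex) \<Rightarrow> (int \<Rightarrow> complex)) \<Rightarrow> bool" where
  "orthogonal_projection Q \<longleftrightarrow> bounded_op Q \<and>
    (\<forall>u\<in>ell2. Q (Q u) = Q u) \<and>
    (\<forall>u\<in>ell2. \<forall>v\<in>ell2. ell2_inner (Q u) v = ell2_inner u (Q v))"

definition projection_valued_measure ::
    "(real set \<Rightarrow> (int \<Rightarrow> complex) \<Rightarrow> (int \<Rightarrow> complex)) \<Rightarrow> bool" where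
  "projection_valued_measure P \<longleftrightarrow>
    (\<forall>B\<in>sets borel. orthogonal_projection (P B)) \<and>
    (\<forall>u\<in>ell2. P {} u = (\<lambda>n. 0)) \<and>
    (\<forall>u\<in>ell2. P UNIV u = u) \<and>
    (\<forall>A\<in>sets borel. \<forall>B\<in>sets borel. \<forall>u\<in>ell2. P (A \<inter> B) u = P A (P B u)) \<and>
    (\<forall>B :: nat \<Rightarrow> real set. range B \<subseteq> sets borel \<longrightarrow> disjoint_family B \<longrightarrow>
      (\<forall>u\<in>ell2. (\<lambda>i. ell2_inner u (P (B i) u)) sums ell2_inner u (P (\<Union>i. B i) u)))"

definition spectral_measure ::
    "(real set \<Rightarrow> (int \<Rightarrow> complex) \<Rightarrow> (int \<Rightarrow> complex)) \<Rightarrow> (int \<Rightarrow> complex) \<Rightarrow> real measure" where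
  "spectral_measure P u = measure_of UNIV (sets borel) (\<lambda>B. ennreal (Re (ell2_inner u (P B u))))"

text \<open>\<open>P\<close> is the spectral resolution of \<open>T\<close>, i.e. \<open>T = \<integral> x dP(x)\<close>, expressed through
  quadratic forms (which determine a bounded operator on a complex Hilbert space by
  polarization). By the spectral theorem, a bounded self-adjoint \<open>T\<close> has exactly one
  spectral resolution, up to values outside Borel sets and outside \<open>ell2\<close>.\<close>

definition spectral_resolution ::
    "((int \<Rightarrow> complex) \<Rightarrow> (int \<Rightarrow> complex)) \<Rightarrow>
     (real set \<Rightarrow> (int \<Rightarrow> complex) \<Rightarrow> (int \<Rightarrow> complex)) \<Rightarrow> bool" where
  "spectral_resolution T P \<longleftrightarrow> projection_valued_measure P \<and>
    (\<forall>u\<in>ell2. integrable (spectral_measure P u) (\<lambda>x. x) \<and>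
      ell2_inner u (T u) = complex_of_real (\<integral>x. x \<partial>spectral_measure P u))"


section \<open>Anderson localization\<close>

text \<open>The restriction of \<open>M\<close> to \<open>S\<close> is carried by a countable set. The almost-everywhere
  formulation does not become vacuous for non-measurable \<open>S\<close>.\<close>

definition pure_point_on :: "real measure \<Rightarrow> real set \<Rightarrow> bool" where
  "pure_point_on M S \<longleftrightarrow> (\<exists>C. countable C \<and> (AE x in M. x \<in> S \<longrightarrow> x \<in> C))"

definition exp_decaying :: "(int \<Rightarrow> complex) \<Rightarrow> bool" where
  "exp_decaying u \<longleftrightarrow>
    (\<exists>C c. c > 0 \<and> (\<forall>n. cmod (u n) \<le> C * exp (- c * \<bar>real_of_int n\<bar>)))"

definition anderson_localization ::
    "((int \<Rightarrow> complex) \<Rightarrow> (int \<Rightarrow> complex)) \<Rightarrow> real set \<Rightarrow> bool" where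
  "anderson_localization T S \<longleftrightarrow>
    (\<forall>P. spectral_resolution T P \<longrightarrow> (\<forall>u\<in>ell2. pure_point_on (spectral_measure P u) S)) \<and>
    (\<forall>E\<in>S. \<forall>u\<in>ell2. u \<noteq> (\<lambda>n. 0) \<longrightarrow> T u = (\<lambda>n. complex_of_real E * u n) \<longrightarrow> exp_decaying u)"


section \<open>Quasi-periodic Schroedinger operators\<close>

text \<open>A family of potentials is a function \<open>V\<close> with \<open>V \<theta> n\<close> the value at site \<open>n\<close> for
  phase \<open>\<theta>\<close>; the frequency is built into \<open>V\<close>.\<close>

definition V1 :: "real \<Rightarrow> real \<Rightarrow> real \<Rightarrow> real \<Rightarrow> int \<Rightarrow> real" where
  "V1 lam \<tau> \<alpha> \<theta> n =
    2 * lam * (cos (2 * pi * (\<theta> + of_int n * \<alpha>)) / (1 - \<tau> * cos (2 * pi * (\<theta> + of_int n * \<alpha>))))"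

definition V2 :: "real \<Rightarrow> real \<Rightarrow> real \<Rightarrow> int \<Rightarrow> real" where
  "V2 lam \<alpha> \<theta> n = (if even n then 2 * lam * cos (2 * pi * (\<theta> + of_int n * \<alpha>)) else 0)"

definition schroedinger ::
    "(real \<Rightarrow> int \<Rightarrow> real) \<Rightarrow> real \<Rightarrow> (int \<Rightarrow> complex) \<Rightarrow> (int \<Rightarrow> complex)" where
  "schroedinger V \<theta> u = (\<lambda>n. u (n + 1) + u (n - 1) + complex_of_real (V \<theta> n) * u n)"

text \<open>For the potentials above and irrational frequency, this set does not depend on \<open>\<theta>\<close>.\<close>

definition Sigma_spec :: "(real \<Rightarrow> int \<Rightarrow> real) \<Rightarrow> real \<Rightarrow> real set" where
  "Sigma_spec V \<theta> = {E. complex_of_real E \<in> spectrum (schroedinger V \<theta>)}"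

definition transfer_step :: "(real \<Rightarrow> int \<Rightarrow> real) \<Rightarrow> real \<Rightarrow> real \<Rightarrow> int \<Rightarrow> real^2^2" where
  "transfer_step V E \<theta> j = vector [vector [E - V \<theta> j, - 1], vector [1, 0]]"

primrec transfer_matrix :: "(real \<Rightarrow> int \<Rightarrow> real) \<Rightarrow> real \<Rightarrow> real \<Rightarrow> nat \<Rightarrow> real^2^2" where
  "transfer_matrix V E \<theta> 0 = mat 1"
| "transfer_matrix V E \<theta> (Suc n) = transfer_step V E \<theta> (int n) ** transfer_matrix V E \<theta> n"

definition lyapunov :: "(real \<Rightarrow> int \<Rightarrow> real) \<Rightarrow> real \<Rightarrow> real" where
  "lyapunov V E =
    lim (\<lambda>n. 1 / real n * integral {0..1} (\<lambda>\<theta>. ln (onorm ((*v) (transfer_matrix V E \<theta> n)))))"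

end

theory Submission
  imports Defs "HOL-Real_Asymp.Real_Asymp" "HOL-Computational_Algebra.Polynomial"
begin

text \<open>Spectrally almost every energy has a nontrivial polynomially bounded solution (the densities
  of the spectral measures of pairs of unit vectors form one), so it suffices that at a positive
  Lyapunov exponent such solutions decay exponentially: these energies are then eigenvalues, and
  they are atoms of a finite measure, hence countably many.

  For the decay of a solution of \<open>H\<^bsub>V\<^sub>1\<^esub> u = E u\<close> with \<open>L = L(E) > 0\<close>, write \<open>D\<^sub>k(x)\<close> for the determinant of
  \<open>E - H\<close> on a box of \<open>k\<close> sites, \<open>x\<close> being the phase of its first site. By Cramer's rule \<open>u\<close>
  decays at a site well inside a box whose determinant has size close to \<open>e\<^bsup>kL\<^esup>\<close>. So if \<open>u\<close>
  did not decay at \<open>y\<close>, all boxes around \<open>y\<close>, and likewise all boxes around a fixed site where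
  \<open>u\<close> does not vanish, would have exponentially smaller determinants. Up to a
  harmless factor, \<open>D\<^sub>k\<close> is a polynomial of degree at most \<open>k\<close> in the cosine of the phase of the center
  of the box; more than \<open>k\<close> of these boxes, whose centers are equidistributed up to small divisors controlled by
  the arithmetic conditions, serve as nodes of Lagrange interpolation, and \<open>D\<^sub>k\<close> would be small
  at all phases. This contradicts the definition of \<open>L\<close> as an average of \<open>ln \<parallel>A\<^sub>n\<parallel> / n\<close>.

  The mosaic model reduces to \<open>V\<^sub>1\<close> with \<open>\<tau> = 0\<close>: at energy \<open>E \<noteq> 0\<close>, eliminating the odd sites
  leaves the equation with coupling \<open>E \<lambda>\<close>, energy \<open>E\<^sup>2 - 2\<close> and frequency \<open>2 \<alpha>\<close>.\<close>

section \<open>Small divisors and equidistribution\<close>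

text \<open>All comparisons of determinants are made up to factors \<open>exp (e * k)\<close> with
  small \<open>e\<close>, so no integral is ever evaluated: the averages of the logarithm of the
  sine and of the logarithm of the weights occur once in a numerator and once in a denominator and
  cancel. What does not cancel is the logarithmic singularity of the denominators; controlling it is
  the task of both arithmetic conditions. The argument lives on an asymmetry. Upper bounds on
  determinants hold uniformly in the phase, by subadditivity and uniform equidistribution. A lower
  bound is available only at some phase, about which nothing is known. Interpolation carries
  smallness from the orbit of \<theta> to that phase. The margin is numerical. In boxes of about 16m
  sites, a site more than m away from both edges leaves at most 15m sites on either side, and all
  other losses together must stay below one further m. On the spectral side the projections are
  given through quadratic forms. Their additivity on vectors and their compatibility with the
  operator have to be derived before densities can be shown to solve the difference
  equation.\<close>

text \<open>The arithmetic conditions are used with \<open>\<bar>sin (\<pi> x)\<bar>\<close>, which dominates and is comparable to the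
  distance of \<open>x\<close> to the integers, because differences of cosines factor into such sines.\<close>

definition diophantine :: "real \<Rightarrow> real \<Rightarrow> real \<Rightarrow> bool" where
  "diophantine \<alpha> \<gamma> \<sigma> \<longleftrightarrow> \<gamma> > 0 \<and> \<sigma> > 0 \<and>
    (\<forall>k::int. k \<noteq> 0 \<longrightarrow> \<gamma> * \<bar>real_of_int k\<bar> powr (- \<sigma>) \<le> \<bar>sin (pi * (of_int k * \<alpha>))\<bar>)"

definition nonresonant :: "real \<Rightarrow> real \<Rightarrow> real \<Rightarrow> real \<Rightarrow> bool" where
  "nonresonant \<alpha> \<theta> \<eta> \<sigma> \<longleftrightarrow> \<eta> > 0 \<and>
    (\<forall>k::int. k \<noteq> 0 \<longrightarrow> \<eta> * \<bar>real_of_int k\<bar> powr (- \<sigma>) \<le> \<bar>sin (pi * (2 * \<theta> + of_int k * \<alpha>))\<bar>)"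

lemma dist_int_le: "dist_int x \<le> \<bar>x - of_int p\<bar>"
  unfolding dist_int_def by (rule cINF_lower) (auto intro!: bdd_belowI[of _ 0])

lemma abs_sin_pi_add_int: "\<bar>sin (pi * (x + of_int p))\<bar> = \<bar>sin (pi * x)\<bar>"
proof -
  have "\<bar>cos (pi * of_int p)\<bar> = 1"
    using sin_cos_squared_add[of "pi * of_int p"] by (simp add: abs_square_eq_1)
  then show ?thesis by (simp add: distrib_left sin_add abs_mult)
qed

lemma le_sin_pi:
  assumes "0 \<le> t" "t \<le> 1/2"
  shows "t \<le> sin (pi * t)"
\<comment> \<open>Up to t = 1/3 the cosine is at least 1/2, so the mean value theorem gives
  \<open>sin (pi * t) \<ge> pi * t / 2 \<ge> t\<close>. Beyond that, monotonicity gives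
  \<open>sin (pi * t) \<ge> sin (pi / 6) = 1/2 \<ge> t\<close>.\<close>
proof (cases "t \<le> 1/3")
  case True
  show ?thesis
  proof (cases "t = 0")
    case False
    then have "0 < pi * t" using assms by simp
    then obtain z where z: "0 < z" "z < pi * t" "sin (pi * t) - sin 0 = (pi * t - 0) * cos z"
      using MVT2[of 0 "pi * t" sin cos] by (auto intro: DERIV_sin)
    have "pi * t \<le> pi * (1/3)" using True by (intro mult_left_mono) auto
    then have "z \<le> pi / 3" using z(2) by linarith
    then have "cos (pi / 3) \<le> cos z" using z(1) by (intro cos_monotone_0_pi_le) auto
    then have "1 / 2 \<le> cos z" by (simp add: cos_60)
    then have "pi * t * (1/2) \<le> sin (pi * t)"
      using z(3) \<open>0 < pi * t\<close> mult_left_mono[of "1/2" "cos z" "pi * t"] by simp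
    moreover have "2 * t \<le> pi * t" using pi_ge_two assms by (intro mult_right_mono) auto
    ultimately show ?thesis by simp
  qed auto
next
  case False
  have "sin (pi / 6) \<le> sin (pi * t)"
    using False assms by (intro sin_monotone_2pi_le) (auto simp: field_simps)
  then show ?thesis using assms by (simp add: sin_30)
qed

lemma dist_int_le_abs_sin: "dist_int x \<le> \<bar>sin (pi * x)\<bar>"
proof -
  define t where "t = x - of_int (round x)"
  have t: "\<bar>t\<bar> \<le> 1/2"
    unfolding t_def using of_int_round_abs_le[of x] by (simp add: abs_minus_commute)
  have "\<bar>sin (pi * x)\<bar> = \<bar>sin (pi * t)\<bar>"
    using abs_sin_pi_add_int[of t "round x"] by (simp add: t_def)
  moreover have "\<bar>t\<bar> \<le> \<bar>sin (pi * t)\<bar>"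
    using le_sin_pi[of "\<bar>t\<bar>"] t by (cases "t \<ge> 0") auto
  ultimately show ?thesis using dist_int_le[of x "round x"] by (simp add: t_def)
qed

lemma diophantine_if_DC: "\<alpha> \<in> DC \<gamma> \<sigma> \<Longrightarrow> \<gamma> > 0 \<Longrightarrow> \<sigma> > 0 \<Longrightarrow> diophantine \<alpha> \<gamma> \<sigma>"
  unfolding DC_def diophantine_def using dist_int_le_abs_sin order_trans by blast

lemma nonresonant_if_Theta:
  assumes "\<theta> \<in> Theta \<alpha> \<sigma>"
  obtains \<eta> where "nonresonant \<alpha> \<theta> \<eta> \<sigma>"
proof -
  obtain \<eta> where \<eta>: "\<eta> > 0"
    "\<And>k::int. k \<noteq> 0 \<Longrightarrow> \<eta> / \<bar>of_int k\<bar> powr \<sigma> \<le> dist_int (2 * \<theta> - of_int k * \<alpha>)"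
    using assms by (auto simp: Theta_def)
  have "\<eta> * \<bar>real_of_int k\<bar> powr (- \<sigma>) \<le> \<bar>sin (pi * (2 * \<theta> + of_int k * \<alpha>))\<bar>" if "k \<noteq> 0" for k :: int
    using \<eta>(2)[of "- k"] that dist_int_le_abs_sin[of "2 * \<theta> + of_int k * \<alpha>"]
    by (simp add: powr_minus divide_inverse)
  then show thesis using that \<eta>(1) by (auto simp: nonresonant_def)
qed

text \<open>Reflecting the lattice changes the sign of the phase. Decay to the left will be decay to
  the right for the reflected problem.\<close>

lemma nonresonant_uminus:
  assumes "nonresonant \<alpha> \<theta> \<eta> \<sigma>" shows "nonresonant \<alpha> (- \<theta>) \<eta> \<sigma>"
proof -
  have "\<eta> * \<bar>real_of_int k\<bar> powr (- \<sigma>) \<le> \<bar>sin (pi * (2 * (- \<theta>) + of_int k * \<alpha>))\<bar>"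
    if "k \<noteq> 0" for k :: int
  proof -
    have "pi * (2 * (- \<theta>) + of_int k * \<alpha>) = - (pi * (2 * \<theta> + of_int (- k) * \<alpha>))"
      by (simp add: algebra_simps)
    then have "\<bar>sin (pi * (2 * (- \<theta>) + of_int k * \<alpha>))\<bar> = \<bar>sin (pi * (2 * \<theta> + of_int (- k) * \<alpha>))\<bar>"
      by (metis abs_minus_cancel sin_minus)
    moreover have "\<eta> * \<bar>real_of_int (- k)\<bar> powr (- \<sigma>) \<le> \<bar>sin (pi * (2 * \<theta> + of_int (- k) * \<alpha>))\<bar>"
      using assms that unfolding nonresonant_def by (metis neg_equal_0_iff_equal)
    ultimately show ?thesis by simp
  qed
  then show ?thesis using assms by (auto simp: nonresonant_def)
qed

text \<open>Multiples of the frequency arise twice: as the step between blocks in the subadditive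
  argument, and as the doubled frequency of the mosaic model.\<close>

lemma diophantine_mult:
  assumes "diophantine \<alpha> \<gamma> \<sigma>" and "m > 0"
  shows "diophantine (of_nat m * \<alpha>) (\<gamma> * of_nat m powr (- \<sigma>)) \<sigma>"
  unfolding diophantine_def
proof (intro conjI allI impI)
  fix k :: int assume "k \<noteq> 0"
  then have "k * int m \<noteq> 0" using assms by auto
  then have "\<gamma> * \<bar>real_of_int (k * int m)\<bar> powr (- \<sigma>) \<le> \<bar>sin (pi * (of_int (k * int m) * \<alpha>))\<bar>"
    using assms(1) unfolding diophantine_def by blast
  then show "\<gamma> * of_nat m powr (- \<sigma>) * \<bar>real_of_int k\<bar> powr (- \<sigma>) \<le> \<bar>sin (pi * (of_int k * (of_nat m * \<alpha>)))\<bar>"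
    by (simp add: abs_mult powr_mult mult_ac)
qed (use assms in \<open>auto simp: diophantine_def\<close>)

lemma nonresonant_mult:
  assumes "nonresonant \<alpha> \<theta> \<eta> \<sigma>" and "m > 0"
  shows "nonresonant (of_nat m * \<alpha>) \<theta> (\<eta> * of_nat m powr (- \<sigma>)) \<sigma>"
  unfolding nonresonant_def
proof (intro conjI allI impI)
  fix k :: int assume "k \<noteq> 0"
  then have "k * int m \<noteq> 0" using assms by auto
  then have "\<eta> * \<bar>real_of_int (k * int m)\<bar> powr (- \<sigma>) \<le> \<bar>sin (pi * (2 * \<theta> + of_int (k * int m) * \<alpha>))\<bar>"
    using assms(1) unfolding nonresonant_def by blast
  then show "\<eta> * of_nat m powr (- \<sigma>) * \<bar>real_of_int k\<bar> powr (- \<sigma>)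
      \<le> \<bar>sin (pi * (2 * \<theta> + of_int k * (of_nat m * \<alpha>)))\<bar>"
    by (simp add: abs_mult powr_mult mult_ac)
qed (use assms in \<open>auto simp: nonresonant_def\<close>)

section \<open>Uniform equidistribution of continuous periodic functions along orbits\<close>

lemma periodic_int:
  fixes g :: "real \<Rightarrow> 'a"
  assumes "\<And>x. g (x + 1) = g x"
  shows "g (x + of_int p) = g x"
proof -
  have nat: "g (y + of_nat n) = g y" for y n
    by (induction n) (auto simp: assms add.assoc[symmetric] add.commute[of 1])
  show ?thesis
  proof (cases "p \<ge> 0")
    case True then show ?thesis using nat[of x "nat p"] by simp
  next
    case False then show ?thesis using nat[of "x + of_int p" "nat (- p)"] by simp
  qed
qed

lemma periodic_uniform:
  fixes g :: "real \<Rightarrow> real"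
  assumes per: "\<And>x. g (x + 1) = g x" and cont: "continuous_on UNIV g" and "e > 0"
  obtains d where "d > 0" "\<And>x y. \<bar>x - y\<bar> < d \<Longrightarrow> \<bar>g x - g y\<bar> < e"
proof -
  have "uniformly_continuous_on {-1..2} g"
    by (intro compact_uniformly_continuous continuous_on_subset[OF cont]) auto
  then obtain d where d: "d > 0"
    "\<And>x y. x \<in> {-1..2} \<Longrightarrow> y \<in> {-1..2} \<Longrightarrow> \<bar>x - y\<bar> < d \<Longrightarrow> \<bar>g x - g y\<bar> < e"
    using \<open>e > 0\<close> unfolding uniformly_continuous_on_def dist_real_def by metis
  have "\<bar>g x - g y\<bar> < e" if "\<bar>x - y\<bar> < min d 1" for x y
  proof -
    let ?x = "x - of_int \<lfloor>x\<rfloor>" and ?y = "y - of_int \<lfloor>x\<rfloor>"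
    have "0 \<le> ?x" "?x < 1" by linarith+
    then have "?x \<in> {-1..2}" "?y \<in> {-1..2}" unfolding atLeastAtMost_iff using that by linarith+
    then have "\<bar>g ?x - g ?y\<bar> < e" using d(2)[of ?x ?y] that by simp
    moreover have "g x = g ?x" "g y = g ?y"
      using periodic_int[of g, OF per, of ?x "\<lfloor>x\<rfloor>"] periodic_int[of g, OF per, of ?y "\<lfloor>x\<rfloor>"] by auto
    ultimately show ?thesis by simp
  qed
  then show thesis using that[of "min d 1"] d(1) by auto
qed

lemma periodic_bounded:
  fixes g :: "real \<Rightarrow> real"
  assumes per: "\<And>x. g (x + 1) = g x" and cont: "continuous_on UNIV g"
  obtains B where "B > 0" "\<And>x. \<bar>g x\<bar> \<le> B"
proof -
  have "bounded (g ` {0..1})"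
    by (intro compact_imp_bounded compact_continuous_image continuous_on_subset[OF cont]) auto
  then obtain B where B: "B > 0" "\<And>x. x \<in> {0..1} \<Longrightarrow> \<bar>g x\<bar> \<le> B"
    unfolding bounded_pos by auto
  have "\<bar>g x\<bar> \<le> B" for x
  proof -
    have "x - of_int \<lfloor>x\<rfloor> \<in> {0..1}" unfolding atLeastAtMost_iff by linarith
    then show ?thesis using B(2) periodic_int[of g, OF per, of "x - of_int \<lfloor>x\<rfloor>" "\<lfloor>x\<rfloor>"] by auto
  qed
  then show thesis using that B by auto
qed

text \<open>Dirichlet's theorem alone may return a small denominator. With \<open>N\<close> large
  enough, a denominator below \<open>Q\<close> would make the sine smaller than the Diophantine
  condition allows.\<close>

lemma Dirichlet_large_denominator:
  assumes dio: "diophantine \<alpha> \<gamma> \<sigma>"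
  obtains h q :: int where "coprime h q" "q \<ge> int Q" "q > 0" "\<bar>of_int q * \<alpha> - of_int h\<bar> < 1 / of_int q"
proof -
  have "((\<lambda>N. pi / real N) \<longlongrightarrow> 0) sequentially" by real_asymp
  moreover have "\<gamma> * real (Suc Q) powr (- \<sigma>) > 0" using dio by (simp add: diophantine_def)
  ultimately have "\<forall>\<^sub>F N in sequentially. pi / real N < \<gamma> * real (Suc Q) powr (- \<sigma>)"
    by (rule order_tendstoD(2))
  then obtain N where N: "N > 0" "pi / real N < \<gamma> * real (Suc Q) powr (- \<sigma>)"
    using eventually_conj[OF eventually_gt_at_top[of 0]] eventually_happens'[OF sequentially_bot] 
    by (metis (mono_tags, lifting) eventually_conj eventually_gt_at_top eventually_happens' sequentially_bot)
  obtain h q where hq: "coprime h q" "0 < q" "q \<le> int N" "\<bar>of_int q * \<alpha> - of_int h\<bar> < 1 / real N"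
    using Dirichlet_approx_coprime[OF N(1), of \<alpha>] by blast
  have "\<bar>sin (pi * (of_int q * \<alpha>))\<bar> = \<bar>sin (pi * (of_int q * \<alpha> - of_int h))\<bar>"
    using abs_sin_pi_add_int[of "of_int q * \<alpha> - of_int h" h] by simp
  also have "\<dots> \<le> \<bar>pi * (of_int q * \<alpha> - of_int h)\<bar>" by (rule abs_sin_x_le_abs_x)
  also have "\<dots> = pi * \<bar>of_int q * \<alpha> - of_int h\<bar>" by (simp add: abs_mult)
  also have "\<dots> \<le> pi * (1 / real N)" using hq(4) by (intro mult_left_mono) auto
  also have "\<dots> < \<gamma> * real (Suc Q) powr (- \<sigma>)" using N by simp
  finally have *: "\<gamma> * real_of_int q powr (- \<sigma>) < \<gamma> * real (Suc Q) powr (- \<sigma>)"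
    using dio hq(2) unfolding diophantine_def by (smt (verit) of_int_pos)
  have "q \<ge> int Q"
  proof (rule ccontr)
    assume "\<not> q \<ge> int Q"
    then have "real (Suc Q) powr (- \<sigma>) \<le> real_of_int q powr (- \<sigma>)"
      using dio hq(2) by (intro powr_mono2') (auto simp: diophantine_def)
    then show False using * dio by (auto simp: diophantine_def)
  qed
  moreover have "1 / real N \<le> 1 / of_int q" using hq(2,3) by (intro divide_left_mono) auto
  ultimately show thesis using that hq by force
qed

text \<open>As \<open>h\<close> is invertible modulo \<open>q\<close>, the residues are merely
  permuted: the orbit of a rational rotation meets every grid point exactly once.\<close>

lemma sum_affine_mod:
  fixes G :: "int \<Rightarrow> real"
  assumes "coprime h q" "q > 0"
  shows "(\<Sum>j\<in>{0..<q}. G ((p + j * h) mod q)) = (\<Sum>j\<in>{0..<q}. G j)"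
proof -
  have inj: "inj_on (\<lambda>j. (p + j * h) mod q) {0..<q}"
  proof (rule inj_onI)
    fix i j assume ij: "i \<in> {0..<q}" "j \<in> {0..<q}" "(p + i * h) mod q = (p + j * h) mod q"
    then have "q dvd (i - j) * h" by (simp add: mod_eq_dvd_iff algebra_simps)
    then have "q dvd i - j" using assms(1) by (simp add: coprime_dvd_mult_left_iff coprime_commute)
    then show "i = j" using ij(1,2) by (metis mod_eq_dvd_iff mod_pos_pos_trivial atLeastLessThan_iff)
  qed
  have "(\<lambda>j. (p + j * h) mod q) ` {0..<q} = {0..<q}"
    using assms(2) by (intro endo_inj_surj inj) auto
  then have "bij_betw (\<lambda>j. (p + j * h) mod q) {0..<q} {0..<q}" using inj by (simp add: bij_betw_def)
  then show ?thesis by (rule sum.reindex_bij_betw)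
qed

lemma riemann_sum_bound:
  fixes g :: "real \<Rightarrow> real"
  assumes cont: "continuous_on UNIV g" and q: "q > 0" and d: "1 / real q < d"
    and osc: "\<And>x y. \<bar>x - y\<bar> < d \<Longrightarrow> \<bar>g x - g y\<bar> \<le> e" and r: "0 \<le> r" "r \<le> 1 / real q"
  shows "\<bar>(\<Sum>i<q. g (r + real i / real q)) - real q * integral {0..1} g\<bar> \<le> e * real q"
proof -
  have int: "g integrable_on {a..b}" for a b
    by (intro integrable_continuous_interval continuous_on_subset[OF cont]) auto
  have part: "integral {0..real n / real q} g = (\<Sum>i<n. integral {real i / real q..real (Suc i) / real q} g)" for n
  proof (induction n)
    case (Suc n)
    have "integral {0..real (Suc n) / real q} g = integral {0..real n / real q} g
        + integral {real n / real q..real (Suc n) / real q} g"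
      by (rule Henstock_Kurzweil_Integration.integral_combine[symmetric]) (auto intro: int divide_right_mono)
    then show ?case using Suc by simp
  qed simp
  have piece: "\<bar>g (r + real i / real q) / real q - integral {real i / real q..real (Suc i) / real q} g\<bar> \<le> e / real q" for i
  proof -
    have len: "real (Suc i) / real q - real i / real q = 1 / real q" using q by (simp add: field_simps)
    have le: "real i / real q \<le> real (Suc i) / real q" by (simp add: divide_right_mono)
    have "norm (integral {real i / real q..real (Suc i) / real q} (\<lambda>x. g (r + real i / real q) - g x))
        \<le> e * (real (Suc i) / real q - real i / real q)"
    proof (rule integral_bound[OF le])
      show "continuous_on {real i / real q..real (Suc i) / real q} (\<lambda>x. g (r + real i / real q) - g x)"
        by (intro continuous_intros continuous_on_subset[OF cont]) auto
      fix x assume x: "x \<in> {real i / real q..real (Suc i) / real q}"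
      then have "x \<le> real i / real q + 1 / real q" "real i / real q \<le> x" using len by auto
      then have "\<bar>(r + real i / real q) - x\<bar> < d" using d r by linarith
      then show "norm (g (r + real i / real q) - g x) \<le> e" using osc by auto
    qed
    moreover have "integral {real i / real q..real (Suc i) / real q} (\<lambda>x. g (r + real i / real q) - g x)
        = g (r + real i / real q) / real q - integral {real i / real q..real (Suc i) / real q} g"
      by (subst Henstock_Kurzweil_Integration.integral_diff) (use len le in \<open>auto intro: int\<close>)
    ultimately show ?thesis using len by (metis real_norm_def times_divide_eq_right mult.right_neutral)
  qed
  have "integral {0..1} g = (\<Sum>i<q. integral {real i / real q..real (Suc i) / real q} g)"
    using part[of q] q by simp
  then have "\<bar>(\<Sum>i<q. g (r + real i / real q) / real q) - integral {0..1} g\<bar> \<le> (\<Sum>i<q. e / real q)"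
    unfolding sum_subtractf[symmetric] by (simp only: sum_subtractf[symmetric])
      (rule order_trans[OF sum_abs sum_mono[OF piece]])
  also have "\<dots> = e" using q by simp
  finally have "real q * \<bar>(\<Sum>i<q. g (r + real i / real q)) / real q - integral {0..1} g\<bar> \<le> real q * e"
    by (intro mult_left_mono) (auto simp: sum_divide_distrib)
  also have "real q * \<bar>(\<Sum>i<q. g (r + real i / real q)) / real q - integral {0..1} g\<bar>
     = \<bar>real q * ((\<Sum>i<q. g (r + real i / real q)) / real q - integral {0..1} g)\<bar>" by (simp add: abs_mult)
  finally show ?thesis using q by (simp add: right_diff_distrib mult.commute)
qed

text \<open>For \<open>j < q\<close> the error \<open>j * \<bar>\<alpha> - h / q\<bar>\<close> stays
  below \<open>1 / q\<close>, so \<open>q\<close> successive orbit points shadow a translated grid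
  of mesh \<open>1 / q\<close>. One \<open>e\<close> pays for moving to the grid, the other for the
  Riemann sum.\<close>

lemma orbit_block_bound:
  fixes g :: "real \<Rightarrow> real"
  assumes per: "\<And>x. g (x + 1) = g x" and cont: "continuous_on UNIV g"
    and hq: "coprime h (int q)" "q > 0" "\<bar>of_nat q * \<alpha> - of_int h\<bar> < 1 / of_nat q"
    and d: "1 / real q < d" and osc: "\<And>x y. \<bar>x - y\<bar> < d \<Longrightarrow> \<bar>g x - g y\<bar> \<le> e"
  shows "\<bar>(\<Sum>j<q. g (x + real j * \<alpha>)) - real q * integral {0..1} g\<bar> \<le> 2 * e * real q"
proof -
  \<comment> \<open>Writing \<open>x = p / q + r\<close> puts the grid at offset \<open>r\<close>,
    with the orbit point of index \<open>j\<close> close to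
    \<open>r + (p + j * h) / q\<close>.\<close>
  define p where "p = \<lfloor>real q * x\<rfloor>"
  define r where "r = x - of_int p / real q"
  have r: "0 \<le> r" "r \<le> 1 / real q"
  proof -
    have "of_int p \<le> real q * x" "real q * x \<le> of_int p + 1" unfolding p_def by linarith+
    moreover have "r = (real q * x - of_int p) / real q"
      using hq(2) by (simp add: r_def diff_divide_distrib)
    ultimately show "0 \<le> r" "r \<le> 1 / real q" using hq(2) by (auto intro: divide_right_mono)
  qed
  define G where "G i = g (r + of_int i / real q)" for i :: int
  have Gmod: "G (i mod int q) = G i" for i
  proof -
    have "r + of_int i / real q = r + of_int (i mod int q) / real q + of_int (i div int q)"
    proof -
      have "real_of_int i = real q * of_int (i div int q) + of_int (i mod int q)"
        by (metis mult_div_mod_eq of_int_add of_int_mult of_int_of_nat_eq)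
      then show ?thesis using hq(2) by (simp add: add_divide_distrib)
    qed
    then show ?thesis unfolding G_def using periodic_int[of g, OF per] by metis
  qed
  have conv: "(\<Sum>j<q. f (int j)) = (\<Sum>j\<in>{0..<int q}. f j)" for f :: "int \<Rightarrow> real"
    by (rule sum.reindex_bij_witness[of _ nat int]) auto
  have "(\<Sum>j<q. G (p + int j * h)) = (\<Sum>j\<in>{0..<int q}. G ((p + j * h) mod int q))"
    unfolding conv[of "\<lambda>j. G (p + j * h)"] by (simp only: Gmod)
  also have "\<dots> = (\<Sum>j\<in>{0..<int q}. G j)" using hq by (intro sum_affine_mod) auto
  also have "\<dots> = (\<Sum>j<q. g (r + real j / real q))" using conv[of G] by (simp add: G_def)
  finally have 1: "(\<Sum>j<q. G (p + int j * h)) = (\<Sum>j<q. g (r + real j / real q))" .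
  have "\<bar>g (x + real j * \<alpha>) - G (p + int j * h)\<bar> \<le> e" if "j < q" for j
  proof -
    have "(x + real j * \<alpha>) - (r + of_int (p + int j * h) / real q) = (real j / real q) * (real q * \<alpha> - of_int h)"
      using hq(2) by (simp add: r_def field_simps)
    then have "\<bar>(x + real j * \<alpha>) - (r + of_int (p + int j * h) / real q)\<bar>
        = (real j / real q) * \<bar>real q * \<alpha> - of_int h\<bar>" by (simp add: abs_mult)
    also have "\<dots> \<le> 1 * (1 / real q)" using hq that by (intro mult_mono) auto
    finally show ?thesis unfolding G_def using osc d by auto
  qed
  then have "(\<Sum>j<q. \<bar>g (x + real j * \<alpha>) - G (p + int j * h)\<bar>) \<le> (\<Sum>j<q. e)"
    by (intro sum_mono) simp
  then have "\<bar>(\<Sum>j<q. g (x + real j * \<alpha>)) - (\<Sum>j<q. G (p + int j * h))\<bar> \<le> (\<Sum>j<q. e)"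
    unfolding sum_subtractf[symmetric] by (rule order_trans[OF sum_abs])
  moreover have "\<bar>(\<Sum>i<q. g (r + real i / real q)) - real q * integral {0..1} g\<bar> \<le> e * real q"
    by (rule riemann_sum_bound[OF cont hq(2) d osc r])
  ultimately show ?thesis using 1 by (simp add: algebra_simps)
qed

text \<open>Blocks of one fixed length \<open>q\<close> are peeled off. Each has error at most
  \<open>e * q\<close> wherever it starts, and fewer than \<open>q\<close> leftover points cost a
  constant. This constant is independent of the phase, which is what the later uses rely on.\<close>

theorem uniform_equidistribution:
  fixes g :: "real \<Rightarrow> real"
  assumes dio: "diophantine \<alpha> \<gamma> \<sigma>" and per: "\<And>x. g (x + 1) = g x"
    and cont: "continuous_on UNIV g" and e: "e > 0"
  obtains C where "C \<ge> 0"
    "\<And>n x. \<bar>(\<Sum>j<n. g (x + real j * \<alpha>)) - real n * integral {0..1} g\<bar> \<le> e * real n + C"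
proof -
  obtain B where B: "B > 0" "\<And>x. \<bar>g x\<bar> \<le> B" using periodic_bounded[OF per cont] by blast
  obtain d where d: "d > 0" "\<And>x y. \<bar>x - y\<bar> < d \<Longrightarrow> \<bar>g x - g y\<bar> < e / 2"
    using periodic_uniform[OF per cont, of "e / 2"] e by auto
  obtain Q :: nat where Q: "1 / d < real Q" using reals_Archimedean2 by blast
  obtain h q' where hq': "coprime h q'" "q' \<ge> int Q" "q' > 0" "\<bar>of_int q' * \<alpha> - of_int h\<bar> < 1 / of_int q'"
    using Dirichlet_large_denominator[OF dio] by blast
  define q where "q = nat q'"
  have q: "q > 0" "q \<ge> Q" and hq: "coprime h (int q)" "\<bar>of_nat q * \<alpha> - of_int h\<bar> < 1 / of_nat q"
    using hq' by (auto simp: q_def)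
  have "1 / d < real q" using Q q(2) by linarith
  then have qd: "1 / real q < d" using d(1) q(1) by (simp add: field_simps)
  define I where "I = integral {0..1} g"
  define S where "S n x = (\<Sum>j<n. g (x + real j * \<alpha>) - I)" for n x
  have I: "\<bar>I\<bar> \<le> B"
  proof -
    have "norm (integral {0..1} g) \<le> B * (1 - 0)"
      by (rule integral_bound) (use B(2) in \<open>auto intro: continuous_on_subset[OF cont]\<close>)
    then show ?thesis by (simp add: I_def)
  qed
  have bound: "\<bar>S n x\<bar> \<le> e * real n + real q * (2 * B)" for n x
  proof (induction n arbitrary: x rule: less_induct)
    case (less n)
    show ?case
    proof (cases "n < q")
      case True
      have "\<bar>S n x\<bar> \<le> (\<Sum>j<n. 2 * B)" unfolding S_def
        by (rule order_trans[OF sum_abs], rule sum_mono) (smt (verit) B(2) I)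
      also have "\<dots> \<le> real q * (2 * B)" using True B(1) by (auto intro: mult_right_mono)
      finally show ?thesis using e by (simp add: add_increasing)
    next
      case False
      define m where "m = n - q"
      have n: "n = q + m" using False by (simp add: m_def)
      have "S n x = S q x + S m (x + real q * \<alpha>)"
        unfolding S_def n lessThan_atLeast0 by (subst sum.atLeastLessThan_concat[symmetric, of 0 q])
          (auto simp: sum.shift_bounds_nat_ivl[of _ 0 q m, simplified] algebra_simps)
      moreover have "\<bar>S q x\<bar> \<le> e * real q"
        using orbit_block_bound[OF per cont hq(1) q(1) hq(2) qd, of "e / 2" x] d(2)
        by (simp add: S_def I_def sum_subtractf less_imp_le)
      moreover have "\<bar>S m (x + real q * \<alpha>)\<bar> \<le> e * real m + real q * (2 * B)"
        using q(1) n by (intro less) auto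
      ultimately show ?thesis unfolding n by (simp add: algebra_simps)
    qed
  qed
  show thesis
    by (rule that[of "real q * (2 * B)"]) (use bound B(1) in \<open>auto simp: S_def I_def sum_subtractf\<close>)
qed

section \<open>Orbits near the zeros of the sine\<close>

lemma orbit_count_bound:
  assumes dio: "diophantine \<alpha> \<gamma> \<sigma>" and r: "r > 0"
  shows "real (card {l \<in> {a..<a + int n}. \<bar>sin (pi * (x + of_int l * \<alpha>))\<bar> < r})
    \<le> 2 * real n * (2 * r / \<gamma>) powr (1 / \<sigma>) + 1" (is "real (card ?S) \<le> _")
proof -
  \<comment> \<open>\<open>1 / t\<close> is the distance between sites at which the Diophantine
    lower bound has dropped to \<open>2 * r\<close>.\<close>
  define t where "t = (2 * r / \<gamma>) powr (1 / \<sigma>)"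
  have \<gamma>: "\<gamma> > 0" "\<sigma> > 0" using dio by (auto simp: diophantine_def)
  then have t: "t > 0" using r by (simp add: t_def)
  have fin: "finite ?S" by (rule finite_subset[of _ "{a..<a + int n}"]) auto
  show ?thesis
  proof (cases "t \<le> 1")
    case False
    have "card ?S \<le> card {a..<a + int n}" by (rule card_mono) auto
    then have "real (card ?S) \<le> real n" by simp
    also have "\<dots> \<le> real n * t" using False by (simp add: mult_le_cancel_left1)
    also have "\<dots> \<le> 2 * real n * t + 1" using t by simp
    finally show ?thesis by (simp add: t_def)
  next
    case True
    \<comment> \<open>Any \<open>M\<close> consecutive sites contain at most one point of the set, since two of them would
      violate the Diophantine condition.\<close>
    define M where "M = nat \<lfloor>1 / t\<rfloor>"
    have t1: "1 / t \<ge> 1" using True t by simp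
    then have M1: "M \<ge> 1" unfolding M_def by linarith
    have Mle: "real M \<le> 1 / t" unfolding M_def by (rule of_nat_floor) (use t1 in linarith)
    have "1 / t < real M + 1" using t1 unfolding M_def by linarith
    then have Mge: "1 / t \<le> 2 * real M" using M1 by linarith
    have sep: "int M \<le> \<bar>l - l'\<bar>" if "l \<in> ?S" "l' \<in> ?S" "l \<noteq> l'" for l l'
    proof (rule ccontr)
      assume *: "\<not> int M \<le> \<bar>l - l'\<bar>"
      let ?A = "pi * (x + of_int l * \<alpha>)" and ?B = "pi * (x + of_int l' * \<alpha>)"
      have "\<bar>sin (?A - ?B)\<bar> \<le> \<bar>sin ?A\<bar> * \<bar>cos ?B\<bar> + \<bar>cos ?A\<bar> * \<bar>sin ?B\<bar>"
        unfolding sin_diff by (metis abs_mult abs_triangle_ineq4)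
      also have "\<dots> \<le> \<bar>sin ?A\<bar> * 1 + 1 * \<bar>sin ?B\<bar>"
        by (intro add_mono mult_mono) auto
      also have "\<dots> < 2 * r" using that by auto
      finally have 1: "\<bar>sin (pi * (of_int (l - l') * \<alpha>))\<bar> < 2 * r" by (simp add: algebra_simps)
      have "real_of_int \<bar>l - l'\<bar> < 1 / t" using * Mle by linarith
      moreover have "real_of_int \<bar>l - l'\<bar> > 0" using that by simp
      ultimately have "(1 / t) powr (- \<sigma>) \<le> real_of_int \<bar>l - l'\<bar> powr (- \<sigma>)"
        using \<gamma> by (intro powr_mono2') auto
      moreover have "(1 / t) powr (- \<sigma>) = 2 * r / \<gamma>"
      proof -
        have "(1 / t) powr (- \<sigma>) = t powr \<sigma>" using t by (simp add: powr_divide powr_minus_divide)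
        also have "\<dots> = (2 * r / \<gamma>) powr 1" unfolding t_def powr_powr using \<gamma> by simp
        finally show ?thesis using r \<gamma> by simp
      qed
      ultimately have "2 * r \<le> \<gamma> * real_of_int \<bar>l - l'\<bar> powr (- \<sigma>)" using \<gamma> by (simp add: field_simps)
      also have "\<dots> \<le> \<bar>sin (pi * (of_int (l - l') * \<alpha>))\<bar>"
        using dio that(3) unfolding diophantine_def by (metis eq_iff_diff_eq_0 of_int_abs)
      finally show False using 1 by simp
    qed
    have inj: "inj_on (\<lambda>l. (l - a) div int M) ?S"
    proof (rule inj_onI)
      fix l l' assume l: "l \<in> ?S" "l' \<in> ?S" and eq: "(l - a) div int M = (l' - a) div int M"
      have "\<bar>l - l'\<bar> < int M"
      proof -
        have "l - a = int M * ((l - a) div int M) + (l - a) mod int M"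
          "l' - a = int M * ((l - a) div int M) + (l' - a) mod int M" using eq by (metis mult_div_mod_eq)+
        moreover have "0 \<le> (l - a) mod int M" "(l - a) mod int M < int M"
          "0 \<le> (l' - a) mod int M" "(l' - a) mod int M < int M" using M1 by auto
        ultimately show ?thesis by linarith
      qed
      then show "l = l'" using sep[OF l] by linarith
    qed
    have "(\<lambda>l. (l - a) div int M) ` ?S \<subseteq> {0..int n div int M}"
      using M1 by (auto simp: pos_imp_zdiv_nonneg_iff intro!: zdiv_mono1)
    then have "card ?S \<le> card {0..int n div int M}"
      by (intro card_inj_on_le[OF inj]) auto
    also have "\<dots> = n div M + 1"
    proof -
      have "int n div int M = int (n div M)" by (simp add: zdiv_int)
      then have "card {0..int n div int M} = nat (int (n div M) + 1)" by simp
      then show ?thesis by simp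
    qed
    finally have "real (card ?S) \<le> real (n div M) + 1" by linarith
    also have "real (n div M) \<le> real n / real M"
    proof -
      have "real (n div M * M) \<le> real n" by (intro of_nat_mono div_times_less_eq_dividend)
      then show ?thesis using M1 by (simp add: pos_le_divide_eq)
    qed
    also have "real n / real M = real n * (1 / real M)" by simp
    also have "\<dots> \<le> real n * (2 * t)"
      using Mge t M1 by (intro mult_left_mono) (auto simp: field_simps)
    finally show ?thesis by (simp add: t_def mult_ac)
  qed
qed

text \<open>Each level \<open>\<delta> / 2 ^ i\<close> lying above \<open>s\<close> accounts for one
  \<open>ln 2\<close> of the gap. Summed over an orbit, the right-hand side turns into counts of
  near-zeros.\<close>

lemma ln_truncation_le:
  fixes s \<delta> :: real
  assumes "0 < s" "0 < \<delta>" "\<delta> / 2 ^ K \<le> s"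
  shows "ln (max s \<delta>) - ln s \<le> ln 2 * (\<Sum>i<K. if s < \<delta> / 2 ^ i then 1 else 0)"
  using assms(3)
proof (induction K)
  case 0
  then have "max s \<delta> = s" by simp
  then show ?case by simp
next
  case (Suc K)
  show ?case
  proof (cases "\<delta> / 2 ^ K \<le> s")
    case True then show ?thesis using Suc.IH by (simp add: distrib_left)
  next
    case False
    have ind: "s < \<delta> / 2 ^ i" if "i < Suc K" for i
    proof -
      have "\<delta> / 2 ^ K \<le> \<delta> / 2 ^ i" using that assms by (intro divide_left_mono power_increasing) auto
      then show ?thesis using False by linarith
    qed
    have "ln (\<delta> / 2 ^ Suc K) \<le> ln s" using assms Suc.prems by (subst ln_le_cancel_iff) auto
    moreover have "ln (\<delta> / 2 ^ Suc K) = ln \<delta> - real (Suc K) * ln 2"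
      using assms by (simp only: ln_div ln_realpow) (simp add: ln_div ln_realpow)
    moreover have "max s \<delta> = \<delta>" using ind[of 0] by simp
    moreover have "(\<Sum>i<Suc K. if s < \<delta> / 2 ^ i then 1 else 0) = (\<Sum>i<Suc K. 1::real)"
      using ind by (intro sum.cong) auto
    ultimately show ?thesis by (simp only: sum_constant card_lessThan) (simp add: mult.commute)
  qed
qed

text \<open>The cut at \<delta> makes the logarithm continuous, so that equidistribution applies. It
  only increases the value: upper bounds survive it for free, lower bounds need the counting
  argument.\<close>

definition truncated_log_sin :: "real \<Rightarrow> real \<Rightarrow> real" where
  "truncated_log_sin \<delta> x = ln (max \<bar>sin (pi * x)\<bar> \<delta>)"

lemma log_sin_orbit_lower:
  assumes dio: "diophantine \<alpha> \<gamma> \<sigma>" and e: "e > 0"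
  obtains \<delta> where "0 < \<delta>" "\<delta> < 1"
    "\<And>a n J K x. J \<subseteq> {a..<a + int n} \<Longrightarrow> (\<And>l. l \<in> J \<Longrightarrow> 1 / 2 ^ K \<le> \<bar>sin (pi * (x + of_int l * \<alpha>))\<bar>) \<Longrightarrow>
      (\<Sum>l\<in>J. truncated_log_sin \<delta> (x + of_int l * \<alpha>) - ln \<bar>sin (pi * (x + of_int l * \<alpha>))\<bar>)
        \<le> e * real n + real K"
proof -
  have \<gamma>: "\<gamma> > 0" "\<sigma> > 0" using dio by (auto simp: diophantine_def)
  define \<rho> where "\<rho> = (1/2::real) powr (1 / \<sigma>)"
  have \<rho>: "0 < \<rho>" "\<rho> < 1"
    using \<gamma> powr_less_mono2[of "1/\<sigma>" "1/2" "1::real"] by (auto simp: \<rho>_def)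
  define A where "A \<delta> = 2 * (2 * \<delta> / \<gamma>) powr (1 / \<sigma>) / (1 - \<rho>)" for \<delta>
  have "((\<lambda>\<delta>. (2 * \<delta> / \<gamma>) powr (1 / \<sigma>)) \<longlongrightarrow> 0) (at_right 0)"
  proof -
    have "((\<lambda>\<delta>. 2 * \<delta> / \<gamma>) \<longlongrightarrow> 0) (at_right 0)" using \<gamma> by (auto intro!: tendsto_eq_intros)
    moreover have "\<forall>\<^sub>F \<delta> in at_right 0. 2 * \<delta> / \<gamma> \<ge> 0"
      unfolding eventually_at_right_field using \<gamma> by (auto intro!: exI[of _ 1])
    ultimately show ?thesis using \<gamma> by (intro tendsto_zero_powrI[where b = "1/\<sigma>"]) auto
  qed
  then have "((\<lambda>\<delta>. 2 / (1 - \<rho>) * (2 * \<delta> / \<gamma>) powr (1 / \<sigma>)) \<longlongrightarrow> 0) (at_right 0)"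
    by (rule tendsto_mult_right_zero)
  then have "(A \<longlongrightarrow> 0) (at_right 0)" unfolding A_def by simp
  then have "\<forall>\<^sub>F \<delta> in at_right 0. A \<delta> < e" using e by (rule order_tendstoD(2))
  moreover have "\<forall>\<^sub>F \<delta> in at_right (0::real). \<delta> \<in> {0<..<1}" by (rule eventually_at_right_real) simp
  ultimately have "\<forall>\<^sub>F \<delta> in at_right 0. A \<delta> < e \<and> \<delta> \<in> {0<..<1}" by (rule eventually_conj)
  from eventually_happens[OF this] obtain \<delta> where \<delta>: "A \<delta> < e" "0 < \<delta>" "\<delta> < 1"
    by (auto simp: trivial_limit_at_right_real)
  show thesis
  proof (rule that[OF \<delta>(2,3)])
    fix a n J K x
    assume J: "J \<subseteq> {a..<a + int n}" and lo: "\<And>l. l \<in> J \<Longrightarrow> 1 / 2 ^ K \<le> \<bar>sin (pi * (x + of_int l * \<alpha>))\<bar>"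
    let ?s = "\<lambda>l::int. \<bar>sin (pi * (x + of_int l * \<alpha>))\<bar>"
    have finJ: "finite J" using J by (rule finite_subset) auto
    have "(\<Sum>l\<in>J. truncated_log_sin \<delta> (x + of_int l * \<alpha>) - ln (?s l))
      \<le> (\<Sum>l\<in>J. ln 2 * (\<Sum>i<K. if ?s l < \<delta> / 2 ^ i then 1 else 0))"
    proof (rule sum_mono)
      fix l assume l: "l \<in> J"
      have "0 < (1::real) / 2 ^ K" by simp
      then have "0 < ?s l" using lo[OF l] by linarith
      moreover have "\<delta> / 2 ^ K \<le> 1 / 2 ^ K" using \<delta> by (intro divide_right_mono) auto
      ultimately show "truncated_log_sin \<delta> (x + of_int l * \<alpha>) - ln (?s l)
          \<le> ln 2 * (\<Sum>i<K. if ?s l < \<delta> / 2 ^ i then 1 else 0)"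
        unfolding truncated_log_sin_def using lo[OF l] \<delta> by (intro ln_truncation_le) auto
    qed
    also have "\<dots> = ln 2 * (\<Sum>i<K. \<Sum>l\<in>J. if ?s l < \<delta> / 2 ^ i then 1 else 0)"
      unfolding sum_distrib_left[symmetric] by (subst sum.swap) simp
    also have "\<dots> \<le> 1 * (\<Sum>i<K. \<Sum>l\<in>J. if ?s l < \<delta> / 2 ^ i then 1 else 0)"
      by (intro mult_right_mono sum_nonneg) (auto intro: less_imp_le[OF ln_2_less_1])
    also have "\<dots> \<le> 1 * (\<Sum>i<K. 2 * real n * (2 * \<delta> / \<gamma>) powr (1 / \<sigma>) * \<rho> ^ i + 1)"
      unfolding mult_1
    proof (rule sum_mono)
      fix i assume "i \<in> {..<K}"
      have "(\<Sum>l\<in>J. if ?s l < \<delta> / 2 ^ i then 1 else 0) = real (card {l \<in> J. ?s l < \<delta> / 2 ^ i})"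
        using finJ by (simp add: sum.If_cases Int_def)
      also have "\<dots> \<le> real (card {l \<in> {a..<a + int n}. ?s l < \<delta> / 2 ^ i})"
      proof (rule of_nat_mono, rule card_mono)
        show "finite {l \<in> {a..<a + int n}. ?s l < \<delta> / 2 ^ i}"
          by (rule finite_subset[of _ "{a..<a + int n}"]) auto
      qed (use J in auto)
      also have "\<dots> \<le> 2 * real n * (2 * (\<delta> / 2 ^ i) / \<gamma>) powr (1 / \<sigma>) + 1"
        using \<delta> by (intro orbit_count_bound[OF dio]) auto
      also have "(2 * (\<delta> / 2 ^ i) / \<gamma>) powr (1 / \<sigma>) = (2 * \<delta> / \<gamma>) powr (1 / \<sigma>) * \<rho> ^ i"
      proof -
        have "2 * (\<delta> / 2 ^ i) / \<gamma> = (2 * \<delta> / \<gamma>) * (1/2) ^ i" by (simp add: power_divide)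
        then have "(2 * (\<delta> / 2 ^ i) / \<gamma>) powr (1 / \<sigma>) = (2 * \<delta> / \<gamma>) powr (1 / \<sigma>) * ((1/2) ^ i) powr (1 / \<sigma>)"
          using \<delta> \<gamma> powr_mult[of "2 * \<delta> / \<gamma>" "(1/2) ^ i" "1 / \<sigma>"] by simp
        also have "((1/2::real) ^ i) powr (1 / \<sigma>) = \<rho> ^ i"
        proof -
          have "(1/2::real) ^ i = (1/2) powr real i" "\<rho> ^ i = \<rho> powr real i"
            using \<rho> by (simp_all add: powr_realpow)
          then show ?thesis by (simp only: \<rho>_def powr_powr mult.commute)
        qed
        finally show ?thesis .
      qed
      finally show "(\<Sum>l\<in>J. if ?s l < \<delta> / 2 ^ i then 1 else 0)
          \<le> 2 * real n * (2 * \<delta> / \<gamma>) powr (1 / \<sigma>) * \<rho> ^ i + 1" by (simp add: mult.assoc)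
    qed
    also have "\<dots> = 2 * real n * (2 * \<delta> / \<gamma>) powr (1 / \<sigma>) * (\<Sum>i<K. \<rho> ^ i) + real K"
      by (simp add: sum.distrib sum_distrib_left)
    also have "\<dots> \<le> 2 * real n * (2 * \<delta> / \<gamma>) powr (1 / \<sigma>) * (1 / (1 - \<rho>)) + real K"
    proof -
      have "(\<Sum>i<K. \<rho> ^ i) \<le> (\<Sum>i. \<rho> ^ i)" using \<rho> by (intro sum_le_suminf summable_geometric) auto
      also have "\<dots> = 1 / (1 - \<rho>)" using \<rho> by (simp add: suminf_geometric)
      finally show ?thesis by (intro add_right_mono mult_left_mono) auto
    qed
    also have "\<dots> = A \<delta> * real n + real K" by (simp add: A_def)
    also have "\<dots> \<le> e * real n + real K" using \<delta> by (intro add_right_mono mult_right_mono) auto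
    finally show "(\<Sum>l\<in>J. truncated_log_sin \<delta> (x + of_int l * \<alpha>) - ln (?s l)) \<le> e * real n + real K" .
  qed
qed

lemma truncated_log_sin_periodic: "truncated_log_sin \<delta> (x + 1) = truncated_log_sin \<delta> x"
  using abs_sin_pi_add_int[of x 1] by (simp add: truncated_log_sin_def)

lemma truncated_log_sin_continuous: "\<delta> > 0 \<Longrightarrow> continuous_on UNIV (truncated_log_sin \<delta>)"
  unfolding truncated_log_sin_def by (intro continuous_intros) (auto simp: max_def)

lemma uniform_equidistribution_int:
  fixes g :: "real \<Rightarrow> real"
  assumes dio: "diophantine \<alpha> \<gamma> \<sigma>" and per: "\<And>x. g (x + 1) = g x"
    and cont: "continuous_on UNIV g" and e: "e > 0"
  obtains C where "C \<ge> 0"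
    "\<And>n x a. \<bar>(\<Sum>l\<in>{a..<a + int n}. g (x + of_int l * \<alpha>)) - real n * integral {0..1} g\<bar> \<le> e * real n + C"
proof -
  obtain C where C: "C \<ge> 0"
    "\<And>n x. \<bar>(\<Sum>j<n. g (x + real j * \<alpha>)) - real n * integral {0..1} g\<bar> \<le> e * real n + C"
    using uniform_equidistribution[OF dio per cont e] by blast
  have "(\<Sum>l\<in>{a..<a + int n}. g (x + of_int l * \<alpha>)) = (\<Sum>j<n. g ((x + of_int a * \<alpha>) + real j * \<alpha>))"
    for a n x
    by (rule sum.reindex_bij_witness[of _ "\<lambda>j. a + int j" "\<lambda>l. nat (l - a)"]) (auto simp: algebra_simps)
  then show thesis using that[OF C(1)] C(2) by simp
qed

section \<open>Lyapunov exponents and continuants\<close>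

text \<open>The limit is the infimum of the averages. For the uniform bound, a block length
  \<open>m\<close> with nearly optimal average is fixed: the values of \<open>f m\<close> at
  successive blocks form an orbit sum for the frequency \<open>m * \<alpha>\<close>, which is again
  Diophantine. Nonnegativity keeps the infimum finite.\<close>

theorem subadditive_cocycle:
  fixes f :: "nat \<Rightarrow> real \<Rightarrow> real"
  assumes dio: "diophantine \<alpha> \<gamma> \<sigma>"
    and nonneg: "\<And>n x. 0 \<le> f n x"
    and per: "\<And>n x. f n (x + 1) = f n x" and cont: "\<And>n. continuous_on UNIV (f n)"
    and sub: "\<And>n m x. f (n + m) x \<le> f n x + f m (x + real n * \<alpha>)"
  obtains L where "(\<lambda>n. integral {0..1} (f n) / real n) \<longlonglongrightarrow> L"
    "\<And>n. real n * L \<le> integral {0..1} (f n)"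
    "\<And>e. e > 0 \<Longrightarrow> \<exists>C. \<forall>n x. f n x \<le> real n * (L + e) + C"
proof -
  define a where "a n = integral {0..1} (f n)" for n
  have int: "f n integrable_on {0..1}" for n
    by (intro integrable_continuous_interval continuous_on_subset[OF cont]) auto
  have a0: "0 \<le> a n" for n unfolding a_def by (intro integral_nonneg int nonneg)
  define L where "L = (INF n\<in>{1..}. a n / real n)"
  have bdd: "bdd_below ((\<lambda>n. a n / real n) ` {1..})" by (rule bdd_belowI[of _ 0]) (use a0 in auto)
  have L_le: "L \<le> a n / real n" if "n \<ge> 1" for n unfolding L_def using bdd that by (intro cINF_lower) auto
  have L0: "L \<ge> 0" unfolding L_def by (intro cINF_greatest) (use a0 in auto)
  have lower: "real n * L \<le> a n" for n
    using L_le[of n] a0[of n] by (cases "n = 0") (auto simp: field_simps)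
  have upper: "\<exists>C. \<forall>n x. f n x \<le> real n * (L + e) + C" if e: "e > 0" for e
  proof -
    have "L < L + e / 2" using e by simp
    then obtain m where m: "m \<ge> 1" "a m / real m < L + e / 2"
      unfolding L_def using bdd by (subst (asm) cINF_less_iff) auto
    have dio': "diophantine (real m * \<alpha>) (\<gamma> * real m powr (- \<sigma>)) \<sigma>"
      using diophantine_mult[OF dio, of m] m by simp
    have e2: "e / 2 > 0" using e by simp
    obtain C where C: "C \<ge> 0"
      "\<And>n x. \<bar>(\<Sum>j<n. f m (x + real j * (real m * \<alpha>))) - real n * integral {0..1} (f m)\<bar> \<le> e / 2 * real n + C"
      using uniform_equidistribution[OF dio' per[of m] cont[of m] e2] by blast
    have "\<exists>B. \<forall>x. f r x \<le> B" for r
      using periodic_bounded[of "f r", OF per cont] by (metis abs_le_D1)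
    then obtain B where B: "\<And>r x. f r x \<le> B r" by metis
    define B' where "B' = (\<Sum>r<m. \<bar>B r\<bar>)"
    have B': "f r x \<le> B'" if "r < m" for r x
    proof -
      have "\<bar>B r\<bar> \<le> B'" unfolding B'_def using that by (intro member_le_sum) auto
      then show ?thesis using B[of r x] by linarith
    qed
    have blocks: "f (q * m + r) x \<le> (\<Sum>j<q. f m (x + real j * (real m * \<alpha>))) + f r (x + real q * (real m * \<alpha>))"
      for q r x
    \<comment> \<open>The remainder \<open>r\<close> is not restricted to be below \<open>m\<close>,
      so that the induction hypothesis can be used with a whole further block counted as part of
      it.\<close>
    proof (induction q arbitrary: r)
      case (Suc q)
      have "f (Suc q * m + r) x = f (q * m + (m + r)) x" by (simp add: algebra_simps)
      also have "\<dots> \<le> (\<Sum>j<q. f m (x + real j * (real m * \<alpha>))) + f (m + r) (x + real q * (real m * \<alpha>))"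
        by (rule Suc.IH)
      also have "f (m + r) (x + real q * (real m * \<alpha>))
          \<le> f m (x + real q * (real m * \<alpha>)) + f r (x + real q * (real m * \<alpha>) + real m * \<alpha>)" by (rule sub)
      finally show ?case by (simp add: algebra_simps)
    qed simp
    have "f n x \<le> real n * (L + e) + (C + B')" for n x
    proof -
      define q r where "q = n div m" and "r = n mod m"
      have n: "n = q * m + r" and r: "r < m" using m(1) by (auto simp: q_def r_def)
      have "f n x \<le> (\<Sum>j<q. f m (x + real j * (real m * \<alpha>))) + f r (x + real q * (real m * \<alpha>))"
        unfolding n by (rule blocks)
      also have "\<dots> \<le> (real q * a m + (e / 2 * real q + C)) + B'"
        using C(2)[where n = q and x = x] B'[OF r] unfolding a_def by (intro add_mono) (auto simp: abs_le_iff)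
      also have "real q * a m \<le> real q * (real m * (L + e / 2))"
        using m by (intro mult_left_mono) (auto simp: field_simps)
      also have "real q * (real m * (L + e / 2)) + (e / 2 * real q + C) + B'
          \<le> real q * (real m * (L + e / 2)) + (e / 2 * (real q * real m) + C) + B'"
      proof -
        have "real q * 1 \<le> real q * real m" using m by (intro mult_left_mono) auto
        then have "e / 2 * real q \<le> e / 2 * (real q * real m)" using e by (intro mult_left_mono) auto
        then show ?thesis by linarith
      qed
      also have "\<dots> = real (q * m) * (L + e) + (C + B')" by (simp add: algebra_simps)
      also have "\<dots> \<le> real n * (L + e) + (C + B')"
        using n L0 e by (intro add_right_mono mult_right_mono) auto
      finally show ?thesis by simp
    qed
    then show ?thesis by blast
  qed
  have "(\<lambda>n. a n / real n) \<longlonglongrightarrow> L"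
  proof (rule tendstoI)
    fix e :: real assume e: "e > 0"
    obtain C where C: "\<And>n x. f n x \<le> real n * (L + e / 2) + C" using upper[of "e/2"] e by auto
    have up: "a n \<le> real n * (L + e / 2) + C" for n
    proof -
      have "a n \<le> integral {0..1} (\<lambda>x::real. real n * (L + e / 2) + C)"
        unfolding a_def by (intro integral_le int C) auto
      then show ?thesis by simp
    qed
    have "(\<lambda>n. \<bar>C\<bar> / real n) \<longlonglongrightarrow> 0" by real_asymp
    then have "\<forall>\<^sub>F n in sequentially. \<bar>C\<bar> / real n < e / 2" using e by (intro order_tendstoD(2)) auto
    then show "\<forall>\<^sub>F n in sequentially. dist (a n / real n) L < e"
      using eventually_gt_at_top[of 0]
    proof eventually_elim
      case (elim n)
      have "a n / real n \<le> (real n * (L + e / 2) + C) / real n" using up by (intro divide_right_mono) auto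
      also have "\<dots> = L + e / 2 + C / real n" using elim by (simp add: add_divide_distrib)
      also have "C / real n \<le> \<bar>C\<bar> / real n" by (intro divide_right_mono) auto
      finally have "a n / real n < L + e" using elim by linarith
      moreover have "L \<le> a n / real n" using elim by (intro L_le) auto
      ultimately show ?case by (simp add: dist_real_def)
    qed
  qed
  then show thesis using that lower upper unfolding a_def by blast
qed

text \<open>Expansion along the last row of the determinant of the tridiagonal matrix with diagonal
  \<open>e s\<close>, ..., \<open>e (s + n - 1)\<close> and off-diagonal entries -1. With
  \<open>e j = E - V \<theta> j\<close> it is the determinant of the box of \<open>n\<close> sites
  starting at \<open>s\<close>.\<close>

fun continuant :: "(int \<Rightarrow> real) \<Rightarrow> int \<Rightarrow> nat \<Rightarrow> real" where
  "continuant e s 0 = 1"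
| "continuant e s (Suc 0) = e s"
| "continuant e s (Suc (Suc n)) = e (s + int (Suc n)) * continuant e s (Suc n) - continuant e s n"

lemma continuant_left:
  "continuant e s (Suc (Suc n)) = e s * continuant e (s + 1) (Suc n) - continuant e (s + 2) n"
proof (induction n rule: induct_nat_012)
  case (ge2 n)
  have "continuant e s (Suc (Suc (Suc (Suc n)))) = e (s + int (Suc (Suc (Suc n)))) * continuant e s (Suc (Suc (Suc n)))
     - continuant e s (Suc (Suc n))" by simp
  then show ?case unfolding ge2 by (simp add: algebra_simps)
qed (auto simp: algebra_simps)

lemma continuant_shift: "continuant (\<lambda>j. e (j + c)) s n = continuant e (s + c) n"
proof (induction n rule: induct_nat_012)
  case (ge2 n)
  then show ?case by (simp add: add_ac)
qed simp_all

text \<open>A box read backwards has the same determinant. For an even potential this makes the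
  determinant an even function of the phase of the center.\<close>

lemma continuant_reflect: "continuant (\<lambda>j. e (c - j)) s n = continuant e (c - s - int n + 1) n"
proof (induction n rule: induct_nat_012)
  case (ge2 n)
  have "continuant (\<lambda>j. e (c - j)) s (Suc (Suc n))
     = e (c - (s + int (Suc n))) * continuant e (c - s - int (Suc n) + 1) (Suc n) - continuant e (c - s - int n + 1) n"
    using ge2 by simp
  also have "\<dots> = continuant e (c - s - int (Suc (Suc n)) + 1) (Suc (Suc n))"
    by (subst continuant_left) (simp add: algebra_simps)
  finally show ?case .
qed auto

text \<open>Cramer's rule for the box problem, without division. There are \<open>i\<close> sites to
  the left of \<open>a + i\<close> and \<open>r\<close> to the right; each boundary value is
  weighted by the determinant of the part on the opposite side of the site.\<close>

lemma continuant_boundary: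
  fixes u :: "int \<Rightarrow> real"
  assumes u: "\<And>j. u (j + 1) + u (j - 1) = e j * u j"
  shows "continuant e a (Suc i + r) * u (a + int i)
    = continuant e (a + int i + 1) r * u (a - 1) + continuant e a i * u (a + int i + 1 + int r)"
proof (induction r rule: induct_nat_012)
  case 0
  show ?case
  proof (induction i)
    case 0 show ?case using u[of a] by (simp add: add.commute)
  next
    case (Suc i)
    have "continuant e a (Suc (Suc i)) * u (a + int (Suc i))
      = continuant e a (Suc i) * (e (a + int (Suc i)) * u (a + int (Suc i))) - continuant e a i * u (a + int (Suc i))"
      by (simp add: algebra_simps)
    also have "e (a + int (Suc i)) * u (a + int (Suc i)) = u (a + int (Suc i) + 1) + u (a + int i)"
      using u[of "a + int (Suc i)"] by simp
    finally show ?case using Suc by (simp add: algebra_simps)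
  qed
  note zero = this
  case 1
  have "continuant e a (Suc (Suc i)) * u (a + int i)
      = e (a + int i + 1) * (continuant e a (Suc i) * u (a + int i)) - continuant e a i * u (a + int i)"
    by (simp add: algebra_simps)
  also have "continuant e a (Suc i) * u (a + int i) = u (a - 1) + continuant e a i * u (a + int i + 1)"
    using zero by simp
  also have "e (a + int i + 1) * (u (a - 1) + continuant e a i * u (a + int i + 1)) - continuant e a i * u (a + int i)
      = e (a + int i + 1) * u (a - 1) + continuant e a i * (e (a + int i + 1) * u (a + int i + 1) - u (a + int i))"
    by (simp add: algebra_simps)
  also have "e (a + int i + 1) * u (a + int i + 1) - u (a + int i) = u (a + int i + 2)"
    using u[of "a + int i + 1"] by (simp add: add.commute)
  finally show ?case by (simp add: add.commute)
next
  case (ge2 r)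
  have "continuant e a (Suc i + Suc (Suc r)) * u (a + int i)
      = e (a + int i + int r + 2) * (continuant e a (Suc i + Suc r) * u (a + int i)) - continuant e a (Suc i + r) * u (a + int i)"
    by (simp add: algebra_simps)
  also have "\<dots> = (e (a + int i + int r + 2) * continuant e (a + int i + 1) (Suc r) - continuant e (a + int i + 1) r) * u (a - 1)
      + continuant e a i * (e (a + int i + int r + 2) * u (a + int i + 1 + int (Suc r)) - u (a + int i + 1 + int r))"
    unfolding ge2 by (simp add: algebra_simps)
  also have "e (a + int i + int r + 2) * u (a + int i + 1 + int (Suc r)) - u (a + int i + 1 + int r)
      = u (a + int i + 1 + int (Suc (Suc r)))"
    using u[of "a + int i + int r + 2"] by (simp add: algebra_simps)
  also have "e (a + int i + int r + 2) * continuant e (a + int i + 1) (Suc r) - continuant e (a + int i + 1) r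
      = continuant e (a + int i + 1) (Suc (Suc r))" by (simp add: algebra_simps)
  finally show ?case .
qed

text \<open>Two steps are the first length at which all four entries are continuants; a single step
  would call for one of length -1.\<close>

lemma transfer_matrix_continuant:
  fixes V E \<theta> defines "e \<equiv> \<lambda>j. E - V \<theta> j"
  shows "transfer_matrix V E \<theta> (Suc (Suc n)) $ 1 $ 1 = continuant e 0 (Suc (Suc n))"
    "transfer_matrix V E \<theta> (Suc (Suc n)) $ 1 $ 2 = - continuant e 1 (Suc n)"
    "transfer_matrix V E \<theta> (Suc (Suc n)) $ 2 $ 1 = continuant e 0 (Suc n)"
    "transfer_matrix V E \<theta> (Suc (Suc n)) $ 2 $ 2 = - continuant e 1 n"
proof (induction n)
  case 0
  {
    case 1 show ?case by (simp add: e_def transfer_step_def matrix_matrix_mult_def sum_2 mat_def)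
  next
    case 2 show ?case by (simp add: e_def transfer_step_def matrix_matrix_mult_def sum_2 mat_def)
  next
    case 3 show ?case by (simp add: e_def transfer_step_def matrix_matrix_mult_def sum_2 mat_def)
  next
    case 4 show ?case by (simp add: e_def transfer_step_def matrix_matrix_mult_def sum_2 mat_def)
  }
next
  case (Suc n)
  have step: "transfer_matrix V E \<theta> (Suc (Suc (Suc n))) $ 1 $ j
      = e (int (Suc (Suc n))) * transfer_matrix V E \<theta> (Suc (Suc n)) $ 1 $ j - transfer_matrix V E \<theta> (Suc (Suc n)) $ 2 $ j"
    "transfer_matrix V E \<theta> (Suc (Suc (Suc n))) $ 2 $ j = transfer_matrix V E \<theta> (Suc (Suc n)) $ 1 $ j" for j
    unfolding transfer_matrix.simps(2)[of V E \<theta> "Suc (Suc n)"]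
    by (simp_all add: e_def transfer_step_def matrix_matrix_mult_def sum_2 del: transfer_matrix.simps)
  {
    case 1 show ?case unfolding step Suc by simp
  next
    case 2 show ?case unfolding step Suc by (simp add: algebra_simps)
  next
    case 3 show ?case unfolding step Suc by simp
  next
    case 4 show ?case unfolding step Suc by simp
  }
qed

lemma transfer_matrix_11: "transfer_matrix V E \<theta> n $ 1 $ 1 = continuant (\<lambda>j. E - V \<theta> j) 0 n"
proof (cases n)
  case 0 then show ?thesis by (simp add: mat_def)
next
  case (Suc m)
  show ?thesis
  proof (cases m)
    case 0 then show ?thesis using Suc by (simp add: transfer_step_def)
  next
    case (Suc k)
    then show ?thesis using \<open>n = Suc m\<close> transfer_matrix_continuant(1)[of V E \<theta> k] by (simp only:)
  qed
qed

section \<open>Norms of transfer matrices and the Lyapunov exponent\<close>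

lemma onorm_matrix2_le_sum:
  fixes A :: "real^2^2"
  shows "onorm ((*v) A) \<le> 4 * (\<Sum>i\<in>UNIV. \<Sum>j\<in>UNIV. \<bar>A $ i $ j\<bar>)"
proof -
  have "\<bar>A $ i $ j\<bar> \<le> (\<Sum>i\<in>UNIV. \<Sum>j\<in>UNIV. \<bar>A $ i $ j\<bar>)" for i j
  proof -
    have "\<bar>A $ i $ j\<bar> \<le> (\<Sum>j\<in>UNIV. \<bar>A $ i $ j\<bar>)" by (rule member_le_sum) auto
    also have "\<dots> \<le> (\<Sum>i\<in>UNIV. \<Sum>j\<in>UNIV. \<bar>A $ i $ j\<bar>)"
      by (rule member_le_sum[where f = "\<lambda>i. \<Sum>j\<in>UNIV. \<bar>A $ i $ j\<bar>"]) (auto intro: sum_nonneg)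
    finally show ?thesis .
  qed
  from onorm_le_matrix_component[of A, OF this] show ?thesis by simp
qed

text \<open>By the triangle inequality the operator norm is Lipschitz in the entries. Continuity in
  the phase is what integrals and equidistribution require.\<close>

lemma continuous_on_onorm_matrix2:
  fixes A :: "'a::metric_space \<Rightarrow> real^2^2"
  assumes "\<And>i j. continuous_on S (\<lambda>x. A x $ i $ j)"
  shows "continuous_on S (\<lambda>x. onorm ((*v) (A x)))"
  unfolding continuous_on
proof
  fix x assume x: "x \<in> S"
  have bl: "bounded_linear ((*v) B)" for B :: "real^2^2" by (rule matrix_vector_mul_bounded_linear)
  have tri: "onorm ((*v) B) \<le> onorm ((*v) (B - C)) + onorm ((*v) C)" for B C :: "real^2^2"
    using onorm_triangle[OF bl[of "B - C"] bl[of C]] by (simp add: matrix_vector_mult_diff_rdistrib)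
  have sym: "(\<Sum>i\<in>UNIV. \<Sum>j\<in>UNIV. \<bar>(B - C) $ i $ j\<bar>) = (\<Sum>i\<in>UNIV. \<Sum>j\<in>UNIV. \<bar>(C - B) $ i $ j\<bar>)"
    for B C :: "real^2^2" by (simp add: abs_minus_commute)
  have diff: "\<bar>onorm ((*v) B) - onorm ((*v) C)\<bar> \<le> 4 * (\<Sum>i\<in>UNIV. \<Sum>j\<in>UNIV. \<bar>(B - C) $ i $ j\<bar>)" for B C :: "real^2^2"
    using tri[of B C] tri[of C B] onorm_matrix2_le_sum[of "B - C"] onorm_matrix2_le_sum[of "C - B"] sym[of B C]
    by linarith
  have t: "((\<lambda>y. A y $ i $ j) \<longlongrightarrow> A x $ i $ j) (at x within S)" for i j
    using assms[of i j] x by (auto simp: continuous_on)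
  have "((\<lambda>y. 4 * (\<Sum>i\<in>UNIV. \<Sum>j\<in>UNIV. \<bar>(A y - A x) $ i $ j\<bar>)) \<longlongrightarrow> 4 * (\<Sum>i\<in>(UNIV::2 set). \<Sum>j\<in>(UNIV::2 set). \<bar>A x $ i $ j - A x $ i $ j\<bar>)) (at x within S)"
    unfolding vector_minus_component
    by (intro tendsto_mult tendsto_const tendsto_sum tendsto_rabs tendsto_diff t)
  then have lim: "((\<lambda>y. 4 * (\<Sum>i\<in>UNIV. \<Sum>j\<in>UNIV. \<bar>(A y - A x) $ i $ j\<bar>)) \<longlongrightarrow> 0) (at x within S)" by simp
  have "((\<lambda>y. onorm ((*v) (A y)) - onorm ((*v) (A x))) \<longlongrightarrow> 0) (at x within S)"
    by (rule Lim_null_comparison[OF _ lim]) (use diff in auto)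
  then show "((\<lambda>y. onorm ((*v) (A y))) \<longlongrightarrow> onorm ((*v) (A x))) (at x within S)" by (simp add: LIM_zero_iff)
qed

text \<open>Twice the determinant is at most the sum of the squares of all entries, that is, of both
  squared column norms, and each of these is at most the squared operator norm.\<close>

lemma onorm_matrix2_ge_1:
  fixes A :: "real^2^2"
  assumes "det A = 1"
  shows "1 \<le> onorm ((*v) A)"
proof -
  have "norm (column j A) \<le> onorm ((*v) A)" for j by (rule norm_column_le_onorm)
  then have col: "(norm (column j A))\<^sup>2 \<le> (onorm ((*v) A))\<^sup>2" for j by (intro power_mono) auto
  have sq: "(norm (column j A))\<^sup>2 = (A $ 1 $ j)\<^sup>2 + (A $ 2 $ j)\<^sup>2" for j
    unfolding power2_norm_eq_inner by (simp add: inner_vec_def sum_2 column_def power2_eq_square)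
  have "1 = A $ 1 $ 1 * A $ 2 $ 2 - A $ 1 $ 2 * A $ 2 $ 1" using assms by (simp add: det_2)
  moreover have "2 * (A $ 1 $ 1 * A $ 2 $ 2) \<le> (A $ 1 $ 1)\<^sup>2 + (A $ 2 $ 2)\<^sup>2"
    using sum_squares_bound[of "A $ 1 $ 1" "A $ 2 $ 2"] by simp
  moreover have "- (2 * (A $ 1 $ 2 * A $ 2 $ 1)) \<le> (A $ 1 $ 2)\<^sup>2 + (A $ 2 $ 1)\<^sup>2"
    using sum_squares_bound[of "A $ 1 $ 2" "- A $ 2 $ 1"] by simp
  ultimately have "1 \<le> (onorm ((*v) A))\<^sup>2" using col[of 1] col[of 2] unfolding sq by linarith
  then show ?thesis
    using matrix_vector_mul_bounded_linear[of A] onorm_pos_le[of "(*v) A"]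
    by (metis one_le_power power2_le_imp_le power_one)
qed

lemma onorm_matrix_mul:
  fixes A B :: "real^2^2"
  shows "onorm ((*v) (A ** B)) \<le> onorm ((*v) A) * onorm ((*v) B)"
  using onorm_compose[OF matrix_vector_mul_bounded_linear[of A] matrix_vector_mul_bounded_linear[of B]]
  by (simp add: o_def matrix_vector_mul_assoc)

definition log_norm :: "(real \<Rightarrow> int \<Rightarrow> real) \<Rightarrow> real \<Rightarrow> nat \<Rightarrow> real \<Rightarrow> real" where
  "log_norm V E n \<theta> = ln (onorm ((*v) (transfer_matrix V E \<theta> n)))"

lemma det_transfer_matrix: "det (transfer_matrix V E \<theta> n) = 1"
proof (induction n)
  case (Suc n)
  moreover have "det (transfer_step V E \<theta> (int n)) = 1" by (simp add: transfer_step_def det_2)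
  ultimately show ?case by (simp only: transfer_matrix.simps det_mul)
qed simp

lemma log_norm_nonneg: "0 \<le> log_norm V E n \<theta>"
  unfolding log_norm_def by (intro ln_ge_zero onorm_matrix2_ge_1 det_transfer_matrix)

lemma onorm_transfer_matrix_pos: "0 < onorm ((*v) (transfer_matrix V E \<theta> n))"
  using onorm_matrix2_ge_1[OF det_transfer_matrix[of V E \<theta> n]] by linarith

lemma exp_log_norm: "exp (log_norm V E n \<theta>) = onorm ((*v) (transfer_matrix V E \<theta> n))"
  unfolding log_norm_def using onorm_transfer_matrix_pos by simp

lemma log_norm_continuous:
  assumes "\<And>n. continuous_on UNIV (\<lambda>\<theta>. V \<theta> n)"
  shows "continuous_on UNIV (log_norm V E n)"
proof -
  have "continuous_on UNIV (\<lambda>\<theta>. transfer_matrix V E \<theta> n $ i $ j)" for i j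
  proof (induction n arbitrary: i j)
    case (Suc n)
    have st: "continuous_on UNIV (\<lambda>\<theta>. transfer_step V E \<theta> (int n) $ i $ k)" for k
    proof -
      have "continuous_on UNIV (\<lambda>\<theta>. transfer_step V E \<theta> (int n) $ 1 $ 1)"
        "continuous_on UNIV (\<lambda>\<theta>. transfer_step V E \<theta> (int n) $ 1 $ 2)"
        "continuous_on UNIV (\<lambda>\<theta>. transfer_step V E \<theta> (int n) $ 2 $ 1)"
        "continuous_on UNIV (\<lambda>\<theta>. transfer_step V E \<theta> (int n) $ 2 $ 2)"
        by (simp_all add: transfer_step_def continuous_on_diff assms)
      then show ?thesis using exhaust_2[of i] exhaust_2[of k] by metis
    qed
    have "(\<lambda>\<theta>. transfer_matrix V E \<theta> (Suc n) $ i $ j)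
        = (\<lambda>\<theta>. \<Sum>k\<in>UNIV. transfer_step V E \<theta> (int n) $ i $ k * transfer_matrix V E \<theta> n $ k $ j)"
      by (simp add: matrix_matrix_mult_def)
    then show ?case by (simp only:) (intro continuous_on_sum continuous_on_mult st Suc)
  qed simp
  then show ?thesis unfolding log_norm_def
    by (intro continuous_on_ln continuous_on_onorm_matrix2) (auto simp: less_imp_neq[OF onorm_transfer_matrix_pos, symmetric])
qed

lemma transfer_matrix_cong:
  assumes "\<And>j. V \<theta> j = V' \<theta>' j"
  shows "transfer_matrix V E \<theta> n = transfer_matrix V' E \<theta>' n"
  by (induction n) (auto simp: transfer_step_def assms)

lemma transfer_matrix_add:
  assumes "\<And>j. V \<theta> (j + int n) = V \<theta>' j"
  shows "transfer_matrix V E \<theta> (n + m) = transfer_matrix V E \<theta>' m ** transfer_matrix V E \<theta> n"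
proof (induction m)
  case (Suc m)
  have "transfer_step V E \<theta> (int (n + m)) = transfer_step V E \<theta>' (int m)"
    using assms[of "int m"] by (simp add: transfer_step_def add.commute)
  then show ?case using Suc by (simp add: matrix_mul_assoc)
qed simp

lemma log_norm_add:
  assumes "\<And>j. V \<theta> (j + int n) = V \<theta>' j"
  shows "log_norm V E (n + m) \<theta> \<le> log_norm V E n \<theta> + log_norm V E m \<theta>'"
proof -
  have "onorm ((*v) (transfer_matrix V E \<theta>' m ** transfer_matrix V E \<theta> n))
      \<le> onorm ((*v) (transfer_matrix V E \<theta>' m)) * onorm ((*v) (transfer_matrix V E \<theta> n))"
    by (rule onorm_matrix_mul)
  then have "ln (onorm ((*v) (transfer_matrix V E \<theta>' m ** transfer_matrix V E \<theta> n)))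
      \<le> ln (onorm ((*v) (transfer_matrix V E \<theta>' m)) * onorm ((*v) (transfer_matrix V E \<theta> n)))"
    using onorm_transfer_matrix_pos[of V E \<theta> n] onorm_transfer_matrix_pos[of V E \<theta>' m]
      onorm_transfer_matrix_pos[of V E \<theta> "n + m"]
    unfolding transfer_matrix_add[of V \<theta> n \<theta>' E m, OF assms]
    by (subst ln_le_cancel_iff) auto
  then show ?thesis unfolding log_norm_def transfer_matrix_add[of V \<theta> n \<theta>' E m, OF assms]
    using onorm_transfer_matrix_pos[of V E \<theta> n] onorm_transfer_matrix_pos[of V E \<theta>' m]
    by (simp add: ln_mult)
qed

lemma continuant_le_onorm:
  "\<bar>continuant (\<lambda>j. E - V \<theta> j) 0 n\<bar> \<le> onorm ((*v) (transfer_matrix V E \<theta> n))"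
  unfolding transfer_matrix_11[symmetric] by (rule matrix_component_le_onorm)

text \<open>The norm is at most four times the largest entry in modulus, and the entries are box
  determinants up to two sites shorter. Which of them is large cannot be prescribed, so later
  estimates must tolerate three values of \<open>k\<close>.\<close>

lemma exists_large_continuant:
  fixes V E \<theta> defines "e \<equiv> \<lambda>j. E - V \<theta> j"
  assumes "n \<ge> 2"
  obtains k s where "k \<in> {n - 2, n - 1, n}" "s \<in> {0, 1}"
    "onorm ((*v) (transfer_matrix V E \<theta> n)) \<le> 4 * \<bar>continuant e s k\<bar>"
proof -
  obtain m where m: "n = Suc (Suc m)" using assms by (metis add_2_eq_Suc le_Suc_ex)
  let ?A = "transfer_matrix V E \<theta> n"
  define a b c d where "a = \<bar>continuant e 0 n\<bar>" and "b = \<bar>continuant e 1 (n - 1)\<bar>"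
    and "c = \<bar>continuant e 0 (n - 1)\<bar>" and "d = \<bar>continuant e 1 (n - 2)\<bar>"
  define B where "B = max (max a b) (max c d)"
  have "\<bar>?A $ 1 $ 1\<bar> = a" "\<bar>?A $ 1 $ 2\<bar> = b" "\<bar>?A $ 2 $ 1\<bar> = c" "\<bar>?A $ 2 $ 2\<bar> = d"
    using transfer_matrix_continuant[of V E \<theta> m] unfolding m e_def a_def b_def c_def d_def
    by (simp_all del: continuant.simps transfer_matrix.simps)
  moreover have "a \<le> B" "b \<le> B" "c \<le> B" "d \<le> B" by (simp_all add: B_def)
  ultimately have "\<bar>?A $ i $ j\<bar> \<le> B" for i j
    using exhaust_2[of i] exhaust_2[of j] by metis
  then have le: "onorm ((*v) ?A) \<le> 4 * B"
    using onorm_le_matrix_component[of ?A B] by simp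
  have "B = a \<or> B = b \<or> B = c \<or> B = d" by (auto simp: B_def max_def)
  then show thesis
    using le that[of n 0] that[of "n - 1" 1] that[of "n - 1" 0] that[of "n - 2" 1]
    unfolding a_def b_def c_def d_def by (elim disjE) simp_all
qed

text \<open>As \<open>lyapunov\<close> is defined by \<open>lim\<close>, convergence has to be
  established before it can be used. Shifting the sites by \<open>n\<close> amounts to moving the
  phase by \<open>n * \<alpha>\<close>, so the log-norms are a subadditive cocycle.\<close>

theorem lyapunov_bounds:
  fixes v :: "real \<Rightarrow> real" and \<alpha> E :: real
  assumes dio: "diophantine \<alpha> \<gamma> \<sigma>" and per: "\<And>x. v (x + 1) = v x" and cont: "continuous_on UNIV v"
  defines "V \<equiv> \<lambda>\<theta> n. v (\<theta> + of_int n * \<alpha>)"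
  shows "(\<lambda>n. integral {0..1} (log_norm V E n) / real n) \<longlonglongrightarrow> lyapunov V E"
    "real n * lyapunov V E \<le> integral {0..1} (log_norm V E n)"
    "e > 0 \<Longrightarrow> \<exists>C. \<forall>n x. log_norm V E n x \<le> real n * (lyapunov V E + e) + C"
proof -
  have shift: "V x (j + int n) = V (x + real n * \<alpha>) j" for x j n by (simp add: V_def algebra_simps)
  have V1: "V (x + 1) j = V x j" for x j using per[of "x + of_int j * \<alpha>"] by (simp add: V_def add_ac)
  have contV: "continuous_on UNIV (\<lambda>\<theta>. V \<theta> n)" for n
    unfolding V_def by (intro continuous_on_compose2[OF cont] continuous_intros) auto
  obtain L where L: "(\<lambda>n. integral {0..1} (log_norm V E n) / real n) \<longlonglongrightarrow> L"
    "\<And>n. real n * L \<le> integral {0..1} (log_norm V E n)"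
    "\<And>e. e > 0 \<Longrightarrow> \<exists>C. \<forall>n x. log_norm V E n x \<le> real n * (L + e) + C"
  proof (rule subadditive_cocycle[OF dio, of "log_norm V E"])
    show "log_norm V E n (x + 1) = log_norm V E n x" for n x
      unfolding log_norm_def using transfer_matrix_cong[of V "x + 1" V x] V1 by simp
  qed (auto simp: log_norm_nonneg intro!: log_norm_continuous contV log_norm_add shift)
  have "lyapunov V E = L" using L(1) unfolding lyapunov_def log_norm_def by (simp add: limI)
  then show "(\<lambda>n. integral {0..1} (log_norm V E n) / real n) \<longlonglongrightarrow> lyapunov V E"
    "real n * lyapunov V E \<le> integral {0..1} (log_norm V E n)"
    "e > 0 \<Longrightarrow> \<exists>C. \<forall>n x. log_norm V E n x \<le> real n * (lyapunov V E + e) + C"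
    using L by auto
qed

lemma continuant_upper_bound:
  fixes v :: "real \<Rightarrow> real" and \<alpha> E :: real
  assumes dio: "diophantine \<alpha> \<gamma> \<sigma>" and per: "\<And>x. v (x + 1) = v x" and cont: "continuous_on UNIV v" and e: "e > 0"
  defines "V \<equiv> \<lambda>\<theta> n. v (\<theta> + of_int n * \<alpha>)"
  obtains C where "C > 0"
    "\<And>n s x. \<bar>continuant (\<lambda>j. E - V x j) s n\<bar> \<le> C * exp (real n * (lyapunov V E + e))"
proof -
  obtain C where C: "\<And>n x. log_norm V E n x \<le> real n * (lyapunov V E + e) + C"
    using lyapunov_bounds(3)[OF dio per cont e, of E] unfolding V_def by auto
  have "\<bar>continuant (\<lambda>j. E - V x j) s n\<bar> \<le> exp C * exp (real n * (lyapunov V E + e))" for n s x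
  proof -
    have "continuant (\<lambda>j. E - V x j) s n = continuant (\<lambda>j. E - V (x + of_int s * \<alpha>) j) 0 n"
      using continuant_shift[of "\<lambda>j. E - V x j" s 0 n] by (simp add: V_def algebra_simps)
    then have "\<bar>continuant (\<lambda>j. E - V x j) s n\<bar> \<le> exp (log_norm V E n (x + of_int s * \<alpha>))"
      using continuant_le_onorm[of E V "x + of_int s * \<alpha>" n] by (simp add: exp_log_norm)
    also have "\<dots> \<le> exp (real n * (lyapunov V E + e) + C)" using C by simp
    finally show ?thesis by (simp add: exp_add mult.commute)
  qed
  then show thesis using that[of "exp C"] by simp
qed

text \<open>A continuous function reaches its mean, and the mean of the log-norm is at least
  \<open>n\<close> times the exponent. Where this happens remains unknown.\<close>

lemma continuant_large_somewhere:
  fixes v :: "real \<Rightarrow> real" and \<alpha> E :: real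
  assumes dio: "diophantine \<alpha> \<gamma> \<sigma>" and per: "\<And>x. v (x + 1) = v x" and cont: "continuous_on UNIV v"
    and n: "n \<ge> 2"
  defines "V \<equiv> \<lambda>\<theta> n. v (\<theta> + of_int n * \<alpha>)"
  obtains k x where "k \<in> {n - 2, n - 1, n}" "exp (real n * lyapunov V E) \<le> 4 * \<bar>continuant (\<lambda>j. E - V x j) 0 k\<bar>"
proof -
  have contV: "continuous_on UNIV (\<lambda>\<theta>. V \<theta> n)" for n
    unfolding V_def by (intro continuous_on_compose2[OF cont] continuous_intros) auto
  have "\<exists>x. real n * lyapunov V E \<le> log_norm V E n x"
  proof (rule ccontr)
    assume "\<nexists>x. real n * lyapunov V E \<le> log_norm V E n x"
    then have less: "log_norm V E n x < real n * lyapunov V E" for x by (simp add: not_le)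
    have c: "continuous_on {0..1} (log_norm V E n)"
      by (rule continuous_on_subset[OF log_norm_continuous[OF contV]]) auto
    have "\<exists>z\<in>{0..1}. \<forall>x\<in>{0..1}. log_norm V E n x \<le> log_norm V E n z"
      by (rule continuous_attains_sup[OF _ _ c]) auto
    then obtain z where z: "\<And>x. x \<in> {0..1} \<Longrightarrow> log_norm V E n x \<le> log_norm V E n z" by blast
    have "integral {0..1} (log_norm V E n) \<le> integral {0..1} (\<lambda>x::real. log_norm V E n z)"
      by (intro integral_le integrable_continuous_interval c z) auto
    then have "integral {0..1} (log_norm V E n) < real n * lyapunov V E" using less[of z] by simp
    then show False using lyapunov_bounds(2)[OF dio per cont, of n E] unfolding V_def by simp
  qed
  then obtain x where x: "real n * lyapunov V E \<le> log_norm V E n x" by blast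
  obtain k s where ks: "k \<in> {n - 2, n - 1, n}"
    "onorm ((*v) (transfer_matrix V E x n)) \<le> 4 * \<bar>continuant (\<lambda>j. E - V x j) s k\<bar>"
    using exists_large_continuant[OF n, of V E x] by blast
  have "continuant (\<lambda>j. E - V x j) s k = continuant (\<lambda>j. E - V (x + of_int s * \<alpha>) j) 0 k"
    using continuant_shift[of "\<lambda>j. E - V x j" s 0 k] by (simp add: V_def algebra_simps)
  moreover have "exp (real n * lyapunov V E) \<le> onorm ((*v) (transfer_matrix V E x n))"
    unfolding exp_log_norm[symmetric] using x by simp
  ultimately show thesis using ks that[of k "x + of_int s * \<alpha>"] by simp
qed

section \<open>Box determinants as polynomials in a cosine\<close>

definition trig_poly :: "nat \<Rightarrow> (real \<Rightarrow> real) \<Rightarrow> bool" where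
  "trig_poly n f \<longleftrightarrow> (\<exists>a b. \<forall>x. f x = (\<Sum>j\<le>n. a j * cos (real j * x) + b j * sin (real j * x)))"

lemma trig_poly_add:
  assumes "trig_poly n f" "trig_poly n g"
  shows "trig_poly n (\<lambda>x. f x + g x)"
proof -
  obtain a b where f: "\<And>x. f x = (\<Sum>j\<le>n. a j * cos (real j * x) + b j * sin (real j * x))"
    using assms(1) unfolding trig_poly_def by blast
  obtain c d where g: "\<And>x. g x = (\<Sum>j\<le>n. c j * cos (real j * x) + d j * sin (real j * x))"
    using assms(2) unfolding trig_poly_def by blast
  have "f x + g x = (\<Sum>j\<le>n. (a j + c j) * cos (real j * x) + (b j + d j) * sin (real j * x))" for x
    unfolding f g sum.distrib[symmetric] by (simp add: algebra_simps)
  then show ?thesis unfolding trig_poly_def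
    by (intro exI[of _ "\<lambda>j. a j + c j"] exI[of _ "\<lambda>j. b j + d j"]) blast
qed

lemma trig_poly_scale:
  assumes "trig_poly n f"
  shows "trig_poly n (\<lambda>x. r * f x)"
proof -
  obtain a b where f: "\<And>x. f x = (\<Sum>j\<le>n. a j * cos (real j * x) + b j * sin (real j * x))"
    using assms(1) unfolding trig_poly_def by blast
  have "r * f x = (\<Sum>j\<le>n. (r * a j) * cos (real j * x) + (r * b j) * sin (real j * x))" for x
    unfolding f sum_distrib_left by (simp add: algebra_simps)
  then show ?thesis unfolding trig_poly_def
    by (intro exI[of _ "\<lambda>j. r * a j"] exI[of _ "\<lambda>j. r * b j"]) blast
qed

lemma trig_poly_cos: "j \<le> n \<Longrightarrow> trig_poly n (\<lambda>x. cos (real j * x))"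
  unfolding trig_poly_def
  by (intro exI[of _ "\<lambda>i. if i = j then 1 else 0"] exI[of _ "\<lambda>i. 0"]) (simp add: mult_delta_left)

lemma trig_poly_sin: "j \<le> n \<Longrightarrow> trig_poly n (\<lambda>x. sin (real j * x))"
  unfolding trig_poly_def
  by (intro exI[of _ "\<lambda>i. 0"] exI[of _ "\<lambda>i. if i = j then 1 else 0"]) (simp add: mult_delta_left)

lemma trig_poly_sum:
  assumes "finite A" "\<And>i. i \<in> A \<Longrightarrow> trig_poly n (f i)"
  shows "trig_poly n (\<lambda>x. \<Sum>i\<in>A. f i x)"
  using assms
proof (induction A rule: finite_induct)
  case empty
  show ?case using trig_poly_scale[OF trig_poly_cos[of 0 n], of 0] by simp
next
  case (insert i A)
  then show ?case by (simp add: trig_poly_add)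
qed

lemma trig_poly_const: "trig_poly n (\<lambda>x. c)"
  using trig_poly_scale[OF trig_poly_cos[of 0 n], of c] by simp

lemma trig_poly_mono:
  assumes "trig_poly n f" "n \<le> m"
  shows "trig_poly m f"
proof -
  obtain a b where f: "\<And>x. f x = (\<Sum>j\<le>n. a j * cos (real j * x) + b j * sin (real j * x))"
    using assms(1) unfolding trig_poly_def by blast
  have "f = (\<lambda>x. \<Sum>j\<le>n. a j * cos (real j * x) + b j * sin (real j * x))" using f by blast
  then show ?thesis using assms(2)
    by (simp only:) (intro trig_poly_sum trig_poly_add trig_poly_scale trig_poly_cos trig_poly_sin, auto)
qed

lemma trig_poly_mult_cos:
  assumes "trig_poly n f"
  shows "trig_poly (Suc n) (\<lambda>x. cos (x + s) * f x)"
proof -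
  obtain a b where f: "\<And>x. f x = (\<Sum>j\<le>n. a j * cos (real j * x) + b j * sin (real j * x))"
    using assms(1) unfolding trig_poly_def by blast
  have C: "trig_poly (Suc n) (\<lambda>x. cos (real j * x) * cos x)" "trig_poly (Suc n) (\<lambda>x. sin (real j * x) * cos x)"
    "trig_poly (Suc n) (\<lambda>x. cos (real j * x) * sin x)" "trig_poly (Suc n) (\<lambda>x. sin (real j * x) * sin x)"
    if "j \<le> n" for j
  proof -
    let ?T = "trig_poly (Suc n)"
    have base: "?T (\<lambda>x. cos (real (Suc j) * x))" "?T (\<lambda>x. sin (real (Suc j) * x))"
      "?T (\<lambda>x. cos (real j * x - x))" "?T (\<lambda>x. sin (real j * x - x))"
    proof -
      show "?T (\<lambda>x. cos (real (Suc j) * x))" "?T (\<lambda>x. sin (real (Suc j) * x))"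
        using that by (auto intro!: trig_poly_cos trig_poly_sin simp del: of_nat_Suc)
      show "?T (\<lambda>x. cos (real j * x - x))"
      proof (cases j)
        case 0 then show ?thesis using trig_poly_cos[of 1 "Suc n"] by simp
      next
        case (Suc i) then show ?thesis using trig_poly_cos[of i "Suc n"] that by (simp add: algebra_simps)
      qed
      show "?T (\<lambda>x. sin (real j * x - x))"
      proof (cases j)
        case 0 then show ?thesis using trig_poly_scale[OF trig_poly_sin[of 1 "Suc n"], of "-1"] by simp
      next
        case (Suc i) then show ?thesis using trig_poly_sin[of i "Suc n"] that by (simp add: algebra_simps)
      qed
    qed
    have id: "real (Suc j) * x = real j * x + x" for x by (simp add: algebra_simps)
    have "?T (\<lambda>x. 1/2 * (cos (real (Suc j) * x) + cos (real j * x - x)))" by (intro trig_poly_scale trig_poly_add base)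
    then show "?T (\<lambda>x. cos (real j * x) * cos x)" by (simp only: id cos_add cos_diff) (simp add: mult.commute)
    have "?T (\<lambda>x. 1/2 * (sin (real (Suc j) * x) + sin (real j * x - x)))" by (intro trig_poly_scale trig_poly_add base)
    then show "?T (\<lambda>x. sin (real j * x) * cos x)" by (simp only: id sin_add sin_diff) (simp add: mult.commute)
    have "?T (\<lambda>x. 1/2 * (sin (real (Suc j) * x) + (-1) * sin (real j * x - x)))" by (intro trig_poly_scale trig_poly_add base)
    then show "?T (\<lambda>x. cos (real j * x) * sin x)" by (simp only: id sin_add sin_diff) (simp add: mult.commute)
    have "?T (\<lambda>x. 1/2 * (cos (real j * x - x) + (-1) * cos (real (Suc j) * x)))" by (intro trig_poly_scale trig_poly_add base)
    then show "?T (\<lambda>x. sin (real j * x) * sin x)" by (simp only: id cos_add cos_diff) (simp add: mult.commute)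
  qed
  have "trig_poly (Suc n) (\<lambda>x. \<Sum>j\<le>n.
      ((a j * cos s) * (cos (real j * x) * cos x) + (- a j * sin s) * (cos (real j * x) * sin x))
    + ((b j * cos s) * (sin (real j * x) * cos x) + (- b j * sin s) * (sin (real j * x) * sin x)))"
    by (intro trig_poly_sum trig_poly_add trig_poly_scale C) auto
  also have "(\<lambda>x. \<Sum>j\<le>n.
      ((a j * cos s) * (cos (real j * x) * cos x) + (- a j * sin s) * (cos (real j * x) * sin x))
    + ((b j * cos s) * (sin (real j * x) * cos x) + (- b j * sin s) * (sin (real j * x) * sin x)))
    = (\<lambda>x. cos (x + s) * f x)"
    unfolding f cos_add sum_distrib_left by (intro ext sum.cong refl) (simp add: algebra_simps)
  finally show ?thesis .
qed

lemma trig_poly_mult_affine_cos: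
  assumes "trig_poly n f"
  shows "trig_poly (Suc n) (\<lambda>x. (A + B * cos (x + s)) * f x)"
proof -
  have "trig_poly (Suc n) (\<lambda>x. A * f x + B * (cos (x + s) * f x))"
    by (intro trig_poly_add trig_poly_scale trig_poly_mult_cos assms trig_poly_mono[OF assms]) simp
  then show ?thesis by (simp add: algebra_simps)
qed

text \<open>Chebyshev polynomials, by the recursion
  \<open>T (n + 2) = 2 * x * T (n + 1) - T n\<close>.\<close>

lemma cos_mult_poly: "\<exists>p. degree p \<le> n \<and> (\<forall>x::real. cos (real n * x) = poly p (cos x))"
proof (induction n rule: induct_nat_012)
  case 0 show ?case by (intro exI[of _ 1]) simp
next
  case 1 show ?case by (intro exI[of _ "[:0, 1:]"]) simp
next
  case (ge2 n)
  obtain p q where p: "degree p \<le> n" "\<And>x::real. cos (real n * x) = poly p (cos x)"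
    and q: "degree q \<le> Suc n" "\<And>x::real. cos (real (Suc n) * x) = poly q (cos x)"
    using ge2 by blast
  let ?r = "[:0, 2:] * q - p"
  have "degree ([:0, 2:] * q) \<le> Suc (Suc n)" using degree_mult_le[of "[:0, 2:]" q] q(1) by simp
  then have "degree ?r \<le> Suc (Suc n)" using p(1) by (intro degree_diff_le) auto
  moreover have "cos (real (Suc (Suc n)) * x) = poly ?r (cos x)" for x
  proof -
    have "cos (real (Suc (Suc n)) * x) = cos (real (Suc n) * x + x)" "cos (real n * x) = cos (real (Suc n) * x - x)"
      by (simp_all add: algebra_simps)
    then have "cos (real (Suc (Suc n)) * x) + cos (real n * x) = 2 * cos x * cos (real (Suc n) * x)"
      unfolding cos_add cos_diff by simp
    then show ?thesis using p(2)[of x] q(2)[of x] by simp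
  qed
  ultimately show ?case by blast
qed

text \<open>Averaging with the reflected argument cancels all sines, and Chebyshev polynomials
  express the remaining cosines.\<close>

lemma even_trig_poly_cos_poly:
  assumes "trig_poly n f" and even: "\<And>x. f (- x) = f x"
  obtains p where "degree p \<le> n" "\<And>x. f x = poly p (cos x)"
proof -
  obtain a b where f: "\<And>x. f x = (\<Sum>j\<le>n. a j * cos (real j * x) + b j * sin (real j * x))"
    using assms(1) unfolding trig_poly_def by blast
  obtain T where T: "\<And>j. degree (T j) \<le> j" "\<And>j x::real. cos (real j * x) = poly (T j) (cos x)"
    using cos_mult_poly by metis
  let ?p = "\<Sum>j\<le>n. smult (a j) (T j)"
  have "degree ?p \<le> n"
    by (intro degree_sum_le) (auto intro!: order_trans[OF degree_smult_le] order_trans[OF T(1)])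
  moreover have "f x = poly ?p (cos x)" for x
  proof -
    have "f x = (f x + f (- x)) / 2" by (simp add: even)
    also have "\<dots> = (\<Sum>j\<le>n. a j * cos (real j * x))"
      unfolding f[of x] f[of "- x"] sum.distrib[symmetric] sum_divide_distrib by simp
    finally show ?thesis by (simp add: poly_sum T(2))
  qed
  ultimately show thesis using that by blast
qed

text \<open>Multiplying by the weights clears the denominators of the potential.\<close>

definition weight :: "real \<Rightarrow> real \<Rightarrow> real" where "weight \<tau> x = 1 - \<tau> * cos (2 * pi * x)"

lemma weight_pos: "\<bar>\<tau>\<bar> < 1 \<Longrightarrow> 0 < weight \<tau> x"
proof -
  assume t: "\<bar>\<tau>\<bar> < 1"
  have "\<tau> * cos (2 * pi * x) \<le> \<bar>\<tau>\<bar> * \<bar>cos (2 * pi * x)\<bar>" by (metis abs_ge_self abs_mult)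
  also have "\<dots> \<le> \<bar>\<tau>\<bar> * 1" by (intro mult_left_mono) auto
  finally show ?thesis using t by (simp add: weight_def)
qed

lemma weight_even: "weight \<tau> (- x) = weight \<tau> x"
  by (simp add: weight_def)

lemma cos_2pi_add_1: "cos (2 * pi * (x + 1)) = cos (2 * pi * x)"
  by (simp add: distrib_left cos_add)

definition gaa_potential :: "real \<Rightarrow> real \<Rightarrow> real \<Rightarrow> real" where
  "gaa_potential lam \<tau> x = 2 * lam * (cos (2 * pi * x) / weight \<tau> x)"

lemma V1_eq: "V1 lam \<tau> \<alpha> = (\<lambda>\<theta> n. gaa_potential lam \<tau> (\<theta> + of_int n * \<alpha>))"
  by (auto simp: V1_def gaa_potential_def weight_def fun_eq_iff)

lemma gaa_potential_periodic: "gaa_potential lam \<tau> (x + 1) = gaa_potential lam \<tau> x"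
  by (simp add: gaa_potential_def weight_def cos_2pi_add_1)

lemma gaa_potential_continuous: "\<bar>\<tau>\<bar> < 1 \<Longrightarrow> continuous_on UNIV (gaa_potential lam \<tau>)"
  unfolding gaa_potential_def using weight_pos[of \<tau>]
  by (intro continuous_intros) (auto simp: weight_def less_imp_neq[symmetric] intro!: continuous_intros)

lemma gaa_potential_even: "gaa_potential lam \<tau> (- x) = gaa_potential lam \<tau> x"
  by (simp add: gaa_potential_def weight_def)

text \<open>Each site brings its own weight \<open>w\<close>, and both \<open>w\<close> and
  \<open>e * w\<close> are affine in a cosine. In the recursion the first term therefore gains one
  degree for one site, and the second, which skips a site, two degrees for two sites. Measuring the
  phase at the center turns the reflection of the box into evenness.\<close>

lemma V1_continuant_poly:
  assumes \<tau>: "\<bar>\<tau>\<bar> < 1"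
  obtains p where "degree p \<le> n"
    "\<And>x. continuant (\<lambda>j. E - V1 lam \<tau> \<alpha> x j) 0 n * (\<Prod>j<n. weight \<tau> (x + real j * \<alpha>))
      = poly p (cos (2 * pi * (x + (real n - 1) / 2 * \<alpha>)))"
proof -
  \<comment> \<open>\<open>h\<close> is the offset from the phase of the first site to that of the
    center, and \<open>y / (2 * pi)\<close> stands for the latter.\<close>
  define h where "h = (real n - 1) / 2 * \<alpha>"
  define e where "e y = (\<lambda>j::int. E - gaa_potential lam \<tau> (y / (2 * pi) - h + of_int j * \<alpha>))" for y
  define w where "w y j = weight \<tau> (y / (2 * pi) - h + real j * \<alpha>)" for y and j :: nat
  define Q where "Q k y = continuant (e y) 0 k * (\<Prod>j<k. w y j)" for k y
  have arg: "2 * pi * (y / (2 * pi) - h + c) = y + (2 * pi * (c - h))" for y c :: real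
    by (simp add: algebra_simps)
  have w: "w y j = 1 + (- \<tau>) * cos (y + 2 * pi * (real j * \<alpha> - h))" for y j
    unfolding w_def weight_def arg by simp
  have ew: "e y (int j) * w y j = E + (- (E * \<tau> + 2 * lam)) * cos (y + 2 * pi * (real j * \<alpha> - h))" for y j
  proof -
    have "w y j > 0" unfolding w_def by (rule weight_pos[OF \<tau>])
    moreover have "gaa_potential lam \<tau> (y / (2 * pi) - h + of_int (int j) * \<alpha>)
        = 2 * lam * (cos (y + 2 * pi * (real j * \<alpha> - h)) / w y j)"
      unfolding gaa_potential_def w_def by (simp only: of_int_of_nat_eq arg)
    ultimately have "e y (int j) * w y j = E * w y j - 2 * lam * cos (y + 2 * pi * (real j * \<alpha> - h))"
      unfolding e_def by (simp add: left_diff_distrib)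
    then show ?thesis unfolding w by (simp add: algebra_simps)
  qed
  have Q: "trig_poly k (Q k)" for k
  proof (induction k rule: induct_nat_012)
    case 0 show ?case unfolding Q_def by (simp add: trig_poly_const)
  next
    case 1
    have "Q 1 = (\<lambda>y. (E + (- (E * \<tau> + 2 * lam)) * cos (y + 2 * pi * (real 0 * \<alpha> - h))) * 1)"
      using ew[of _ 0] by (simp add: Q_def fun_eq_iff)
    then show ?case
      using trig_poly_mult_affine_cos[OF trig_poly_const[of 0 1], of E "- (E * \<tau> + 2 * lam)" "2 * pi * (real 0 * \<alpha> - h)"]
      by (simp only: One_nat_def)
  next
    case (ge2 k)
    have eq: "Q (Suc (Suc k)) y = (E + (- (E * \<tau> + 2 * lam)) * cos (y + 2 * pi * (real (Suc k) * \<alpha> - h))) * Q (Suc k) y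
       + (- 1) * ((1 + (- \<tau>) * cos (y + 2 * pi * (real (Suc k) * \<alpha> - h))) * ((1 + (- \<tau>) * cos (y + 2 * pi * (real k * \<alpha> - h))) * Q k y))" for y
      unfolding w[symmetric] ew[symmetric] Q_def by (simp add: algebra_simps)
    moreover have "trig_poly (Suc (Suc k)) (\<lambda>y. (E + (- (E * \<tau> + 2 * lam)) * cos (y + 2 * pi * (real (Suc k) * \<alpha> - h))) * Q (Suc k) y
       + (- 1) * ((1 + (- \<tau>) * cos (y + 2 * pi * (real (Suc k) * \<alpha> - h))) * ((1 + (- \<tau>) * cos (y + 2 * pi * (real k * \<alpha> - h))) * Q k y)))"
      by (intro trig_poly_add trig_poly_scale trig_poly_mult_affine_cos ge2)
    ultimately show ?case by (simp only: ext[OF eq])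
  qed
  have even: "Q n (- y) = Q n y" for y
  proof -
    have rfl: "- y / (2 * pi) - h + of_int j * \<alpha> = - (y / (2 * pi) - h + of_int (int n - 1 - j) * \<alpha>)" for j
      by (simp add: h_def field_simps)
    have "e (- y) = (\<lambda>j. e y (int n - 1 - j))"
      unfolding e_def rfl gaa_potential_even by simp
    then have 1: "continuant (e (- y)) 0 n = continuant (e y) 0 n"
      using continuant_reflect[of "e y" "int n - 1" 0 n] by simp
    have "(\<Prod>j<n. w (- y) j) = (\<Prod>j<n. w y (n - 1 - j))"
    proof (rule prod.cong[OF refl])
      fix j assume "j \<in> {..<n}"
      then have eq: "of_int (int n - 1 - int j) = real (n - 1 - j)" by auto
      have arg': "- y / (2 * pi) - h + real j * \<alpha> = - (y / (2 * pi) - h + real (n - 1 - j) * \<alpha>)"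
        using rfl[of "int j"] by (simp only: eq of_int_of_nat_eq)
      show "w (- y) j = w y (n - 1 - j)"
        unfolding w_def arg' weight_even ..
    qed
    also have "\<dots> = (\<Prod>j<n. w y j)"
      by (rule prod.reindex_bij_witness[of _ "\<lambda>j. n - 1 - j" "\<lambda>j. n - 1 - j"]) auto
    finally show ?thesis unfolding Q_def using 1 by simp
  qed
  obtain p where p: "degree p \<le> n" "\<And>y. Q n y = poly p (cos y)"
    using even_trig_poly_cos_poly[OF Q[of n] even] by blast
  show thesis
  proof (rule that[OF p(1)])
    fix x
    have "(2 * pi * (x + h)) / (2 * pi) - h = x" by simp
    then show "continuant (\<lambda>j. E - V1 lam \<tau> \<alpha> x j) 0 n * (\<Prod>j<n. weight \<tau> (x + real j * \<alpha>))
      = poly p (cos (2 * pi * (x + (real n - 1) / 2 * \<alpha>)))"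
      using p(2)[of "2 * pi * (x + h)"] unfolding Q_def e_def w_def h_def[symmetric] V1_eq by simp
  qed
qed

section \<open>Interpolation at equidistributed nodes\<close>

lemma lagrange_bound:
  fixes p :: "real poly" and z :: "'a \<Rightarrow> real"
  assumes "finite J" "degree p < card J" and inj: "inj_on z J"
  shows "\<bar>poly p t\<bar> \<le> (\<Sum>a\<in>J. \<bar>poly p (z a)\<bar> * (\<Prod>b\<in>J - {a}. \<bar>t - z b\<bar> / \<bar>z a - z b\<bar>))"
proof -
  define l where "l a = (\<Prod>b\<in>J - {a}. smult (1 / (z a - z b)) [:- z b, 1:])" for a
  define q where "q = (\<Sum>a\<in>J. smult (poly p (z a)) (l a))"
  have l: "poly (l a) s = (\<Prod>b\<in>J - {a}. (s - z b) / (z a - z b))" for a s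
    by (simp add: l_def poly_prod diff_divide_distrib)
  have "p = q"
  proof (rule poly_eqI_degree[of "z ` J"])
    fix x assume "x \<in> z ` J"
    then obtain c where c: "c \<in> J" "x = z c" by blast
    have "poly (l a) (z c) = (if a = c then 1 else 0)" if "a \<in> J" for a
    proof (cases "a = c")
      case True
      have "(z c - z b) / (z c - z b) = 1" if "b \<in> J - {c}" for b
        using that inj c(1) by (auto simp: inj_on_def)
      then show ?thesis unfolding l True by simp
    next
      case False
      then show ?thesis unfolding l using assms(1) c(1) by (auto intro!: prod_zero bexI[of _ c])
    qed
    then have "poly q x = (\<Sum>a\<in>J. if a = c then poly p (z a) else 0)"
      unfolding q_def c(2) poly_sum by (intro sum.cong) auto
    then show "poly p x = poly q x" using assms(1) c by simp
  next
    have card: "card (z ` J) = card J" by (rule card_image[OF inj])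
    then show "degree p < card (z ` J)" using assms(2) by simp
    have "degree (l a) \<le> card J - 1" if "a \<in> J" for a
    proof -
      have "degree (l a) \<le> (\<Sum>b\<in>J - {a}. degree (smult (1 / (z a - z b)) [:- z b, 1:]))"
        unfolding l_def using assms(1) degree_prod_sum_le[of "J - {a}" "\<lambda>b. smult (1 / (z a - z b)) [:- z b, 1:]"]
        by (simp add: o_def)
      also have "\<dots> \<le> (\<Sum>b\<in>J - {a}. 1)" by (intro sum_mono order_trans[OF degree_smult_le]) simp
      also have "\<dots> = card J - 1" using that assms(1) by simp
      finally show ?thesis .
    qed
    then have "degree q \<le> card J - 1" unfolding q_def
      by (intro degree_sum_le assms(1)) (auto intro: order_trans[OF degree_smult_le])
    then show "degree q < card (z ` J)" using card assms(2) by linarith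
  qed
  then have "poly p t = poly q t" by (rule arg_cong)
  also have "\<dots> = (\<Sum>a\<in>J. poly p (z a) * (\<Prod>b\<in>J - {a}. (t - z b) / (z a - z b)))"
    by (simp only: q_def poly_sum poly_smult l)
  finally have "\<bar>poly p t\<bar> = \<bar>\<Sum>a\<in>J. poly p (z a) * (\<Prod>b\<in>J - {a}. (t - z b) / (z a - z b))\<bar>"
    by simp
  also have "\<dots> \<le> (\<Sum>a\<in>J. \<bar>poly p (z a) * (\<Prod>b\<in>J - {a}. (t - z b) / (z a - z b))\<bar>)" by (rule sum_abs)
  also have "\<dots> = (\<Sum>a\<in>J. \<bar>poly p (z a)\<bar> * (\<Prod>b\<in>J - {a}. \<bar>t - z b\<bar> / \<bar>z a - z b\<bar>))"
    by (simp add: abs_mult abs_prod)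
  finally show ?thesis .
qed

text \<open>Both products are exponentials of orbit sums of one continuous function, the logarithm
  of the weight, and the averages cancel.\<close>

lemma weight_ratio_bound:
  assumes dio: "diophantine \<alpha> \<gamma> \<sigma>" and \<tau>: "\<bar>\<tau>\<bar> < 1" and e: "e > 0"
  obtains C where "C > 0" "\<And>n x y. (\<Prod>j<n. weight \<tau> (x + real j * \<alpha>))
      \<le> C * exp (e * real n) * (\<Prod>j<n. weight \<tau> (y + real j * \<alpha>))"
proof -
  let ?g = "\<lambda>x. ln (weight \<tau> x)"
  have per: "?g (x + 1) = ?g x" for x by (simp add: weight_def cos_2pi_add_1)
  have cont: "continuous_on UNIV ?g"
    using weight_pos[OF \<tau>] by (intro continuous_on_ln) (auto simp: weight_def less_imp_neq[symmetric] intro!: continuous_intros)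
  have e2: "e / 2 > 0" using e by simp
  obtain C where C: "C \<ge> 0"
    "\<And>n x. \<bar>(\<Sum>j<n. ?g (x + real j * \<alpha>)) - real n * integral {0..1} ?g\<bar> \<le> e / 2 * real n + C"
    using uniform_equidistribution[OF dio per cont e2] by blast
  have prod: "(\<Prod>j<n. weight \<tau> (x + real j * \<alpha>)) = exp (\<Sum>j<n. ?g (x + real j * \<alpha>))" for n x
    using weight_pos[OF \<tau>] by (simp add: exp_sum)
  have "(\<Prod>j<n. weight \<tau> (x + real j * \<alpha>)) \<le> exp (2 * C) * exp (e * real n) * (\<Prod>j<n. weight \<tau> (y + real j * \<alpha>))" for n x y
  proof -
    have "(\<Sum>j<n. ?g (x + real j * \<alpha>)) \<le> 2 * C + e * real n + (\<Sum>j<n. ?g (y + real j * \<alpha>))"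
      using C(2)[where n = n and x = x] C(2)[where n = n and x = y] unfolding abs_le_iff by (simp add: field_simps)
    then show ?thesis unfolding prod exp_add[symmetric] by simp
  qed
  then show thesis using that[of "exp (2 * C)"] by simp
qed

lemma abs_cos_diff: "\<bar>cos (2 * pi * x) - cos (2 * pi * y)\<bar> = 2 * \<bar>sin (pi * (x + y))\<bar> * \<bar>sin (pi * (x - y))\<bar>"
proof -
  have "cos (2 * pi * x) - cos (2 * pi * y) = 2 * sin (pi * (x + y)) * sin (pi * (y - x))"
    unfolding cos_diff_cos by (simp add: algebra_simps add_divide_distrib diff_divide_distrib)
  moreover have "sin (pi * (y - x)) = - sin (pi * (x - y))"
    by (metis minus_diff_eq mult_minus_right sin_minus)
  ultimately show ?thesis by (simp add: abs_mult)
qed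

text \<open>Differences of cosines are twice products of two sines, so the logarithms of numerator
  and denominator are orbit sums over the same two windows with the same main term. Truncation
  bounds the numerator from above. The denominator consists of four singular sums (two sines, two
  windows), each bounded below at the cost of one \<open>K\<close>.\<close>

lemma node_product_bound:
  assumes dio: "diophantine \<alpha> \<gamma> \<sigma>" and e: "e > 0"
  obtains C where "C > 0"
    "\<And>a1 a2 n1 n2 \<phi> y K c. {a1..<a1 + int n1} \<inter> {a2..<a2 + int n2} = {} \<Longrightarrow>
      c \<in> {a1..<a1 + int n1} \<union> {a2..<a2 + int n2} \<Longrightarrow>
      (\<And>b. b \<in> {a1..<a1 + int n1} \<union> {a2..<a2 + int n2} \<Longrightarrow> b \<noteq> c \<Longrightarrow>
        1 / 2 ^ K \<le> \<bar>sin (pi * (2 * \<phi> + of_int (c + b) * \<alpha>))\<bar> \<and> 1 / 2 ^ K \<le> \<bar>sin (pi * (of_int (c - b) * \<alpha>))\<bar>) \<Longrightarrow>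
      (\<Prod>b\<in>({a1..<a1 + int n1} \<union> {a2..<a2 + int n2}) - {c}.
        \<bar>cos (2 * pi * y) - cos (2 * pi * (\<phi> + of_int b * \<alpha>))\<bar> /
        \<bar>cos (2 * pi * (\<phi> + of_int c * \<alpha>)) - cos (2 * pi * (\<phi> + of_int b * \<alpha>))\<bar>)
      \<le> C * exp (e * real (n1 + n2) + 4 * real K)"
proof -
  \<comment> \<open>Per node, the numerator uses up \<open>2 * e'\<close> and the denominator
    \<open>4 * e'\<close>.\<close>
  define e' where "e' = e / 6"
  have e': "e' > 0" using e by (simp add: e'_def)
  show thesis
  proof (rule log_sin_orbit_lower[OF dio e'])
  fix \<delta> :: real
  assume \<delta>: "0 < \<delta>" "\<delta> < 1"
    and low: "\<And>a n J K x. J \<subseteq> {a..<a + int n} \<Longrightarrow> (\<And>l. l \<in> J \<Longrightarrow> 1 / 2 ^ K \<le> \<bar>sin (pi * (x + of_int l * \<alpha>))\<bar>) \<Longrightarrow>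
      (\<Sum>l\<in>J. truncated_log_sin \<delta> (x + of_int l * \<alpha>) - ln \<bar>sin (pi * (x + of_int l * \<alpha>))\<bar>) \<le> e' * real n + real K"
  let ?f = "truncated_log_sin \<delta>"
  define m where "m = integral {0..1} ?f"
  show thesis
  proof (rule uniform_equidistribution_int[OF dio truncated_log_sin_periodic truncated_log_sin_continuous[OF \<delta>(1)] e'])
  fix C :: real
  assume C: "C \<ge> 0"
    "\<And>n x a. \<bar>(\<Sum>l\<in>{a..<a + int n}. ?f (x + of_int l * \<alpha>)) - real n * integral {0..1} ?f\<bar> \<le> e' * real n + C"
  note C = C[folded m_def]
  \<comment> \<open>Equidistribution concerns complete windows; these two bounds limit the effect of
    dropping the node \<open>c\<close>.\<close>
  have f0: "?f x \<le> 0" for x unfolding truncated_log_sin_def using \<delta> by (subst ln_le_zero_iff) (auto simp: max_def)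
  have f1: "- ?f x \<le> ln (1 / \<delta>)" for x
    unfolding truncated_log_sin_def using \<delta> by (simp add: ln_div)
  have sinf: "\<bar>sin (pi * x)\<bar> \<le> exp (?f x)" for x unfolding truncated_log_sin_def using \<delta> by (simp add: max_def)
  define D where "D = 2 * (4 * C + ln (1 / \<delta>))"
  show thesis
  proof (rule that[of "exp D"])
    fix a1 a2 n1 n2 \<phi> y K c
    define I1 I2 where "I1 = {a1..<a1 + int n1}" and "I2 = {a2..<a2 + int n2}"
    define J where "J = I1 \<union> I2"
    assume disj: "{a1..<a1 + int n1} \<inter> {a2..<a2 + int n2} = {}"
      and c: "c \<in> {a1..<a1 + int n1} \<union> {a2..<a2 + int n2}"
      and sep: "\<And>b. b \<in> {a1..<a1 + int n1} \<union> {a2..<a2 + int n2} \<Longrightarrow> b \<noteq> c \<Longrightarrow>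
        1 / 2 ^ K \<le> \<bar>sin (pi * (2 * \<phi> + of_int (c + b) * \<alpha>))\<bar> \<and> 1 / 2 ^ K \<le> \<bar>sin (pi * (of_int (c - b) * \<alpha>))\<bar>"
    define N where "N = real (n1 + n2)"
    have finI: "finite I1" "finite I2" "finite J" by (auto simp: I1_def I2_def J_def)
    have disj': "I1 \<inter> I2 = {}" using disj by (simp add: I1_def I2_def)
    have cJ: "c \<in> J" using c by (simp add: J_def I1_def I2_def)
    have sumJ: "\<bar>(\<Sum>b\<in>J. ?f (x + of_int b * \<alpha>)) - N * m\<bar> \<le> e' * N + 2 * C" for x
    proof -
      have "(\<Sum>b\<in>J. ?f (x + of_int b * \<alpha>)) = (\<Sum>b\<in>I1. ?f (x + of_int b * \<alpha>)) + (\<Sum>b\<in>I2. ?f (x + of_int b * \<alpha>))"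
        unfolding J_def by (rule sum.union_disjoint) (use finI disj' in auto)
      then show ?thesis using C(2)[where a = a1 and n = n1 and x = x] C(2)[where a = a2 and n = n2 and x = x]
        unfolding I1_def[symmetric] I2_def[symmetric] N_def abs_le_iff by (simp add: algebra_simps)
    qed
    have sumJc: "(\<Sum>b\<in>J - {c}. ?f (x + of_int b * \<alpha>)) = (\<Sum>b\<in>J. ?f (x + of_int b * \<alpha>)) - ?f (x + of_int c * \<alpha>)" for x
      using finI cJ by (simp add: sum_diff1)
    have up: "(\<Sum>b\<in>J - {c}. ?f (x + of_int b * \<alpha>)) \<le> N * m + e' * N + 2 * C + ln (1 / \<delta>)" for x
      using sumJ[of x] f1[of "x + of_int c * \<alpha>"] unfolding sumJc abs_le_iff by linarith
    have lo: "N * m - 2 * e' * N - 2 * C - 2 * real K \<le> (\<Sum>b\<in>J - {c}. ln \<bar>sin (pi * (x + of_int b * \<alpha>))\<bar>)"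
      if s: "\<And>b. b \<in> J \<Longrightarrow> b \<noteq> c \<Longrightarrow> 1 / 2 ^ K \<le> \<bar>sin (pi * (x + of_int b * \<alpha>))\<bar>" for x
    proof -
      let ?d = "\<lambda>b::int. ?f (x + of_int b * \<alpha>) - ln \<bar>sin (pi * (x + of_int b * \<alpha>))\<bar>"
      have "sum ?d (J - {c}) = sum ?d (I1 - {c}) + sum ?d (I2 - {c})"
        unfolding J_def Un_Diff by (rule sum.union_disjoint) (use finI disj' in auto)
      moreover have "sum ?d (I1 - {c}) \<le> e' * real n1 + real K"
        by (rule low[of _ a1]) (use s in \<open>auto simp: I1_def J_def\<close>)
      moreover have "sum ?d (I2 - {c}) \<le> e' * real n2 + real K"
        by (rule low[of _ a2]) (use s in \<open>auto simp: I2_def J_def\<close>)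
      ultimately have "sum ?d (J - {c}) \<le> e' * N + 2 * real K" by (simp add: N_def algebra_simps)
      then have "(\<Sum>b\<in>J - {c}. ?f (x + of_int b * \<alpha>)) - (\<Sum>b\<in>J - {c}. ln \<bar>sin (pi * (x + of_int b * \<alpha>))\<bar>) \<le> e' * N + 2 * real K"
        by (simp add: sum_subtractf)
      moreover have "N * m - e' * N - 2 * C \<le> (\<Sum>b\<in>J - {c}. ?f (x + of_int b * \<alpha>))"
        using sumJ[of x] f0[of "x + of_int c * \<alpha>"] unfolding sumJc abs_le_iff by linarith
      ultimately show ?thesis by linarith
    qed
    have flip: "\<bar>sin (pi * (x - (\<phi> + of_int b * \<alpha>)))\<bar> = \<bar>sin (pi * ((\<phi> - x) + of_int b * \<alpha>))\<bar>" for x b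
    proof -
      have "pi * (x - (\<phi> + of_int b * \<alpha>)) = - (pi * ((\<phi> - x) + of_int b * \<alpha>))" by (simp add: algebra_simps)
      then show ?thesis by (metis abs_minus_cancel sin_minus)
    qed
    have K0: "0 < (1::real) / 2 ^ K" by simp
    define A where "A b = ?f ((y + \<phi>) + of_int b * \<alpha>) + ?f ((\<phi> - y) + of_int b * \<alpha>)" for b :: int
    define B where "B b = ln \<bar>sin (pi * ((2 * \<phi> + of_int c * \<alpha>) + of_int b * \<alpha>))\<bar>
        + ln \<bar>sin (pi * ((- (of_int c * \<alpha>)) + of_int b * \<alpha>))\<bar>" for b :: int
    have s1: "1 / 2 ^ K \<le> \<bar>sin (pi * ((2 * \<phi> + of_int c * \<alpha>) + of_int b * \<alpha>))\<bar>" if "b \<in> J" "b \<noteq> c" for b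
      using sep[of b] that by (simp add: J_def I1_def I2_def algebra_simps)
    have s2: "1 / 2 ^ K \<le> \<bar>sin (pi * ((- (of_int c * \<alpha>)) + of_int b * \<alpha>))\<bar>" if "b \<in> J" "b \<noteq> c" for b
    proof -
      have "pi * ((- (of_int c * \<alpha>)) + of_int b * \<alpha>) = - (pi * (of_int (c - b) * \<alpha>))" by (simp add: algebra_simps)
      then show ?thesis using sep[of b] that by (simp only: sin_minus abs_minus_cancel) (simp add: J_def I1_def I2_def)
    qed
    have "(\<Prod>b\<in>J - {c}. \<bar>cos (2 * pi * y) - cos (2 * pi * (\<phi> + of_int b * \<alpha>))\<bar> /
        \<bar>cos (2 * pi * (\<phi> + of_int c * \<alpha>)) - cos (2 * pi * (\<phi> + of_int b * \<alpha>))\<bar>) \<le> (\<Prod>b\<in>J - {c}. exp (A b - B b))"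
    proof (rule prod_mono, rule conjI)
      fix b assume b: "b \<in> J - {c}"
      have "\<bar>cos (2 * pi * y) - cos (2 * pi * (\<phi> + of_int b * \<alpha>))\<bar>
          = 2 * \<bar>sin (pi * ((y + \<phi>) + of_int b * \<alpha>))\<bar> * \<bar>sin (pi * ((\<phi> - y) + of_int b * \<alpha>))\<bar>"
        unfolding abs_cos_diff flip by (simp add: add.assoc)
      also have "\<dots> \<le> 2 * exp (?f ((y + \<phi>) + of_int b * \<alpha>)) * exp (?f ((\<phi> - y) + of_int b * \<alpha>))"
        by (intro mult_mono sinf order.refl) auto
      also have "\<dots> = 2 * exp (A b)" by (simp add: A_def exp_add)
      finally have num: "\<bar>cos (2 * pi * y) - cos (2 * pi * (\<phi> + of_int b * \<alpha>))\<bar> \<le> 2 * exp (A b)" .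
      have pos: "0 < \<bar>sin (pi * ((2 * \<phi> + of_int c * \<alpha>) + of_int b * \<alpha>))\<bar>"
        "0 < \<bar>sin (pi * ((- (of_int c * \<alpha>)) + of_int b * \<alpha>))\<bar>"
        using less_le_trans[OF K0 s1[of b]] less_le_trans[OF K0 s2[of b]] b by blast+
      have "exp (B b) = \<bar>sin (pi * ((2 * \<phi> + of_int c * \<alpha>) + of_int b * \<alpha>))\<bar> * \<bar>sin (pi * ((- (of_int c * \<alpha>)) + of_int b * \<alpha>))\<bar>"
        unfolding B_def exp_add by (simp only: exp_ln[OF pos(1)] exp_ln[OF pos(2)])
      then have den: "\<bar>cos (2 * pi * (\<phi> + of_int c * \<alpha>)) - cos (2 * pi * (\<phi> + of_int b * \<alpha>))\<bar> = 2 * exp (B b)"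
        unfolding abs_cos_diff flip by (simp add: algebra_simps)
      show "\<bar>cos (2 * pi * y) - cos (2 * pi * (\<phi> + of_int b * \<alpha>))\<bar> /
        \<bar>cos (2 * pi * (\<phi> + of_int c * \<alpha>)) - cos (2 * pi * (\<phi> + of_int b * \<alpha>))\<bar> \<le> exp (A b - B b)"
        unfolding den exp_diff using num by (simp add: divide_simps)
    qed auto
    also have "\<dots> = exp ((\<Sum>b\<in>J - {c}. A b) - (\<Sum>b\<in>J - {c}. B b))"
      using finI by (simp add: exp_sum[symmetric] sum_subtractf)
    also have "\<dots> \<le> exp (D + (e * N + 4 * real K))"
    proof -
      have "(\<Sum>b\<in>J - {c}. A b) \<le> 2 * (N * m) + 2 * (e' * N) + 4 * C + 2 * ln (1 / \<delta>)"
        unfolding A_def sum.distrib using add_mono[OF up[of "y + \<phi>"] up[of "\<phi> - y"]] by (simp add: algebra_simps)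
      moreover have "2 * (N * m) - 4 * (e' * N) - 4 * C - 4 * real K \<le> (\<Sum>b\<in>J - {c}. B b)"
        unfolding B_def sum.distrib using add_mono[OF lo[OF s1] lo[OF s2]] by (simp add: algebra_simps)
      moreover have "6 * (e' * N) = e * N" by (simp add: e'_def)
      moreover have "a - b \<le> 2 * (4 * C' + l) + (Z + 4 * k)"
        if "a \<le> 2 * Y + 2 * X + 4 * C' + 2 * l" "2 * Y - 4 * X - 4 * C' - 4 * k \<le> b" "6 * X = Z"
        for a b X Y Z C' l k :: real using that by argo
      ultimately show ?thesis unfolding exp_le_cancel_iff D_def by blast
    qed
    finally show "(\<Prod>b\<in>({a1..<a1 + int n1} \<union> {a2..<a2 + int n2}) - {c}.
        \<bar>cos (2 * pi * y) - cos (2 * pi * (\<phi> + of_int b * \<alpha>))\<bar> /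
        \<bar>cos (2 * pi * (\<phi> + of_int c * \<alpha>)) - cos (2 * pi * (\<phi> + of_int b * \<alpha>))\<bar>)
      \<le> exp D * exp (e * real (n1 + n2) + 4 * real K)"
      by (simp only: J_def I1_def I2_def N_def exp_add)
  qed simp
qed
qed
qed

section \<open>Decay of generalized eigenfunctions\<close>

lemma recurrence_zero:
  fixes u :: "int \<Rightarrow> real"
  assumes u: "\<And>j. u (j + 1) + u (j - 1) = e j * u j" and "u 0 = 0" "u 1 = 0"
  shows "u j = 0"
proof -
  have up: "u (int n) = 0 \<and> u (int n + 1) = 0" for n
  proof (induction n)
    case (Suc n)
    then show ?case using u[of "int n + 1"] by (simp add: add.commute)
  qed (use assms in auto)
  have down: "u (- int n) = 0 \<and> u (1 - int n) = 0" for n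
  proof (induction n)
    case (Suc n)
    have "- int (Suc n) = - int n - 1" "1 - int (Suc n) = - int n" by simp_all
    then show ?case using Suc u[of "- int n"] by (simp only:) (simp add: add.commute)
  qed (use assms in auto)
  show ?thesis using up[of "nat j"] down[of "nat (- j)"] by (cases "j \<ge> 0") auto
qed

text \<open>Either coefficient in \<open>continuant_boundary\<close> is a determinant of at most
  \<open>M\<close> sites. A box determinant much larger than \<open>exp (M * l)\<close> thus makes
  the interior value small compared with the boundary values.\<close>

lemma box_bound:
  fixes u :: "int \<Rightarrow> real"
  assumes u: "\<And>j. u (j + 1) + u (j - 1) = e j * u j"
    and D: "\<And>s n. \<bar>continuant e s n\<bar> \<le> C * exp (real n * l)" and "C \<ge> 0" "l \<ge> 0"
    and k: "k = Suc i + r" "i \<le> M" "r \<le> M" and B: "\<bar>u (a - 1)\<bar> \<le> B" "\<bar>u (a + int k)\<bar> \<le> B"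
  shows "\<bar>continuant e a k\<bar> * \<bar>u (a + int i)\<bar> \<le> 2 * C * exp (real M * l) * B"
proof -
  have mono: "C * exp (real n * l) \<le> C * exp (real M * l)" if "n \<le> M" for n
    using that \<open>C \<ge> 0\<close> \<open>l \<ge> 0\<close> by (intro mult_left_mono) (auto intro: mult_right_mono)
  have "\<bar>continuant e a k\<bar> * \<bar>u (a + int i)\<bar>
      = \<bar>continuant e (a + int i + 1) r * u (a - 1) + continuant e a i * u (a + int k)\<bar>"
    unfolding abs_mult[symmetric] k(1) continuant_boundary[OF u] by (simp add: algebra_simps)
  also have "\<dots> \<le> \<bar>continuant e (a + int i + 1) r\<bar> * \<bar>u (a - 1)\<bar> + \<bar>continuant e a i\<bar> * \<bar>u (a + int k)\<bar>"
    by (metis abs_mult abs_triangle_ineq)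
  also have "\<dots> \<le> (C * exp (real M * l)) * B + (C * exp (real M * l)) * B"
    using D[of "a + int i + 1" r] D[of a i] mono[OF k(3)] mono[OF k(2)] \<open>C \<ge> 0\<close>
    by (intro add_mono mult_mono B) (auto intro: order_trans)
  finally show ?thesis by (simp add: mult_ac)
qed

text \<open>The error budget affords decay by \<open>L / 8\<close> for each \<open>m\<close> at
  sites near 16m, that is, the rate \<open>L / 128\<close> per site. One half-line is treated here;
  reflection supplies the other.\<close>

theorem V1_decay_right:
  fixes u :: "int \<Rightarrow> real"
  assumes dio: "diophantine \<alpha> \<gamma> \<sigma>" and nonres: "nonresonant \<alpha> \<theta> \<eta> \<sigma>" and \<tau>: "\<bar>\<tau>\<bar> < 1"
    and L: "lyapunov (V1 lam \<tau> \<alpha>) E > 0"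
    and u: "\<And>j. u (j + 1) + u (j - 1) = (E - V1 lam \<tau> \<alpha> \<theta> j) * u j"
    and B: "\<And>j. \<bar>u j\<bar> \<le> B * (1 + \<bar>real_of_int j\<bar>)\<^sup>2"
  obtains C c where "c > 0" "\<And>j. j \<ge> 0 \<Longrightarrow> \<bar>u j\<bar> \<le> C * exp (- c * real_of_int j)"
proof (cases "u 0 = 0 \<and> u 1 = 0")
  case True
  then have "u j = 0" for j using recurrence_zero[OF u] by blast
  then show thesis using that[of 1 0] by simp
next
  case False
  define L where "L = lyapunov (V1 lam \<tau> \<alpha>) E"
  have L0: "L > 0" using L by (simp add: L_def)
  \<comment> \<open>A nonzero solution cannot vanish at two neighbouring sites, so next to the
    origin there is an anchor with a nonzero value.\<close>
  obtain s :: int where s: "s \<in> {0, 1}" "u s \<noteq> 0" using False by blast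
  define e where "e j = E - V1 lam \<tau> \<alpha> \<theta> j" for j
  have \<gamma>: "\<gamma> > 0" "\<sigma> > 0" "\<eta> > 0" using dio nonres by (auto simp: diophantine_def nonresonant_def)
  have B0: "B \<ge> 0" using order_trans[OF abs_ge_zero B[of 0]] by simp
  \<comment> \<open>Over 15m sites an error of \<open>L / 60\<close> per site amounts to
    \<open>L * m / 4\<close>; over about 16m nodes an error of \<open>L / 128\<close> per node
    amounts to about \<open>L * m / 8\<close>.\<close>
  have L60: "L / 60 > 0" and L128: "L / 128 > 0" using L0 by auto
  note per = gaa_potential_periodic[of lam \<tau>] and cont = gaa_potential_continuous[OF \<tau>, of lam]
  show thesis
  proof (rule continuant_upper_bound[where E = E, OF dio per cont L60])
  fix C1 :: real
  assume C1': "C1 > 0"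
    "\<And>n s x. \<bar>continuant (\<lambda>j. E - gaa_potential lam \<tau> (x + of_int j * \<alpha>)) s n\<bar>
      \<le> C1 * exp (real n * (lyapunov (\<lambda>\<theta> n. gaa_potential lam \<tau> (\<theta> + of_int n * \<alpha>)) E + L / 60))"
  have C1: "C1 > 0"
    "\<And>n s x. \<bar>continuant (\<lambda>j. E - V1 lam \<tau> \<alpha> x j) s n\<bar> \<le> C1 * exp (real n * (L + L / 60))"
    using C1' unfolding V1_eq[symmetric] L_def[symmetric] by (simp_all add: V1_eq)
  show thesis
  proof (rule weight_ratio_bound[OF dio \<tau> L128])
  fix C2 :: real
  assume C2: "C2 > 0" "\<And>n x y. (\<Prod>j<n. weight \<tau> (x + real j * \<alpha>))
      \<le> C2 * exp (L / 128 * real n) * (\<Prod>j<n. weight \<tau> (y + real j * \<alpha>))"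
  show thesis
  proof (rule node_product_bound[OF dio L128])
  fix C3 :: real
  assume C3: "C3 > 0"
    "\<And>a1 a2 n1 n2 \<phi> y K c. {a1..<a1 + int n1} \<inter> {a2..<a2 + int n2} = {} \<Longrightarrow>
      c \<in> {a1..<a1 + int n1} \<union> {a2..<a2 + int n2} \<Longrightarrow>
      (\<And>b. b \<in> {a1..<a1 + int n1} \<union> {a2..<a2 + int n2} \<Longrightarrow> b \<noteq> c \<Longrightarrow>
        1 / 2 ^ K \<le> \<bar>sin (pi * (2 * \<phi> + of_int (c + b) * \<alpha>))\<bar> \<and> 1 / 2 ^ K \<le> \<bar>sin (pi * (of_int (c - b) * \<alpha>))\<bar>) \<Longrightarrow>
      (\<Prod>b\<in>({a1..<a1 + int n1} \<union> {a2..<a2 + int n2}) - {c}.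
        \<bar>cos (2 * pi * y) - cos (2 * pi * (\<phi> + of_int b * \<alpha>))\<bar> /
        \<bar>cos (2 * pi * (\<phi> + of_int c * \<alpha>)) - cos (2 * pi * (\<phi> + of_int b * \<alpha>))\<bar>)
      \<le> C3 * exp (L / 128 * real (n1 + n2) + 4 * real K)"
  define g where "g = min \<gamma> \<eta>"
  have g0: "g > 0" using \<gamma> by (simp add: g_def)
  define A where "A = 2 * C1 * B * (1 + 1 / \<bar>u s\<bar>)"
  have A0: "A \<ge> 0" using C1(1) B0 by (simp add: A_def)
  define A3 where "A3 = 4 * (C2 * C3)"
  have A30: "A3 > 0" using C2(1) C3(1) by (simp add: A3_def)
  \<comment> \<open>For large m, the small divisors at distances up to 100m exceed
    \<open>1 / 2 ^ K\<close> for \<open>K\<close> near \<open>L * m / 64\<close>; the quadratic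
    growth of \<open>u\<close> and its constants cost at most \<open>L * m / 8\<close>; the number
    of nodes and the remaining constants cost at most \<open>L * m / 16\<close>.\<close>
  have ev1: "\<forall>\<^sub>F m in sequentially. 2 * 2 powr (- (L / 64 * real m)) \<le> g * (100 * real m) powr (- \<sigma>)"
    using L0 g0 \<gamma>(2) by real_asymp
  have ev2: "\<forall>\<^sub>F m in sequentially. A * (1 + 100 * real m)\<^sup>2 \<le> exp (L / 8 * real m)"
    using L0 A0 by real_asymp
  have ev3: "\<forall>\<^sub>F m in sequentially. A3 * (16 * real m + 1) * exp (L / 128) \<le> exp (L / 16 * real m)"
    using L0 A30 by real_asymp
  have "\<forall>\<^sub>F m in sequentially. 2 * 2 powr (- (L / 64 * real m)) \<le> g * (100 * real m) powr (- \<sigma>)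
      \<and> A * (1 + 100 * real m)\<^sup>2 \<le> exp (L / 8 * real m)
      \<and> A3 * (16 * real m + 1) * exp (L / 128) \<le> exp (L / 16 * real m)"
    by (intro eventually_conj ev1 ev2 ev3)
  then obtain m0 where m0: "\<And>m. m \<ge> m0 \<Longrightarrow> 2 * 2 powr (- (L / 64 * real m)) \<le> g * (100 * real m) powr (- \<sigma>)"
      "\<And>m. m \<ge> m0 \<Longrightarrow> A * (1 + 100 * real m)\<^sup>2 \<le> exp (L / 8 * real m)"
      "\<And>m. m \<ge> m0 \<Longrightarrow> A3 * (16 * real m + 1) * exp (L / 128) \<le> exp (L / 16 * real m)"
    unfolding eventually_sequentially by blast
  have far: "\<bar>u y\<bar> \<le> exp (- (L / 8 * real m))"
    if m: "m \<ge> m0" "m \<ge> 15" and y: "16 * int m \<le> y" "y \<le> 16 * int m + 15" for y m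
  proof (rule ccontr)
    assume not: "\<not> \<bar>u y\<bar> \<le> exp (- (L / 8 * real m))"
    \<comment> \<open>In units of \<open>L * m\<close>: 15 + 1/4 from the uniform determinant bound,
      1/8 from the growth of \<open>u\<close>, and 1/8 from the assumed failure of decay.\<close>
    define Z where "Z = exp (real m * (31 / 2 * L))"
    define R where "R = B * (1 + 100 * real m)\<^sup>2"
    define Q where "Q = 2 * C1 * exp (real (15 * m) * (L + L / 60)) * R"
    have R: "\<bar>u j\<bar> \<le> R" if "\<bar>j\<bar> \<le> 100 * int m" for j
    proof -
      have "\<bar>real_of_int j\<bar> \<le> 100 * real m" using that by linarith
      then have "B * (1 + \<bar>real_of_int j\<bar>)\<^sup>2 \<le> R" unfolding R_def
        by (intro mult_left_mono power_mono add_left_mono B0) auto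
      then show ?thesis using B[of j] by linarith
    qed
    have box: "\<bar>continuant e a k\<bar> * \<bar>u (a + int i)\<bar> \<le> Q"
      if "k = Suc i + r" "i \<le> 15 * m" "r \<le> 15 * m" "\<bar>a - 1\<bar> \<le> 100 * int m" "\<bar>a + int k\<bar> \<le> 100 * int m" for a k i r
      unfolding Q_def by (rule box_bound[OF u[folded e_def] C1(2)[where x = \<theta>, folded e_def[abs_def]] _ _ that(1-3) R[OF that(4)] R[OF that(5)]])
        (use C1(1) L0 in auto)
    have "\<exists>k x. k \<in> {16 * m - 2, 16 * m - 1, 16 * m} \<and>
        exp (real (16 * m) * L) \<le> 4 * \<bar>continuant (\<lambda>j. E - V1 lam \<tau> \<alpha> x j) 0 k\<bar>"
      unfolding V1_eq L_def
    proof (rule continuant_large_somewhere[where n = "16 * m" and E = E, OF dio per cont])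
      show "2 \<le> 16 * m" using m(2) by simp
    qed (intro exI conjI)
    then obtain k x where k: "k \<in> {16 * m - 2, 16 * m - 1, 16 * m}"
      and x: "exp (real (16 * m) * L) \<le> 4 * \<bar>continuant (\<lambda>j. E - V1 lam \<tau> \<alpha> x j) 0 k\<bar>" by blast
    have kle: "k \<le> 16 * m" "16 * m \<le> k + 2" using k m(2) by auto
    have expZ: "Q * (1 + 1 / \<bar>u s\<bar>) * exp (L / 8 * real m) \<le> Z"
    proof -
      have "Q * (1 + 1 / \<bar>u s\<bar>) * exp (L / 8 * real m)
          = (A * (1 + 100 * real m)\<^sup>2) * exp (real (15 * m) * (L + L / 60) + L / 8 * real m)"
        unfolding exp_add by (simp only: A_def R_def Q_def mult_ac)
      also have "\<dots> \<le> exp (L / 8 * real m) * exp (real (15 * m) * (L + L / 60) + L / 8 * real m)"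
        by (intro mult_right_mono m0(2) m) auto
      also have "\<dots> = Z" unfolding Z_def exp_add[symmetric] by (simp add: field_simps)
      finally show ?thesis .
    qed
    have Q0: "0 \<le> Q" using C1(1) B0 by (simp add: R_def Q_def)
    \<comment> \<open>This makes \<open>k + 1\<close> nodes in all, one more than the degree. The
      window around \<open>y\<close> absorbs the variation of \<open>k\<close>.\<close>
    define n2 where "n2 = k + 1 - 6 * m"
    \<comment> \<open>Left ends of the boxes around \<open>s\<close> and around \<open>y\<close>. All centers are to the right of the origin:
      the condition on \<open>\<theta>\<close> says nothing for \<open>k = 0\<close> (possibly \<open>2 \<theta>\<close> is an integer), so
      no two centers may be symmetric about it. The boxes around \<open>y\<close> make up for the lost half.\<close>
    define I1 I2 where "I1 = {- 7 * int m..<- 7 * int m + int (6 * m)}"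
      and "I2 = {y - 13 * int m..<y - 13 * int m + int n2}"
    define J where "J = I1 \<union> I2"
    have n2: "int n2 = int k + 1 - 6 * int m" unfolding n2_def using kle m by linarith
    have I1: "- 7 * int m \<le> a" "a < - int m" if "a \<in> I1" for a using that by (auto simp: I1_def)
    have I2: "y - 13 * int m \<le> a" "a < y - 19 * int m + int k + 1" if "a \<in> I2" for a
      using that n2 by (auto simp: I2_def)
    have disj: "I1 \<inter> I2 = {}"
    proof -
      have False if "a \<in> I1" "a \<in> I2" for a using I1[OF that(1)] I2[OF that(2)] y m by linarith
      then show ?thesis by blast
    qed
    have small: "\<bar>continuant e a k\<bar> \<le> Z" if a: "a \<in> J" for a
    proof (cases "a \<in> I1")
      case True
      define i where "i = nat (s - a)"
      define r where "r = k - 1 - i"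
      have i: "int i = s - a" unfolding i_def using I1[OF True] s m by auto
      have ik: "int i + 1 \<le> int k" using I1[OF True] s(1) m kle i by auto
      have r: "int r = int k - 1 - int i" unfolding r_def using ik by linarith
      have "k = Suc i + r" using r by linarith
      moreover have "i \<le> 15 * m" "r \<le> 15 * m" "\<bar>a - 1\<bar> \<le> 100 * int m" "\<bar>a + int k\<bar> \<le> 100 * int m"
        using I1[OF True] s(1) m kle i r by auto
      ultimately have "\<bar>continuant e a k\<bar> * \<bar>u (a + int i)\<bar> \<le> Q"
        by (rule box)
      then have "\<bar>continuant e a k\<bar> \<le> Q * (1 / \<bar>u s\<bar>)"
        using s(2) i by (simp add: field_simps)
      also have "\<dots> \<le> Q * (1 + 1 / \<bar>u s\<bar>)"
        using Q0 by (intro mult_left_mono) auto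
      also have "\<dots> \<le> Q * (1 + 1 / \<bar>u s\<bar>) * exp (L / 8 * real m)"
        using mult_left_mono[of 1 "exp (L / 8 * real m)" "Q * (1 + 1 / \<bar>u s\<bar>)"] Q0 L0 by simp
      finally show ?thesis using expZ by linarith
    next
      case False
      then have aI: "a \<in> I2" using a by (simp add: J_def)
      define i where "i = nat (y - a)"
      define r where "r = k - 1 - i"
      have i: "int i = y - a" unfolding i_def using I2[OF aI] y m kle by auto
      have ik: "int i + 1 \<le> int k" using I2[OF aI] m kle i by auto
      have r: "int r = int k - 1 - int i" unfolding r_def using ik by linarith
      have "k = Suc i + r" using r by linarith
      moreover have "i \<le> 15 * m" "r \<le> 15 * m" "\<bar>a - 1\<bar> \<le> 100 * int m" "\<bar>a + int k\<bar> \<le> 100 * int m"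
        using I2[OF aI] m kle i r y by auto
      ultimately have 1: "\<bar>continuant e a k\<bar> * \<bar>u (a + int i)\<bar> \<le> Q"
        by (rule box)
      \<comment> \<open>Instead of the fixed value \<open>u s\<close>, the assumed lower bound at
        \<open>y\<close> is divided out, at the price of \<open>L * m / 8\<close>.\<close>
      have "exp (- (L / 8 * real m)) < \<bar>u (a + int i)\<bar>" using not i by simp
      then have "\<bar>continuant e a k\<bar> * exp (- (L / 8 * real m)) \<le> \<bar>continuant e a k\<bar> * \<bar>u (a + int i)\<bar>"
        by (intro mult_left_mono) auto
      then have "\<bar>continuant e a k\<bar> * exp (- (L / 8 * real m)) \<le> Q"
        using 1 by linarith
      then have "\<bar>continuant e a k\<bar> * exp (- (L / 8 * real m)) * exp (L / 8 * real m)
          \<le> Q * exp (L / 8 * real m)"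
        by (rule mult_right_mono) simp
      also have "\<bar>continuant e a k\<bar> * exp (- (L / 8 * real m)) * exp (L / 8 * real m) = \<bar>continuant e a k\<bar>"
        by (simp add: exp_minus)
      also have "Q * exp (L / 8 * real m)
          \<le> Q * exp (L / 8 * real m) * (1 + 1 / \<bar>u s\<bar>)"
        using mult_left_mono[of 1 "1 + 1 / \<bar>u s\<bar>" "Q * exp (L / 8 * real m)"] Q0
        by simp
      finally show ?thesis using expZ by (simp add: mult_ac)
    qed
    define h where "h = (real k - 1) / 2"
    define \<phi> where "\<phi> = \<theta> + h * \<alpha>"
    define z where "z a = cos (2 * pi * (\<phi> + of_int a * \<alpha>))" for a :: int
    obtain p where p: "degree p \<le> k"
      "\<And>x. continuant (\<lambda>j. E - V1 lam \<tau> \<alpha> x j) 0 k * (\<Prod>j<k. weight \<tau> (x + real j * \<alpha>))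
        = poly p (cos (2 * pi * (x + (real k - 1) / 2 * \<alpha>)))"
      using V1_continuant_poly[OF \<tau>, of k E lam \<alpha>] by blast
    define W where "W x = (\<Prod>j<k. weight \<tau> (x + real j * \<alpha>))" for x
    have W0: "W x > 0" for x unfolding W_def by (intro prod_pos weight_pos[OF \<tau>])
    have pz: "poly p (z a) = continuant e a k * W (\<theta> + of_int a * \<alpha>)" for a
    proof -
      have "continuant (\<lambda>j. E - V1 lam \<tau> \<alpha> (\<theta> + of_int a * \<alpha>) j) 0 k = continuant e a k"
        using continuant_shift[of e a 0 k] by (simp add: e_def V1_eq algebra_simps)
      moreover have "\<theta> + of_int a * \<alpha> + (real k - 1) / 2 * \<alpha> = \<phi> + of_int a * \<alpha>" by (simp add: \<phi>_def h_def)
      ultimately show ?thesis using p(2)[of "\<theta> + of_int a * \<alpha>"] unfolding z_def W_def by (simp only:)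
    qed
    \<comment> \<open>\<open>4 * K\<close> then costs at most \<open>L * m / 16\<close>, while
      \<open>1 / 2 ^ K\<close> is exponentially small in m and hence below the small divisors, which
      are only polynomially small.\<close>
    define K where "K = nat \<lfloor>L / 64 * real m\<rfloor>"
    have K: "real K \<le> L / 64 * real m" "L / 64 * real m \<le> real K + 1"
    proof -
      have "0 \<le> L / 64 * real m" using L0 by simp
      then show "real K \<le> L / 64 * real m" "L / 64 * real m \<le> real K + 1" unfolding K_def by linarith+
    qed
    have K2: "1 / 2 ^ K \<le> g * (100 * real m) powr (- \<sigma>)"
    proof -
      have "(1::real) / 2 ^ K = 2 powr (- real K)" by (simp add: powr_minus powr_realpow divide_inverse)
      also have "\<dots> \<le> 2 powr (1 - L / 64 * real m)" using K(2) by (intro powr_mono) auto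
      also have "\<dots> = 2 * 2 powr (- (L / 64 * real m))" unfolding diff_conv_add_uminus powr_add by simp
      finally show ?thesis using m0(1)[OF m(1)] by linarith
    qed
    have arith: "1 / 2 ^ K \<le> \<gamma> * \<bar>real_of_int d\<bar> powr (- \<sigma>)" "1 / 2 ^ K \<le> \<eta> * \<bar>real_of_int d\<bar> powr (- \<sigma>)"
      if "d \<noteq> 0" "\<bar>d\<bar> \<le> 100 * int m" for d
    proof -
      have "\<bar>real_of_int d\<bar> \<le> 100 * real m" "0 < \<bar>real_of_int d\<bar>" using that by linarith+
      then have "(100 * real m) powr (- \<sigma>) \<le> \<bar>real_of_int d\<bar> powr (- \<sigma>)" using \<gamma> by (intro powr_mono2') auto
      then have "g * (100 * real m) powr (- \<sigma>) \<le> \<gamma> * \<bar>real_of_int d\<bar> powr (- \<sigma>)"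
        "g * (100 * real m) powr (- \<sigma>) \<le> \<eta> * \<bar>real_of_int d\<bar> powr (- \<sigma>)"
        using \<gamma> by (auto intro!: mult_mono simp: g_def)
      then show "1 / 2 ^ K \<le> \<gamma> * \<bar>real_of_int d\<bar> powr (- \<sigma>)" "1 / 2 ^ K \<le> \<eta> * \<bar>real_of_int d\<bar> powr (- \<sigma>)"
        using K2 by linarith+
    qed
    have range: "- 7 * int m \<le> a" "a \<le> 14 * int m" if "a \<in> J" for a
      using that I1[of a] I2[of a] y m kle by (auto simp: J_def)
    have sep: "1 / 2 ^ K \<le> \<bar>sin (pi * (2 * \<phi> + of_int (c + b) * \<alpha>))\<bar> \<and> 1 / 2 ^ K \<le> \<bar>sin (pi * (of_int (c - b) * \<alpha>))\<bar>"
      if cb: "c \<in> J" "b \<in> J" "b \<noteq> c" for c b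
    proof
      \<comment> \<open>\<open>d\<close> is the sum of the positions of the two centers. Left ends
        are at least -7m and \<open>k\<close> is at least 16m - 2, so \<open>d\<close> is positive
        and the condition on \<theta> applies.\<close>
      define d where "d = int k - 1 + c + b"
      have "d \<noteq> 0" "\<bar>d\<bar> \<le> 100 * int m" unfolding d_def using range[OF cb(1)] range[OF cb(2)] kle m by linarith+
      note dd = this
      have "pi * (2 * \<phi> + of_int (c + b) * \<alpha>) = pi * (2 * \<theta> + of_int d * \<alpha>)"
        by (simp add: \<phi>_def h_def d_def field_simps)
      moreover have "\<eta> * \<bar>real_of_int d\<bar> powr (- \<sigma>) \<le> \<bar>sin (pi * (2 * \<theta> + of_int d * \<alpha>))\<bar>"
        using nonres dd unfolding nonresonant_def by blast
      ultimately show "1 / 2 ^ K \<le> \<bar>sin (pi * (2 * \<phi> + of_int (c + b) * \<alpha>))\<bar>"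
        using arith(2)[OF dd] by (simp only:)
      have dd': "c - b \<noteq> 0" "\<bar>c - b\<bar> \<le> 100 * int m" using range[OF cb(1)] range[OF cb(2)] cb(3) by linarith+
      have "\<gamma> * \<bar>real_of_int (c - b)\<bar> powr (- \<sigma>) \<le> \<bar>sin (pi * (of_int (c - b) * \<alpha>))\<bar>"
        using dio dd' unfolding diophantine_def by blast
      then show "1 / 2 ^ K \<le> \<bar>sin (pi * (of_int (c - b) * \<alpha>))\<bar>" using arith(1)[OF dd'] by linarith
    qed
    have K0: "(0::real) < 1 / 2 ^ K" by simp
    have inj: "inj_on z J"
    proof (rule inj_onI, rule ccontr)
      fix a b assume ab: "a \<in> J" "b \<in> J" "z a = z b" "a \<noteq> b"
      have "\<bar>z a - z b\<bar> = 2 * \<bar>sin (pi * (2 * \<phi> + of_int (a + b) * \<alpha>))\<bar> * \<bar>sin (pi * (of_int (a - b) * \<alpha>))\<bar>"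
        unfolding z_def abs_cos_diff by (simp add: algebra_simps)
      moreover have "0 < \<bar>sin (pi * (2 * \<phi> + of_int (a + b) * \<alpha>))\<bar>" "0 < \<bar>sin (pi * (of_int (a - b) * \<alpha>))\<bar>"
        using sep[OF ab(1,2)] ab(4) K0 by (metis less_le_trans)+
      ultimately have "0 < \<bar>z a - z b\<bar>" by simp
      then show False using ab(3) by simp
    qed
    have finJ: "finite J" by (simp add: J_def I1_def I2_def)
    have cardJ: "card J = k + 1"
    proof -
      have "card J = card I1 + card I2" unfolding J_def by (rule card_Un_disjoint) (use disj in \<open>auto simp: I1_def I2_def\<close>)
      also have "\<dots> = 6 * m + n2" by (simp add: I1_def I2_def)
      also have "\<dots> = k + 1" using n2 by linarith
      finally show ?thesis .
    qed
    \<comment> \<open>Center phase of the box with the large determinant. It is uncontrolled, but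
      the interpolation bound holds at every point.\<close>
    define yy where "yy = x + h * \<alpha>"
    define X where "X = C3 * exp (L / 128 * real (k + 1) + 4 * real K)"
    have prod: "(\<Prod>b\<in>J - {a}. \<bar>cos (2 * pi * yy) - z b\<bar> / \<bar>z a - z b\<bar>) \<le> X" if a: "a \<in> J" for a
    proof -
      have n12: "6 * m + n2 = k + 1" using n2 by linarith
      show ?thesis
        using C3(2)[of "- 7 * int m" "6 * m" "y - 13 * int m" n2 a K \<phi> yy] disj a sep[OF a]
        unfolding I1_def[symmetric] I2_def[symmetric] J_def[symmetric] z_def[symmetric] n12 X_def by blast
    qed
    have "\<bar>continuant (\<lambda>j. E - V1 lam \<tau> \<alpha> x j) 0 k\<bar> * W x = \<bar>poly p (cos (2 * pi * yy))\<bar>"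
      using p(2)[of x] W0[of x] unfolding W_def[symmetric] yy_def h_def by (metis abs_mult abs_of_pos)
    also have "\<dots> \<le> (\<Sum>a\<in>J. \<bar>poly p (z a)\<bar> * (\<Prod>b\<in>J - {a}. \<bar>cos (2 * pi * yy) - z b\<bar> / \<bar>z a - z b\<bar>))"
      by (rule lagrange_bound[OF finJ _ inj]) (use p(1) cardJ in simp)
    also have "\<dots> \<le> (\<Sum>a\<in>J. (Z * (C2 * exp (L / 128 * real k) * W x)) * X)"
    proof (intro sum_mono mult_mono prod)
      fix a assume a: "a \<in> J"
      have "\<bar>poly p (z a)\<bar> = \<bar>continuant e a k\<bar> * W (\<theta> + of_int a * \<alpha>)" unfolding pz abs_mult using W0 by (simp add: less_imp_le)
      also have "\<dots> \<le> Z * (C2 * exp (L / 128 * real k) * W x)"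
        using C2(2)[where n = k and x = "\<theta> + of_int a * \<alpha>" and y = x] small[OF a] W0 unfolding W_def[symmetric]
        by (intro mult_mono) (auto intro: less_imp_le simp: Z_def)
      finally show "\<bar>poly p (z a)\<bar> \<le> Z * (C2 * exp (L / 128 * real k) * W x)" .
    qed (use C2(1) W0[of x] in \<open>auto intro!: prod_nonneg mult_nonneg_nonneg simp: Z_def less_imp_le\<close>)
    also have "\<dots> = (real (k + 1) * Z * C2 * exp (L / 128 * real k) * X) * W x"
      using cardJ by (simp add: mult_ac)
    finally have "\<bar>continuant (\<lambda>j. E - V1 lam \<tau> \<alpha> x j) 0 k\<bar> \<le> real (k + 1) * Z * C2 * exp (L / 128 * real k) * X"
      using W0[of x] by simp
    then have "exp (real (16 * m) * L) \<le> 4 * (real (k + 1) * Z * C2 * exp (L / 128 * real k) * X)" using x by linarith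
    also have "\<dots> = A3 * real (k + 1) * exp (L / 128) * (Z * exp (L / 128 * real k + L / 128 * real k + 4 * real K))"
    proof -
      have "L / 128 * real (k + 1) + 4 * real K = L / 128 + L / 128 * real k + 4 * real K"
        by (simp add: field_simps)
      then have "X = C3 * (exp (L / 128) * exp (L / 128 * real k) * exp (4 * real K))"
        by (simp only: X_def exp_add)
      then show ?thesis by (simp only: A3_def exp_add mult_ac)
    qed
    also have "\<dots> \<le> A3 * (16 * real m + 1) * exp (L / 128) * (Z * exp (L / 4 * real m + L / 16 * real m))"
    proof (intro mult_mono)
      have "L * real k \<le> L * (16 * real m)" using L0 kle by (intro mult_left_mono) auto
      then show "exp (L / 128 * real k + L / 128 * real k + 4 * real K) \<le> exp (L / 4 * real m + L / 16 * real m)"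
        using K(1) by (simp add: field_simps)
    qed (use A30 kle in \<open>auto simp: Z_def\<close>)
    also have "\<dots> \<le> exp (L / 16 * real m) * (Z * exp (L / 4 * real m + L / 16 * real m))"
      by (intro mult_right_mono m0(3) m) (auto simp: Z_def)
    also have "\<dots> = exp (real m * (31 / 2 * L) + L / 16 * real m + (L / 4 * real m + L / 16 * real m))"
      by (simp only: Z_def exp_add mult_ac)
    \<comment> \<open>The total is 31/2 + 1/16 + 1/4 + 1/16 = 15 + 7/8, below 16.\<close>
    also have "\<dots> < exp (real (16 * m) * L)"
      using L0 m(2) by (simp add: field_simps)
    finally show False by simp
  qed
  \<comment> \<open>\<open>L / 8\<close> per \<open>m\<close>, spread over blocks of 16 sites. In
    \<open>C\<close> the first summand absorbs the position within a block, the second the finitely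
    many sites before the estimate starts.\<close>
  define c where "c = L / 128"
  define m1 where "m1 = max m0 15"
  define C where "C = exp (15 * c) + B * (1 + 16 * real m1)\<^sup>2 * exp (c * (16 * real m1))"
  have c: "c > 0" using L0 by (simp add: c_def)
  have "\<bar>u j\<bar> \<le> C * exp (- c * real_of_int j)" if j: "j \<ge> 0" for j
  proof (cases "j \<ge> 16 * int m1")
    case True
    define m where "m = nat (j div 16)"
    have jm: "j = 16 * int m + j mod 16" "0 \<le> j mod 16" "j mod 16 < 16" using j by (auto simp: m_def)
    have m: "m \<ge> m1" using True jm by linarith
    have "\<bar>u j\<bar> \<le> exp (- (L / 8 * real m))"
      using m jm by (intro far) (auto simp: m1_def)
    also have "\<dots> \<le> exp (15 * c + - c * real_of_int j)"
    proof -
      have "real_of_int j \<le> 16 * real m + 15" using jm by linarith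
      then have "c * real_of_int j \<le> c * (16 * real m + 15)" using c by (intro mult_left_mono) auto
      then show ?thesis by (simp add: c_def field_simps)
    qed
    also have "\<dots> \<le> C * exp (- c * real_of_int j)"
      using B0 unfolding exp_add C_def by (intro mult_right_mono) auto
    finally show ?thesis .
  next
    case False
    then have jr: "real_of_int j \<le> 16 * real m1" by linarith
    have "\<bar>u j\<bar> \<le> B * (1 + 16 * real m1)\<^sup>2"
      using B[of j] j jr by (intro order_trans[OF B] mult_left_mono power_mono B0) auto
    also have "\<dots> \<le> B * (1 + 16 * real m1)\<^sup>2 * exp (c * (16 * real m1)) * exp (- c * real_of_int j)"
    proof -
      have "c * real_of_int j \<le> c * (16 * real m1)" using c jr by (intro mult_left_mono) auto
      then have "1 \<le> exp (c * (16 * real m1)) * exp (- c * real_of_int j)" unfolding exp_add[symmetric] by simp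
      then show ?thesis using B0 mult_left_mono[of 1 _ "B * (1 + 16 * real m1)\<^sup>2"] by (simp add: mult.assoc)
    qed
    also have "\<dots> \<le> C * exp (- c * real_of_int j)" unfolding C_def by (intro mult_right_mono) auto
    finally show ?thesis .
  qed
  then show thesis using that c by blast
  qed
qed
qed
qed

text \<open>Since the potential is an even function of the phase, the reflected sequence solves the
  equation with phase \<open>- \<theta>\<close>, at the same energy and the same exponent.\<close>

theorem V1_decay:
  fixes u :: "int \<Rightarrow> real"
  assumes dio: "diophantine \<alpha> \<gamma> \<sigma>" and nonres: "nonresonant \<alpha> \<theta> \<eta> \<sigma>" and \<tau>: "\<bar>\<tau>\<bar> < 1"
    and L: "lyapunov (V1 lam \<tau> \<alpha>) E > 0"
    and u: "\<And>j. u (j + 1) + u (j - 1) = (E - V1 lam \<tau> \<alpha> \<theta> j) * u j"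
    and B: "\<And>j. \<bar>u j\<bar> \<le> B * (1 + \<bar>real_of_int j\<bar>)\<^sup>2"
  shows "\<exists>C c. c > 0 \<and> (\<forall>j. \<bar>u j\<bar> \<le> C * exp (- c * \<bar>real_of_int j\<bar>))"
proof (rule V1_decay_right[OF dio nonres \<tau> L u B])
  fix C c :: real
  assume right: "c > 0" "\<And>j. j \<ge> 0 \<Longrightarrow> \<bar>u j\<bar> \<le> C * exp (- c * real_of_int j)"
  have refl: "V1 lam \<tau> \<alpha> (- \<theta>) j = V1 lam \<tau> \<alpha> \<theta> (- j)" for j
  proof -
    have "- \<theta> + of_int j * \<alpha> = - (\<theta> + of_int (- j) * \<alpha>)" by simp
    then show ?thesis unfolding V1_eq by (simp only: gaa_potential_even)
  qed
  show ?thesis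
  proof (rule V1_decay_right[OF dio nonresonant_uminus[OF nonres] \<tau> L, where u = "\<lambda>j. u (- j)" and B = B])
    fix j :: int
    have e: "- j + 1 = - (j - 1)" "- j - 1 = - (j + 1)" by linarith+
    show "u (- (j + 1)) + u (- (j - 1)) = (E - V1 lam \<tau> \<alpha> (- \<theta>) j) * u (- j)"
      using u[of "- j"] unfolding refl e by linarith
  next
    fix j show "\<bar>u (- j)\<bar> \<le> B * (1 + \<bar>real_of_int j\<bar>)\<^sup>2" using B[of "- j"] by simp
  next
    fix C' c' :: real
    assume left: "c' > 0" "\<And>j. j \<ge> 0 \<Longrightarrow> \<bar>u (- j)\<bar> \<le> C' * exp (- c' * real_of_int j)"
    have "\<bar>u j\<bar> \<le> (\<bar>C\<bar> + \<bar>C'\<bar>) * exp (- min c c' * \<bar>real_of_int j\<bar>)" for j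
    proof (cases "j \<ge> 0")
      case True
      have "\<bar>u j\<bar> \<le> C * exp (- c * real_of_int j)" using right(2) True by simp
      also have "\<dots> \<le> (\<bar>C\<bar> + \<bar>C'\<bar>) * exp (- min c c' * \<bar>real_of_int j\<bar>)"
        using True by (intro mult_mono) (auto intro: mult_right_mono)
      finally show ?thesis .
    next
      case False
      have "\<bar>u j\<bar> \<le> C' * exp (- c' * real_of_int (- j))" using left(2)[of "- j"] False by simp
      also have "\<dots> \<le> (\<bar>C\<bar> + \<bar>C'\<bar>) * exp (- min c c' * \<bar>real_of_int j\<bar>)"
        using False by (intro mult_mono) (auto intro: mult_right_mono)
      finally show ?thesis .
    qed
    then show ?thesis using right(1) left(1) by (intro exI[of _ "\<bar>C\<bar> + \<bar>C'\<bar>"] exI[of _ "min c c'"]) auto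
  qed
qed

section \<open>The mosaic model and its reduction\<close>

lemma lyapunov_eq_0:
  assumes cont: "\<And>n. continuous_on UNIV (\<lambda>\<theta>. V \<theta> n)"
    and le: "\<And>n. integral {0..1} (log_norm V E n) \<le> b n"
    and b: "(\<lambda>n. b n / real n) \<longlonglongrightarrow> 0"
  shows "lyapunov V E = 0"
proof -
  have "0 \<le> integral {0..1} (log_norm V E n)" for n
    by (intro integral_nonneg integrable_continuous_interval continuous_on_subset[OF log_norm_continuous[OF cont]] log_norm_nonneg) auto
  then have "(\<lambda>n. integral {0..1} (log_norm V E n) / real n) \<longlonglongrightarrow> 0"
    by (intro tendsto_sandwich[OF _ _ tendsto_const b]) (auto intro!: always_eventually divide_right_mono le)
  then show ?thesis unfolding lyapunov_def log_norm_def by (simp add: limI)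
qed

lemma V2_continuous: "continuous_on UNIV (\<lambda>\<theta>. V2 lam \<alpha> \<theta> n)"
  unfolding V2_def by (cases "even n") (auto intro!: continuous_intros)

lemma V2_bounded: "\<bar>V2 lam \<alpha> \<theta> n\<bar> \<le> 2 * \<bar>lam\<bar>"
proof (cases "even n")
  case True
  have "\<bar>lam\<bar> * \<bar>cos (2 * pi * (\<theta> + of_int n * \<alpha>))\<bar> \<le> \<bar>lam\<bar> * 1" by (intro mult_left_mono) auto
  then show ?thesis using True by (simp add: V2_def abs_mult)
qed (simp add: V2_def)

lemma V2_shift: "V2 lam \<alpha> \<theta> (j + int (2 * m)) = V2 lam \<alpha> (\<theta> + real (2 * m) * \<alpha>) j"
  by (simp add: V2_def algebra_simps)

lemma V2_eq_V1: "E * V2 lam \<alpha> \<theta> (2 * m) = V1 (E * lam) 0 (2 * \<alpha>) \<theta> m"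
  by (simp add: V2_def V1_def mult_ac)

lemma V2_odd: "V2 lam \<alpha> \<theta> (2 * m + 1) = 0" "V2 lam \<alpha> \<theta> (2 * m - 1) = 0"
  by (simp_all add: V2_def)

text \<open>The mosaic potential is covariant under even shifts, so estimates are made for even
  lengths; a last odd step costs a bounded factor.\<close>

lemma log_norm_V2_parity:
  "log_norm (V2 lam \<alpha>) E n \<theta> \<le> log_norm (V2 lam \<alpha>) E (2 * (n div 2)) \<theta> + ln (4 * (\<bar>E\<bar> + 2 * \<bar>lam\<bar> + 2))"
proof (cases "even n")
  case True
  have "0 \<le> ln (4 * (\<bar>E\<bar> + 2 * \<bar>lam\<bar> + 2))" by (rule ln_ge_zero) simp
  then show ?thesis using True by simp
next
  case False
  define m where "m = n div 2"
  have n: "n = 2 * m + 1" using False by (simp add: m_def)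
  let ?\<theta> = "\<theta> + real (2 * m) * \<alpha>"
  have "onorm ((*v) (transfer_matrix (V2 lam \<alpha>) E ?\<theta> 1)) \<le> 4 * (\<bar>E - V2 lam \<alpha> ?\<theta> 0\<bar> + 2)"
    using onorm_matrix2_le_sum[of "transfer_matrix (V2 lam \<alpha>) E ?\<theta> 1"]
    by (simp add: transfer_step_def sum_2)
  also have "\<dots> \<le> 4 * (\<bar>E\<bar> + 2 * \<bar>lam\<bar> + 2)"
    using V2_bounded[of lam \<alpha> ?\<theta> 0] by (intro mult_left_mono) linarith+
  finally have "log_norm (V2 lam \<alpha>) E 1 ?\<theta> \<le> ln (4 * (\<bar>E\<bar> + 2 * \<bar>lam\<bar> + 2))"
    unfolding log_norm_def using onorm_transfer_matrix_pos[of "V2 lam \<alpha>" E ?\<theta> 1] by (subst ln_le_cancel_iff) auto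
  moreover have "log_norm (V2 lam \<alpha>) E (2 * m + 1) \<theta> \<le> log_norm (V2 lam \<alpha>) E (2 * m) \<theta> + log_norm (V2 lam \<alpha>) E 1 ?\<theta>"
    by (rule log_norm_add) (rule V2_shift)
  ultimately show ?thesis by (simp add: n)
qed

text \<open>At zero energy the transfer matrix over two sites is minus a lower triangular matrix
  with unit diagonal, so products grow at most linearly. A positive exponent therefore permits
  division by \<open>E\<close>.\<close>

lemma lyapunov_V2_0: "lyapunov (V2 lam \<alpha>) 0 = 0"
proof -
  have mat: "transfer_matrix (V2 lam \<alpha>) 0 \<theta> (2 * m) $ 1 $ 1 = (- 1) ^ m \<and>
     transfer_matrix (V2 lam \<alpha>) 0 \<theta> (2 * m) $ 1 $ 2 = 0 \<and>
     transfer_matrix (V2 lam \<alpha>) 0 \<theta> (2 * m) $ 2 $ 2 = (- 1) ^ m \<and>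
     \<bar>transfer_matrix (V2 lam \<alpha>) 0 \<theta> (2 * m) $ 2 $ 1\<bar> \<le> 2 * \<bar>lam\<bar> * real m" for m \<theta>
  proof (induction m)
    case 0 show ?case by (simp add: mat_def)
  next
    case (Suc m)
    let ?A = "transfer_matrix (V2 lam \<alpha>) 0 \<theta>"
    have odd: "V2 lam \<alpha> \<theta> (1 + 2 * int m) = 0" using V2_odd(1)[of lam \<alpha> \<theta> "int m"] by (simp add: add.commute)
    have "?A (2 * Suc m) = transfer_step (V2 lam \<alpha>) 0 \<theta> (1 + 2 * int m) ** (transfer_step (V2 lam \<alpha>) 0 \<theta> (2 * int m) ** ?A (2 * m))"
      by simp
    then have eqs: "?A (2 * Suc m) $ 1 $ j = - ?A (2 * m) $ 1 $ j"
      "?A (2 * Suc m) $ 2 $ j = - (V2 lam \<alpha> \<theta> (2 * int m) * ?A (2 * m) $ 1 $ j) - ?A (2 * m) $ 2 $ j" for j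
      by (simp_all add: transfer_step_def matrix_matrix_mult_def sum_2 odd del: transfer_matrix.simps)
    have "\<bar>- (V2 lam \<alpha> \<theta> (2 * int m) * (- 1) ^ m) - ?A (2 * m) $ 2 $ 1\<bar>
        \<le> \<bar>V2 lam \<alpha> \<theta> (2 * int m) * (- 1) ^ m\<bar> + \<bar>?A (2 * m) $ 2 $ 1\<bar>" by linarith
    also have "\<dots> \<le> 2 * \<bar>lam\<bar> + 2 * \<bar>lam\<bar> * real m"
      using V2_bounded[of lam \<alpha> \<theta> "2 * int m"] Suc by (intro add_mono) (auto simp: abs_mult power_abs)
    finally show ?case unfolding eqs using Suc by (simp add: algebra_simps)
  qed
  let ?K = "ln (4 * (\<bar>0\<bar> + 2 * \<bar>lam\<bar> + 2))"
  define b where "b n = ln (4 * (2 + 2 * \<bar>lam\<bar> * real n)) + ?K" for n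
  have even: "log_norm (V2 lam \<alpha>) 0 (2 * m) \<theta> \<le> ln (4 * (2 + 2 * \<bar>lam\<bar> * real m))" for m \<theta>
  proof -
    have "onorm ((*v) (transfer_matrix (V2 lam \<alpha>) 0 \<theta> (2 * m))) \<le> 4 * (2 + 2 * \<bar>lam\<bar> * real m)"
      using onorm_matrix2_le_sum[of "transfer_matrix (V2 lam \<alpha>) 0 \<theta> (2 * m)"] mat[of \<theta> m]
      by (simp add: sum_2 power_abs del: transfer_matrix.simps)
    then show ?thesis unfolding log_norm_def
      using onorm_transfer_matrix_pos[of "V2 lam \<alpha>" 0 \<theta> "2 * m"] by (subst ln_le_cancel_iff) (auto simp: add_pos_nonneg)
  qed
  have le: "log_norm (V2 lam \<alpha>) 0 n \<theta> \<le> b n" for n \<theta>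
  proof -
    have "2 * \<bar>lam\<bar> * real (n div 2) \<le> 2 * \<bar>lam\<bar> * real n" by (intro mult_left_mono) auto
    then have "ln (4 * (2 + 2 * \<bar>lam\<bar> * real (n div 2))) \<le> ln (4 * (2 + 2 * \<bar>lam\<bar> * real n))"
      by (subst ln_le_cancel_iff) (auto simp: add_pos_nonneg)
    then show ?thesis using log_norm_V2_parity[of lam \<alpha> 0 n \<theta>] even[of "n div 2" \<theta>] unfolding b_def by linarith
  qed
  show ?thesis
  proof (rule lyapunov_eq_0[OF V2_continuous])
    fix n
    have "integral {0..1} (log_norm (V2 lam \<alpha>) 0 n) \<le> integral {0..1} (\<lambda>x::real. b n)"
      by (intro integral_le integrable_continuous_interval continuous_on_subset[OF log_norm_continuous[OF V2_continuous]] le) auto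
    then show "integral {0..1} (log_norm (V2 lam \<alpha>) 0 n) \<le> b n" by simp
  next
    show "(\<lambda>n. b n / real n) \<longlonglongrightarrow> 0"
    proof (cases "lam = 0")
      case True
      then have "(\<lambda>n. b n / real n) = (\<lambda>n. (ln 8 + ?K) / real n)" by (simp add: b_def)
      then show ?thesis by (simp only:) real_asymp
    next
      case False
      define l where "l = \<bar>lam\<bar>"
      have l: "l > 0" using False by (simp add: l_def)
      have "(\<lambda>n. (ln (4 * (2 + 2 * l * real n)) + c) / real n) \<longlonglongrightarrow> 0" for c :: real using l by real_asymp
      then show ?thesis unfolding b_def l_def .
    qed
  qed
qed

text \<open>If \<open>u\<close> solves the mosaic equation, the matrix \<open>C E\<close> maps \<open>(u\<^sub>2\<^sub>m, u\<^sub>2\<^sub>m\<^sub>-\<^sub>1)\<close> to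
  \<open>(u\<^sub>2\<^sub>m, u\<^sub>2\<^sub>m\<^sub>-\<^sub>2)\<close>.\<close>

lemma V2_transfer_conjugate:
  defines "C E \<equiv> (vector [vector [1, 0], vector [- 1, E]] :: real^2^2)"
  shows "C E ** transfer_matrix (V2 lam \<alpha>) E \<theta> (2 * m)
    = transfer_matrix (V1 (E * lam) 0 (2 * \<alpha>)) (E\<^sup>2 - 2) \<theta> m ** C E"
proof (induction m)
  case (Suc m)
  let ?A = "transfer_matrix (V2 lam \<alpha>) E \<theta>" and ?S = "transfer_step (V2 lam \<alpha>) E \<theta>"
    and ?S' = "transfer_step (V1 (E * lam) 0 (2 * \<alpha>)) (E\<^sup>2 - 2) \<theta> (int m)"
  have odd: "V2 lam \<alpha> \<theta> (1 + 2 * int m) = 0" using V2_odd(1)[of lam \<alpha> \<theta> "int m"] by (simp add: add.commute)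
  have odd': "V2 lam \<alpha> \<theta> (1 + int m * 2) = 0" using odd by (simp only: mult.commute)
  have step: "C E ** (?S (1 + 2 * int m) ** ?S (2 * int m)) = ?S' ** C E"
    unfolding C_def transfer_step_def V2_eq_V1[symmetric]
    by (simp add: vec_eq_iff forall_2 matrix_matrix_mult_def sum_2 odd odd' power2_eq_square algebra_simps)
  have "?A (2 * Suc m) = ?S (1 + 2 * int m) ** (?S (2 * int m) ** ?A (2 * m))" by simp
  then have "C E ** ?A (2 * Suc m) = (C E ** (?S (1 + 2 * int m) ** ?S (2 * int m))) ** ?A (2 * m)"
    by (simp only: matrix_mul_assoc)
  also have "\<dots> = ?S' ** (C E ** ?A (2 * m))" unfolding step by (simp only: matrix_mul_assoc)
  finally show ?case unfolding Suc by (simp add: matrix_mul_assoc)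
qed simp

text \<open>For \<open>E \<noteq> 0\<close> the conjugating matrix has the inverse
  \<open>?D\<close>. Passing from two mosaic steps to one step of the reduced model then costs a
  constant, however long the product.\<close>

lemma log_norm_V2_le:
  assumes "E \<noteq> 0"
  obtains K where "\<And>n \<theta>. log_norm (V2 lam \<alpha>) E n \<theta> \<le> K + log_norm (V1 (E * lam) 0 (2 * \<alpha>)) (E\<^sup>2 - 2) (n div 2) \<theta>"
proof -
  let ?C = "vector [vector [1, 0], vector [- 1, E]] :: real^2^2"
  let ?D = "vector [vector [1, 0], vector [1 / E, 1 / E]] :: real^2^2"
  define \<kappa> where "\<kappa> = onorm ((*v) ?D) * onorm ((*v) ?C)"
  have inv: "?D ** ?C = mat 1"
    using assms by (simp add: vec_eq_iff forall_2 matrix_matrix_mult_def sum_2 mat_def)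
  have le: "log_norm (V2 lam \<alpha>) E (2 * m) \<theta> \<le> ln \<kappa> + log_norm (V1 (E * lam) 0 (2 * \<alpha>)) (E\<^sup>2 - 2) m \<theta>" for m \<theta>
  proof -
    let ?A = "transfer_matrix (V2 lam \<alpha>) E \<theta> (2 * m)"
    let ?B = "transfer_matrix (V1 (E * lam) 0 (2 * \<alpha>)) (E\<^sup>2 - 2) \<theta> m"
    have "?A = (?D ** ?C) ** ?A" unfolding inv by simp
    also have "\<dots> = ?D ** (?B ** ?C)" by (simp only: matrix_mul_assoc[symmetric] V2_transfer_conjugate)
    finally have "onorm ((*v) ?A) \<le> onorm ((*v) ?D) * onorm ((*v) (?B ** ?C))" by (metis onorm_matrix_mul)
    also have "\<dots> \<le> onorm ((*v) ?D) * (onorm ((*v) ?B) * onorm ((*v) ?C))"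
      by (intro mult_left_mono onorm_matrix_mul onorm_pos_le matrix_vector_mul_bounded_linear)
    finally have 1: "onorm ((*v) ?A) \<le> \<kappa> * onorm ((*v) ?B)" by (simp add: \<kappa>_def mult_ac)
    have A0: "0 < onorm ((*v) ?A)" and B0: "0 < onorm ((*v) ?B)" by (rule onorm_transfer_matrix_pos)+
    then have "0 < \<kappa> * onorm ((*v) ?B)" using 1 by linarith
    then have \<kappa>: "0 < \<kappa>" using B0 by (simp add: zero_less_mult_iff)
    have "ln (onorm ((*v) ?A)) \<le> ln (\<kappa> * onorm ((*v) ?B))" using 1 A0 by (subst ln_le_cancel_iff) auto
    then show ?thesis unfolding log_norm_def using \<kappa> B0 by (simp add: ln_mult)
  qed
  show thesis
  proof (rule that[of "ln \<kappa> + ln (4 * (\<bar>E\<bar> + 2 * \<bar>lam\<bar> + 2))"])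
    fix n \<theta>
    show "log_norm (V2 lam \<alpha>) E n \<theta> \<le> ln \<kappa> + ln (4 * (\<bar>E\<bar> + 2 * \<bar>lam\<bar> + 2))
        + log_norm (V1 (E * lam) 0 (2 * \<alpha>)) (E\<^sup>2 - 2) (n div 2) \<theta>"
      using log_norm_V2_parity[of lam \<alpha> E n \<theta>] le[of "n div 2" \<theta>] by linarith
  qed
qed

text \<open>The mosaic cocycle depends on the parity of the site, so \<open>lyapunov_bounds\<close>
  is applied to the reduced model alone. If its exponent vanished, \<open>log_norm_V2_le\<close>
  would force the mosaic averages to converge to 0 as well.\<close>

lemma lyapunov_V2_pos:
  assumes dio: "diophantine \<alpha> \<gamma> \<sigma>" and pos: "lyapunov (V2 lam \<alpha>) E > 0"
  shows "E \<noteq> 0 \<and> lyapunov (V1 (E * lam) 0 (2 * \<alpha>)) (E\<^sup>2 - 2) > 0"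
proof
  show E: "E \<noteq> 0" using pos lyapunov_V2_0[of lam \<alpha>] by auto
  let ?V = "V1 (E * lam) 0 (2 * \<alpha>)" and ?E = "E\<^sup>2 - 2"
  have dio2: "diophantine (2 * \<alpha>) (\<gamma> * 2 powr (- \<sigma>)) \<sigma>" using diophantine_mult[OF dio, of 2] by simp
  have \<tau>: "\<bar>0\<bar> < (1::real)" by simp
  have lim: "(\<lambda>n. integral {0..1} (log_norm ?V ?E n) / real n) \<longlonglongrightarrow> lyapunov ?V ?E"
    unfolding V1_eq by (rule lyapunov_bounds(1)[OF dio2 gaa_potential_periodic gaa_potential_continuous[OF \<tau>]])
  have contV: "continuous_on UNIV (\<lambda>\<theta>. ?V \<theta> n)" for n
    unfolding V1_eq by (intro continuous_on_compose2[OF gaa_potential_continuous[OF \<tau>]] continuous_intros) auto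
  have int: "log_norm V E' n integrable_on {0..1}" if "\<And>n. continuous_on UNIV (\<lambda>\<theta>. V \<theta> n)" for V E' n
    by (intro integrable_continuous_interval continuous_on_subset[OF log_norm_continuous[OF that]]) auto
  define a where "a n = integral {0..1} (log_norm ?V ?E n)" for n
  have a0: "0 \<le> a n" for n unfolding a_def by (intro integral_nonneg int contV log_norm_nonneg)
  show "lyapunov ?V ?E > 0"
  proof (rule ccontr)
    assume "\<not> lyapunov ?V ?E > 0"
    moreover have "0 \<le> lyapunov ?V ?E"
      by (rule LIMSEQ_le_const[OF lim]) (use a0 in \<open>auto simp: a_def\<close>)
    ultimately have "lyapunov ?V ?E = 0" by simp
    then have lim0: "(\<lambda>n. a n / real n) \<longlonglongrightarrow> 0" using lim by (simp add: a_def)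
    have half: "filterlim (\<lambda>n::nat. n div 2) sequentially sequentially"
      unfolding filterlim_at_top eventually_sequentially
      by (metis div_le_mono nonzero_mult_div_cancel_left zero_neq_numeral)
    have lim2: "(\<lambda>n. a (n div 2) / real (n div 2)) \<longlonglongrightarrow> 0"
      by (rule filterlim_compose[OF lim0 half])
    have lim3: "(\<lambda>n. a (n div 2) / real n) \<longlonglongrightarrow> 0"
    proof (rule tendsto_sandwich[OF _ _ tendsto_const lim2])
      show "\<forall>\<^sub>F n in sequentially. a (n div 2) / real n \<le> a (n div 2) / real (n div 2)"
        using eventually_ge_at_top[of 2]
      proof eventually_elim
        case (elim n)
        then have "0 < real (n div 2)" "real (n div 2) \<le> real n" by auto
        then show ?case using a0 by (intro divide_left_mono mult_pos_pos) auto
      qed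
    qed (use a0 in auto)
    show False
    proof (rule log_norm_V2_le[OF E, of lam \<alpha>])
      fix K assume K: "\<And>n \<theta>. log_norm (V2 lam \<alpha>) E n \<theta> \<le> K + log_norm ?V ?E (n div 2) \<theta>"
      have "lyapunov (V2 lam \<alpha>) E = 0"
      proof (rule lyapunov_eq_0[OF V2_continuous])
        fix n
        have "integral {0..1} (log_norm (V2 lam \<alpha>) E n) \<le> integral {0..1} (\<lambda>x. K + log_norm ?V ?E (n div 2) x)"
          by (intro integral_le int V2_continuous contV Henstock_Kurzweil_Integration.integrable_add integrable_const_ivl K)
        also have "\<dots> = K + a (n div 2)"
          unfolding a_def by (subst Henstock_Kurzweil_Integration.integral_add) (auto intro: int contV)
        finally show "integral {0..1} (log_norm (V2 lam \<alpha>) E n) \<le> K + a (n div 2)" .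
      next
        have "(\<lambda>n. K / real n) \<longlonglongrightarrow> 0" by real_asymp
        from tendsto_add[OF this lim3] show "(\<lambda>n. (K + a (n div 2)) / real n) \<longlonglongrightarrow> 0"
          by (simp add: add_divide_distrib)
      qed
      then show False using pos by simp
    qed
  qed
qed

theorem V2_decay:
  fixes u :: "int \<Rightarrow> real"
  assumes dio: "diophantine \<alpha> \<gamma> \<sigma>" and nonres: "nonresonant \<alpha> \<theta> \<eta> \<sigma>"
    and L: "lyapunov (V2 lam \<alpha>) E > 0"
    and u: "\<And>j. u (j + 1) + u (j - 1) = (E - V2 lam \<alpha> \<theta> j) * u j"
    and B: "\<And>j. \<bar>u j\<bar> \<le> B * (1 + \<bar>real_of_int j\<bar>)\<^sup>2"
  shows "\<exists>C c. c > 0 \<and> (\<forall>j. \<bar>u j\<bar> \<le> C * exp (- c * \<bar>real_of_int j\<bar>))"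
proof -
  have E: "E \<noteq> 0" and L': "lyapunov (V1 (E * lam) 0 (2 * \<alpha>)) (E\<^sup>2 - 2) > 0"
    using lyapunov_V2_pos[OF dio L] by auto
  have dio2: "diophantine (2 * \<alpha>) (\<gamma> * 2 powr (- \<sigma>)) \<sigma>" using diophantine_mult[OF dio, of 2] by simp
  have nonres2: "nonresonant (2 * \<alpha>) \<theta> (\<eta> * 2 powr (- \<sigma>)) \<sigma>" using nonresonant_mult[OF nonres, of 2] by simp
  have B0: "B \<ge> 0" using order_trans[OF abs_ge_zero B[of 0]] by simp
  have odd: "u (2 * m + 2) + u (2 * m) = E * u (2 * m + 1)" for m
    using u[of "2 * m + 1"] V2_odd(1)[of lam \<alpha> \<theta> m] by (simp add: add.commute)
  have "\<exists>C c. c > 0 \<and> (\<forall>j. \<bar>u (2 * j)\<bar> \<le> C * exp (- c * \<bar>real_of_int j\<bar>))"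
  proof (rule V1_decay[OF dio2 nonres2 _ L', where u = "\<lambda>m. u (2 * m)" and B = "4 * B"])
    fix m
    \<comment> \<open>The equations at both odd neighbours of \<open>2 * m\<close> are added; the
      equation at \<open>2 * m\<close> then replaces the sum of the two odd values.\<close>
    have "u (2 * (m + 1)) + u (2 * (m - 1)) + 2 * u (2 * m) = E * u (2 * m + 1) + E * u (2 * m - 1)"
      using odd[of m] odd[of "m - 1"] by (simp add: algebra_simps)
    also have "\<dots> = E * (u (2 * m + 1) + u (2 * m - 1))" by (simp add: distrib_left)
    also have "\<dots> = (E * E - E * V2 lam \<alpha> \<theta> (2 * m)) * u (2 * m)"
      unfolding u by (simp add: algebra_simps)
    finally show "u (2 * (m + 1)) + u (2 * (m - 1)) = (E\<^sup>2 - 2 - V1 (E * lam) 0 (2 * \<alpha>) \<theta> m) * u (2 * m)"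
      unfolding V2_eq_V1 by (simp add: power2_eq_square algebra_simps)
  next
    fix m
    have "B * (1 + \<bar>real_of_int (2 * m)\<bar>)\<^sup>2 \<le> B * (2 * (1 + \<bar>real_of_int m\<bar>))\<^sup>2"
      by (intro mult_left_mono power_mono B0) auto
    also have "\<dots> = 4 * B * (1 + \<bar>real_of_int m\<bar>)\<^sup>2" unfolding power_mult_distrib by simp
    finally show "\<bar>u (2 * m)\<bar> \<le> 4 * B * (1 + \<bar>real_of_int m\<bar>)\<^sup>2" using B[of "2 * m"] by linarith
  qed simp
  then obtain C c where c: "c > 0" and C: "\<And>j. \<bar>u (2 * j)\<bar> \<le> C * exp (- c * \<bar>real_of_int j\<bar>)" by blast
  have C0: "C \<ge> 0" using order_trans[OF abs_ge_zero C[of 0]] by simp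
  define C' where "C' = (C + 2 * C / \<bar>E\<bar>) * exp (c / 2)"
  have "\<bar>u n\<bar> \<le> C' * exp (- (c / 2) * \<bar>real_of_int n\<bar>)" for n
  proof -
    have even: "\<bar>u (2 * j)\<bar> \<le> C * (exp (c / 2) * exp (- (c / 2) * \<bar>real_of_int n\<bar>))" if "\<bar>n\<bar> \<le> 2 * \<bar>j\<bar> + 1" for j
    proof -
      have "\<bar>real_of_int n\<bar> \<le> 2 * \<bar>real_of_int j\<bar> + 1" using that by linarith
      then have "c / 2 * \<bar>real_of_int n\<bar> \<le> c / 2 * (2 * \<bar>real_of_int j\<bar> + 1)" using c by (intro mult_left_mono) auto
      then have "exp (- c * \<bar>real_of_int j\<bar>) \<le> exp (c / 2) * exp (- (c / 2) * \<bar>real_of_int n\<bar>)"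
        unfolding exp_add[symmetric] by (simp add: field_simps)
      then have "C * exp (- c * \<bar>real_of_int j\<bar>) \<le> C * (exp (c / 2) * exp (- (c / 2) * \<bar>real_of_int n\<bar>))"
        using C0 by (intro mult_left_mono) auto
      then show ?thesis using C[of j] by linarith
    qed
    let ?X = "exp (c / 2) * exp (- (c / 2) * \<bar>real_of_int n\<bar>)"
    have "\<bar>u n\<bar> \<le> (C + 2 * C / \<bar>E\<bar>) * ?X"
    proof (cases "even n")
      case True
      then obtain j where j: "n = 2 * j" by (elim evenE)
      have "\<bar>u n\<bar> \<le> C * ?X" using even[of j] unfolding j by simp
      also have "\<dots> \<le> (C + 2 * C / \<bar>E\<bar>) * ?X" using C0 by (intro mult_right_mono) auto
      finally show ?thesis .
    next
      case False
      then obtain j where j: "n = 2 * j + 1" by (elim oddE)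
      \<comment> \<open>An odd site is recovered from its two even neighbours by dividing by
        \<open>E\<close>; the slack of 1 in \<open>even\<close> covers both of them.\<close>
      have j1: "\<bar>n\<bar> \<le> 2 * \<bar>j\<bar> + 1" "\<bar>n\<bar> \<le> 2 * \<bar>j + 1\<bar> + 1" unfolding j by arith+
      have "\<bar>E\<bar> * \<bar>u n\<bar> = \<bar>u (2 * (j + 1)) + u (2 * j)\<bar>" using odd[of j] unfolding j by (simp add: abs_mult[symmetric] distrib_left)
      also have "\<dots> \<le> C * ?X + C * ?X" using even[OF j1(1)] even[OF j1(2)] by linarith
      finally have "\<bar>u n\<bar> \<le> 2 * C / \<bar>E\<bar> * ?X" using E by (simp add: field_simps)
      also have "\<dots> \<le> (C + 2 * C / \<bar>E\<bar>) * ?X" using C0 by (intro mult_right_mono) auto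
      finally show ?thesis .
    qed
    then show ?thesis by (simp add: C'_def mult_ac)
  qed
  then show ?thesis using c by (intro exI[of _ C'] exI[of _ "c / 2"]) auto
qed

section \<open>Spectral measures and generalized eigenfunctions\<close>

lemma ell2_scale: "u \<in> ell2 \<Longrightarrow> (\<lambda>n. c * u n) \<in> ell2"
  unfolding ell2_def by (simp add: norm_mult power_mult_distrib summable_on_cmult_right)

lemma ell2_add:
  assumes "u \<in> ell2" "v \<in> ell2"
  shows "(\<lambda>n. u n + v n) \<in> ell2"
proof -
  have "(cmod (a + b))\<^sup>2 \<le> 2 * (cmod a)\<^sup>2 + 2 * (cmod b)\<^sup>2" for a b
  proof -
    have "(cmod (a + b))\<^sup>2 \<le> (cmod a + cmod b)\<^sup>2" by (intro power_mono norm_triangle_ineq) auto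
    also have "\<dots> \<le> 2 * (cmod a)\<^sup>2 + 2 * (cmod b)\<^sup>2"
      using sum_squares_bound[of "cmod a" "cmod b"] by (simp add: power2_sum)
    finally show ?thesis .
  qed
  moreover have "(\<lambda>n. 2 * (cmod (u n))\<^sup>2 + 2 * (cmod (v n))\<^sup>2) summable_on UNIV"
    using assms by (intro summable_on_add summable_on_cmult_right) (auto simp: ell2_def)
  ultimately show ?thesis unfolding ell2_def by (auto intro: summable_on_comparison_test)
qed

lemma ell2_diff:
  assumes "u \<in> ell2" "v \<in> ell2"
  shows "(\<lambda>n. u n - v n) \<in> ell2"
  using ell2_add[OF assms(1) ell2_scale[OF assms(2), of "-1"]] by simp

lemma ell2_inner_summable:
  assumes "u \<in> ell2" "v \<in> ell2"
  shows "(\<lambda>n. cnj (u n) * v n) summable_on UNIV"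
proof (rule abs_summable_summable, rule summable_on_comparison_test)
  show "(\<lambda>n. (cmod (u n))\<^sup>2 + (cmod (v n))\<^sup>2) summable_on UNIV"
    using assms by (intro summable_on_add) (auto simp: ell2_def)
  fix n show "norm (cnj (u n) * v n) \<le> (cmod (u n))\<^sup>2 + (cmod (v n))\<^sup>2"
    unfolding norm_mult complex_mod_cnj
    using sum_squares_bound[of "cmod (u n)" "cmod (v n)"] mult_nonneg_nonneg[OF norm_ge_zero norm_ge_zero, of "u n" "v n"]
    by linarith
qed auto

text \<open>The spectral data enter through quadratic forms, for which the real part is enough. It
  is symmetric, so that polarization takes two terms instead of four.\<close>

definition rinner :: "(int \<Rightarrow> complex) \<Rightarrow> (int \<Rightarrow> complex) \<Rightarrow> real" where
  "rinner u v = Re (ell2_inner u v)"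

lemma rinner_add_right:
  assumes "u \<in> ell2" "v \<in> ell2" "w \<in> ell2"
  shows "rinner u (\<lambda>n. v n + w n) = rinner u v + rinner u w"
  unfolding rinner_def ell2_inner_def distrib_left
  using assms by (subst infsum_add) (auto intro: ell2_inner_summable)

lemma ell2_inner_cnj: "ell2_inner v u = cnj (ell2_inner u v)"
  unfolding ell2_inner_def infsum_cnj[symmetric] by (simp add: mult.commute)

lemma rinner_commute: "rinner v u = rinner u v"
  unfolding rinner_def ell2_inner_cnj[of v u] by simp

lemma rinner_scale_right: "rinner u (\<lambda>n. of_real c * v n) = c * rinner u v"
proof -
  have "cnj (u n) * (of_real c * v n) = of_real c * (cnj (u n) * v n)" for n by simp
  then show ?thesis unfolding rinner_def ell2_inner_def by (simp only: infsum_cmult_right') simp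
qed

lemma rinner_add_left:
  assumes "u \<in> ell2" "v \<in> ell2" "w \<in> ell2"
  shows "rinner (\<lambda>n. v n + w n) u = rinner v u + rinner w u"
  using rinner_add_right[OF assms] by (simp add: rinner_commute)

lemma rinner_diff_right:
  assumes "u \<in> ell2" "v \<in> ell2" "w \<in> ell2"
  shows "rinner u (\<lambda>n. v n - w n) = rinner u v - rinner u w"
  using rinner_add_right[OF assms(1,2) ell2_scale[OF assms(3), of "-1"]] rinner_scale_right[of u "-1" w] by simp

lemma rinner_diff_left:
  assumes "u \<in> ell2" "v \<in> ell2" "w \<in> ell2"
  shows "rinner (\<lambda>n. v n - w n) u = rinner v u - rinner w u"
  using rinner_diff_right[OF assms] by (simp add: rinner_commute)

lemma rinner_zero [simp]: "rinner u (\<lambda>n. 0) = 0" "rinner (\<lambda>n. 0) u = 0"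
  by (simp_all add: rinner_def ell2_inner_def)

lemma rinner_self: "u \<in> ell2 \<Longrightarrow> rinner u u = (\<Sum>\<^sub>\<infinity>n. (cmod (u n))\<^sup>2)"
proof -
  assume u: "u \<in> ell2"
  have eq: "cnj (u n) * u n = complex_of_real ((cmod (u n))\<^sup>2)" for n
    by (metis complex_norm_square mult.commute)
  have "((\<lambda>n. complex_of_real ((cmod (u n))\<^sup>2)) has_sum complex_of_real (\<Sum>\<^sub>\<infinity>n. (cmod (u n))\<^sup>2)) UNIV"
    unfolding has_sum_of_real_iff using u by (intro has_sum_infsum) (simp add: ell2_def)
  then show ?thesis unfolding rinner_def ell2_inner_def eq by (simp add: infsumI)
qed

lemma rinner_nonneg: "u \<in> ell2 \<Longrightarrow> 0 \<le> rinner u u"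
  by (simp add: rinner_self infsum_nonneg)

lemma rinner_self_eq_0: "u \<in> ell2 \<Longrightarrow> rinner u u = 0 \<longleftrightarrow> u = (\<lambda>n. 0)"
proof
  assume u: "u \<in> ell2" "rinner u u = 0"
  have "(cmod (u n))\<^sup>2 \<le> 0" for n
    using finite_sum_le_infsum[of "\<lambda>n. (cmod (u n))\<^sup>2" UNIV "{n}"] u by (auto simp: rinner_self ell2_def)
  then show "u = (\<lambda>n. 0)" by (auto simp: fun_eq_iff)
qed auto

definition delta :: "int \<Rightarrow> int \<Rightarrow> complex" where "delta m n = (if n = m then 1 else 0)"

lemma delta_ell2 [simp]: "delta m \<in> ell2"
  unfolding ell2_def
proof
  have "(\<lambda>n. (cmod (delta m n))\<^sup>2) summable_on {m}" by simp
  then show "(\<lambda>n. (cmod (delta m n))\<^sup>2) summable_on UNIV"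
    by (rule summable_on_cong_neutral[THEN iffD1, rotated -1]) (auto simp: delta_def)
qed

lemma rinner_delta: "rinner (delta m) u = Re (u m)"
proof -
  have "ell2_inner (delta m) u = (\<Sum>\<^sub>\<infinity>n\<in>{m}. cnj (delta m n) * u n)"
    unfolding ell2_inner_def by (rule infsum_cong_neutral) (auto simp: delta_def)
  then show ?thesis by (simp add: rinner_def delta_def)
qed

section \<open>Calculus with a spectral resolution\<close>

locale symmetric_operator =
  fixes T :: "(int \<Rightarrow> complex) \<Rightarrow> (int \<Rightarrow> complex)"
    and P :: "real set \<Rightarrow> (int \<Rightarrow> complex) \<Rightarrow> (int \<Rightarrow> complex)"
  assumes T_ell2: "u \<in> ell2 \<Longrightarrow> T u \<in> ell2"
    and T_add: "T (\<lambda>n. u n + v n) = (\<lambda>n. T u n + T v n)"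
    and T_sym: "u \<in> ell2 \<Longrightarrow> v \<in> ell2 \<Longrightarrow> rinner (T u) v = rinner u (T v)"
    and res: "spectral_resolution T P"
begin

lemma pvm: "projection_valued_measure P" using res by (simp add: spectral_resolution_def)

lemma orth: "B \<in> sets borel \<Longrightarrow> orthogonal_projection (P B)" using pvm by (simp add: projection_valued_measure_def)

lemma P_ell2 [simp]: "B \<in> sets borel \<Longrightarrow> u \<in> ell2 \<Longrightarrow> P B u \<in> ell2"
  using orth by (simp add: orthogonal_projection_def bounded_op_def)

lemma P_add: "B \<in> sets borel \<Longrightarrow> u \<in> ell2 \<Longrightarrow> v \<in> ell2 \<Longrightarrow> P B (\<lambda>n. u n + v n) = (\<lambda>n. P B u n + P B v n)"
  using orth by (simp add: orthogonal_projection_def bounded_op_def)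

lemma P_diff: "B \<in> sets borel \<Longrightarrow> u \<in> ell2 \<Longrightarrow> v \<in> ell2 \<Longrightarrow> P B (\<lambda>n. u n - v n) = (\<lambda>n. P B u n - P B v n)"
proof -
  assume B: "B \<in> sets borel" "u \<in> ell2" "v \<in> ell2"
  have "P B (\<lambda>n. - 1 * v n) = (\<lambda>n. - 1 * P B v n)"
    using orth[OF B(1)] B(3) unfolding orthogonal_projection_def bounded_op_def by blast
  then show ?thesis using P_add[OF B(1,2) ell2_scale[OF B(3), of "- 1"]] by simp
qed

lemma P_idem: "B \<in> sets borel \<Longrightarrow> u \<in> ell2 \<Longrightarrow> P B (P B u) = P B u"
  using orth by (simp add: orthogonal_projection_def)

lemma P_sym: "B \<in> sets borel \<Longrightarrow> u \<in> ell2 \<Longrightarrow> v \<in> ell2 \<Longrightarrow> rinner (P B u) v = rinner u (P B v)"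
  using orth by (simp add: orthogonal_projection_def rinner_def)

lemma P_inter: "A \<in> sets borel \<Longrightarrow> B \<in> sets borel \<Longrightarrow> u \<in> ell2 \<Longrightarrow> P (A \<inter> B) u = P A (P B u)"
  using pvm by (simp add: projection_valued_measure_def)

lemma P_empty: "u \<in> ell2 \<Longrightarrow> P {} u = (\<lambda>n. 0)" and P_UNIV: "u \<in> ell2 \<Longrightarrow> P UNIV u = u"
  using pvm by (simp_all add: projection_valued_measure_def)

lemma P_disjoint:
  assumes "A \<in> sets borel" "B \<in> sets borel" "u \<in> ell2" "A \<inter> B = {}"
  shows "P A (P B u) = (\<lambda>n. 0)"
  using P_inter[OF assms(1-3)] P_empty[OF assms(3)] assms(4) by simp

definition q :: "(int \<Rightarrow> complex) \<Rightarrow> real set \<Rightarrow> real" where "q u B = rinner u (P B u)"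

lemma q_eq: "B \<in> sets borel \<Longrightarrow> u \<in> ell2 \<Longrightarrow> q u B = rinner (P B u) (P B u)"
  unfolding q_def by (simp add: P_sym P_idem)

lemma q_nonneg: "B \<in> sets borel \<Longrightarrow> u \<in> ell2 \<Longrightarrow> 0 \<le> q u B"
  by (simp add: q_eq rinner_nonneg)

lemma q_sums:
  assumes "range B \<subseteq> sets borel" "disjoint_family (B :: nat \<Rightarrow> real set)" "u \<in> ell2"
  shows "(\<lambda>i. q u (B i)) sums q u (\<Union>i. B i)"
  using pvm assms unfolding projection_valued_measure_def q_def rinner_def
  by (intro sums_Re) blast

abbreviation "N u \<equiv> spectral_measure P u"

lemma sets_N [simp, measurable_cong]: "sets (N u) = sets borel" and space_N [simp]: "space (N u) = UNIV"
  unfolding spectral_measure_def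
  using sets.sigma_sets_eq[of "borel :: real measure"] by (simp_all add: sets_measure_of_conv space_measure_of_conv)

lemma emeasure_N:
  assumes "u \<in> ell2" "B \<in> sets borel"
  shows "emeasure (N u) B = ennreal (q u B)"
  unfolding spectral_measure_def q_def[unfolded rinner_def, symmetric]
proof (rule emeasure_measure_of_sigma)
  show "sigma_algebra UNIV (sets (borel :: real measure))"
    using sets.sigma_algebra_axioms[of "borel :: real measure"] by simp
  show "positive (sets borel) (\<lambda>B. ennreal (q u B))"
    using assms by (simp add: positive_def q_def P_empty)
  show "countably_additive (sets borel) (\<lambda>B. ennreal (q u B))"
    unfolding countably_additive_def
  proof (intro allI impI)
    fix A :: "nat \<Rightarrow> real set"
    assume A: "range A \<subseteq> sets borel" "disjoint_family A"
    show "(\<Sum>i. ennreal (q u (A i))) = ennreal (q u (\<Union>i. A i))"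
      using A(1) by (intro suminf_ennreal_eq q_nonneg q_sums A assms) auto
  qed
qed (rule assms)

lemma finite_N: "u \<in> ell2 \<Longrightarrow> finite_measure (N u)"
  by (rule finite_measureI) (simp add: emeasure_N)

lemma measure_N: "u \<in> ell2 \<Longrightarrow> B \<in> sets borel \<Longrightarrow> measure (N u) B = q u B"
  by (simp add: measure_def emeasure_N q_nonneg)

text \<open>By the intersection rule, projecting a vector cuts off its spectral measure outside
  \<open>B\<close>. Energies of projected vectors thereby become integrals over arbitrary Borel
  sets.\<close>

lemma N_proj:
  assumes "u \<in> ell2" "B \<in> sets borel"
  shows "N (P B u) = density (N u) (indicator B)"
proof (rule measure_eqI)
  fix A assume "A \<in> sets (N (P B u))"
  then have A: "A \<in> sets borel" by simp
  have "q (P B u) A = q u (A \<inter> B)"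
  proof -
    have "q (P B u) A = rinner u (P B (P (A \<inter> B) u))"
      unfolding q_def using assms A by (simp add: P_sym P_inter)
    also have "P B (P (A \<inter> B) u) = P (A \<inter> B) u"
      using assms A P_inter[of B "A \<inter> B" u] by (simp add: Int_ac)
    finally show ?thesis by (simp add: q_def)
  qed
  then show "emeasure (N (P B u)) A = emeasure (density (N u) (indicator B)) A"
    using assms A by (simp add: emeasure_N emeasure_density nn_integral_indicator' indicator_inter_arith[symmetric] Int_ac mult.commute)
qed simp

definition t :: "(int \<Rightarrow> complex) \<Rightarrow> real" where "t u = rinner u (T u)"

lemma N_integrable: "u \<in> ell2 \<Longrightarrow> integrable (N u) (\<lambda>x. x)"
  and t_eq: "u \<in> ell2 \<Longrightarrow> t u = (\<integral>x. x \<partial>N u)"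
  using res by (simp_all add: spectral_resolution_def t_def rinner_def)

lemma t_proj:
  assumes "u \<in> ell2" "B \<in> sets borel"
  shows "t (P B u) = (\<integral>x\<in>B. x \<partial>N u)"
proof -
  have "t (P B u) = (\<integral>x. x \<partial>density (N u) (\<lambda>x. ennreal (indicator B x)))"
    using assms by (simp add: t_eq N_proj ennreal_indicator)
  also have "\<dots> = (\<integral>x. indicator B x *\<^sub>R x \<partial>N u)"
    using assms by (subst integral_density) auto
  finally show ?thesis by (simp add: set_lebesgue_integral_def)
qed

text \<open>Additivity is given only for the quadratic forms. The squared norm of the difference of
  both sides is expanded; since the two pieces are orthogonal, it reduces to these forms and
  vanishes.\<close>

lemma P_compl:
  assumes "u \<in> ell2" "B \<in> sets borel"
  shows "u = (\<lambda>n. P B u n + P (- B) u n)"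
proof -
  interpret finite_measure "N u" by (rule finite_N[OF assms(1)])
  have B': "- B \<in> sets borel" using assms(2) by (rule borel_comp)
  have "measure (N u) (B \<union> - B) = measure (N u) B + measure (N u) (- B)"
    using assms B' by (intro finite_measure_Union) auto
  then have qq: "q u UNIV = q u B + q u (- B)" using assms B' by (simp add: measure_N)
  have cross: "rinner (P B u) (P (- B) u) = 0"
    using assms B' by (simp add: P_sym P_disjoint)
  have cross': "rinner (P (- B) u) (P B u) = 0" using cross by (simp add: rinner_commute)
  let ?w = "\<lambda>n. P B u n + P (- B) u n"
  have w: "?w \<in> ell2" using assms B' by (intro ell2_add) auto
  have "rinner (\<lambda>n. u n - ?w n) (\<lambda>n. u n - ?w n) = rinner u u - 2 * rinner u ?w + rinner ?w ?w"
    using assms w ell2_diff[OF assms(1) w] by (simp add: rinner_diff_left rinner_diff_right rinner_commute)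
  also have "rinner u ?w = q u B + q u (- B)" using assms B' by (simp add: rinner_add_right q_def)
  also have "rinner ?w ?w = q u B + q u (- B)"
    using assms B' w cross cross' by (simp add: rinner_add_left rinner_add_right q_eq)
  also have "rinner u u = q u UNIV" using assms by (simp add: q_def P_UNIV)
  finally have "rinner (\<lambda>n. u n - ?w n) (\<lambda>n. u n - ?w n) = 0" using qq by simp
  then have "(\<lambda>n. u n - ?w n) = (\<lambda>n. 0)" using rinner_self_eq_0[OF ell2_diff[OF assms(1) w]] by simp
  then show ?thesis by (simp add: fun_eq_iff)
qed

lemma t_add:
  assumes "a \<in> ell2" "b \<in> ell2"
  shows "t (\<lambda>n. a n + b n) = t a + t b + 2 * rinner a (T b)"
proof -
  note T = T_ell2[OF assms(1)] T_ell2[OF assms(2)]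
  have "t (\<lambda>n. a n + b n) = rinner (\<lambda>n. a n + b n) (T a) + rinner (\<lambda>n. a n + b n) (T b)"
    unfolding t_def T_add by (rule rinner_add_right[OF ell2_add[OF assms] T])
  also have "\<dots> = (rinner a (T a) + rinner b (T a)) + (rinner a (T b) + rinner b (T b))"
    using rinner_add_left[OF T(1) assms] rinner_add_left[OF T(2) assms] by simp
  also have "rinner b (T a) = rinner a (T b)"
    using T_sym[OF assms(2,1)] rinner_commute[of "T b" a] by simp
  finally show ?thesis by (simp add: t_def)
qed

lemma t_compl:
  assumes "w \<in> ell2" "B \<in> sets borel"
  shows "t w = t (P B w) + t (P (- B) w)"
proof -
  have B': "- B \<in> sets borel" using assms(2) by (rule borel_comp)
  have "(\<integral>x. x \<partial>N w) = (\<integral>x. indicator B x *\<^sub>R x + indicator (- B) x *\<^sub>R x \<partial>N w)"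
    by (intro Bochner_Integration.integral_cong refl) (auto simp: indicator_def)
  also have "\<dots> = (\<integral>x\<in>B. x \<partial>N w) + (\<integral>x\<in>-B. x \<partial>N w)"
    unfolding set_lebesgue_integral_def using assms B' N_integrable[OF assms(1)]
    by (intro Bochner_Integration.integral_add integrable_mult_indicator) auto
  finally show ?thesis using assms B' by (simp add: t_eq[OF assms(1)] t_proj)
qed

text \<open>A weak form of the fact that \<open>T\<close> commutes with the projections, which is
  not part of the definition. The energy of \<open>P (- B) a + P B b\<close> is an integral and
  splits over \<open>B\<close> and its complement, so the mixed term in \<open>t_add\<close> must be
  zero.\<close>

lemma T_cross:
  assumes "a \<in> ell2" "b \<in> ell2" "B \<in> sets borel"
  shows "rinner (P (- B) a) (T (P B b)) = 0"
proof -
  have B': "- B \<in> sets borel" using assms(3) by (rule borel_comp)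
  define w where "w = (\<lambda>n. P (- B) a n + P B b n)"
  have w: "w \<in> ell2" unfolding w_def using assms B' by (intro ell2_add) auto
  have "P B w = P B b" "P (- B) w = P (- B) a"
    unfolding w_def using assms B' by (simp_all add: P_add P_idem P_disjoint)
  then have "t w = t (P B b) + t (P (- B) a)" using t_compl[OF w assms(3)] by simp
  moreover have "t w = t (P (- B) a) + t (P B b) + 2 * rinner (P (- B) a) (T (P B b))"
    unfolding w_def using assms B' by (intro t_add) auto
  ultimately show ?thesis by simp
qed

lemma T_P: 
  assumes "a \<in> ell2" "b \<in> ell2" "B \<in> sets borel"
  shows "rinner (P B a) (T (P B b)) = rinner a (T (P B b))"
proof -
  have B': "- B \<in> sets borel" using assms(3) by (rule borel_comp)
  have "rinner a (T (P B b)) = rinner (\<lambda>n. P B a n + P (- B) a n) (T (P B b))"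
    using P_compl[OF assms(1,3)] by simp
  then show ?thesis using assms B' T_cross[OF assms] by (simp add: rinner_add_left T_ell2)
qed

text \<open>Against the spectral measure, \<open>x\<close> and the constant \<open>E\<close> have
  the same integral over every Borel set, so all mass sits at \<open>E\<close>, and the mass is the
  squared norm.\<close>

lemma eigenvalue_atom:
  assumes \<phi>: "\<phi> \<in> ell2" "\<phi> \<noteq> (\<lambda>n. 0)" and eig: "T \<phi> = (\<lambda>n. complex_of_real E * \<phi> n)"
  shows "emeasure (N \<phi>) {E} \<noteq> 0"
proof -
  interpret finite_measure "N \<phi>" by (rule finite_N[OF \<phi>(1)])
  have "AE x in N \<phi>. x = E"
  proof (rule density_unique_real)
    show "integrable (N \<phi>) (\<lambda>x. x)" by (rule N_integrable[OF \<phi>(1)])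
    show "integrable (N \<phi>) (\<lambda>x. E)" by simp
    fix B assume "B \<in> sets (N \<phi>)"
    then have B: "B \<in> sets borel" by simp
    have "(\<integral>x\<in>B. x \<partial>N \<phi>) = rinner \<phi> (T (P B \<phi>))"
      using \<phi> B by (simp add: t_proj[symmetric] t_def T_P)
    also have "\<dots> = rinner (T \<phi>) (P B \<phi>)" using \<phi> B by (simp add: T_sym)
    also have "\<dots> = E * q \<phi> B"
      unfolding eig rinner_commute[of _ "P B \<phi>"] rinner_scale_right by (simp add: q_def rinner_commute)
    also have "\<dots> = (\<integral>x\<in>B. E \<partial>N \<phi>)"
      using \<phi> B by (simp add: set_lebesgue_integral_def measure_N)
    finally show "(\<integral>x\<in>B. x \<partial>N \<phi>) = (\<integral>x\<in>B. E \<partial>N \<phi>)" .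
  qed
  then have "emeasure (N \<phi>) {E} = emeasure (N \<phi>) UNIV" by (intro emeasure_eq_AE) auto
  also have "\<dots> = ennreal (rinner \<phi> \<phi>)" using \<phi> by (simp add: emeasure_N q_def P_UNIV)
  finally have "emeasure (N \<phi>) {E} = ennreal (rinner \<phi> \<phi>)" .
  moreover have "rinner \<phi> \<phi> > 0" using \<phi> rinner_nonneg[of \<phi>] rinner_self_eq_0[of \<phi>] by simp
  ultimately show ?thesis by (simp add: ennreal_eq_0_iff)
qed

text \<open>A projection that kills the unit vectors at all sites is zero, so a weighted sum of
  their spectral measures dominates every spectral measure. The weights are summable but decay only
  polynomially: their inverses become the growth bound of the generalized eigenfunctions.\<close>

lemma exists_measure_class:
  obtains M :: "real measure" where "finite_measure M" "sets M = sets borel"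
    "\<And>B. B \<in> sets borel \<Longrightarrow> emeasure M B = (\<Sum>i. ennreal (1 / (real i + 1)\<^sup>2 * q (delta (int_decode i)) B))"
    "\<And>u. u \<in> ell2 \<Longrightarrow> absolutely_continuous M (N u)"
proof -
  define w :: "nat \<Rightarrow> real" where "w i = 1 / (real i + 1)\<^sup>2" for i
  have w: "w i > 0" for i by (simp add: w_def)
  define d where "d i = delta (int_decode i)" for i
  have d: "d i \<in> ell2" for i by (simp add: d_def)
  define F where "F B = (\<Sum>i. ennreal (w i * q (d i) B))" for B
  define M where "M = measure_of UNIV (sets (borel :: real measure)) F"
  have sets: "sets M = sets borel"
    unfolding M_def using sets.sigma_sets_eq[of "borel :: real measure"] by (simp add: sets_measure_of_conv)
  have space: "space M = UNIV" unfolding M_def by (simp add: space_measure_of_conv)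
  have em: "emeasure M B = F B" if "B \<in> sets borel" for B
    unfolding M_def
  proof (rule emeasure_measure_of_sigma)
    show "sigma_algebra UNIV (sets (borel :: real measure))"
      using sets.sigma_algebra_axioms[of "borel :: real measure"] by simp
    show "positive (sets borel) F"
      by (simp add: positive_def F_def q_def P_empty d)
    show "countably_additive (sets borel) F"
      unfolding countably_additive_def
    proof (intro allI impI)
      fix A :: "nat \<Rightarrow> real set"
      assume A: "range A \<subseteq> sets borel" "disjoint_family A"
      have swap: "(\<Sum>i. F (A i)) = (\<Sum>j. \<Sum>i. ennreal (w j * q (d j) (A i)))"
        unfolding F_def nn_integral_count_space_nat[symmetric] by (rule pair_sigma_finite.Fubini'[OF pair_sigma_finite.intro[OF sigma_finite_measure_count_space sigma_finite_measure_count_space]]) simp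
      have inner: "(\<Sum>i. ennreal (w j * q (d j) (A i))) = ennreal (w j * q (d j) (\<Union>i. A i))" for j
      proof (rule suminf_ennreal_eq)
        show "0 \<le> w j * q (d j) (A i)" for i
          using A(1) by (intro mult_nonneg_nonneg less_imp_le[OF w] q_nonneg d) auto
        show "(\<lambda>i. w j * q (d j) (A i)) sums (w j * q (d j) (\<Union>i. A i))"
          by (rule sums_mult[OF q_sums[OF A d]])
      qed
      have "(\<Sum>j. \<Sum>i. ennreal (w j * q (d j) (A i))) = F (\<Union>i. A i)"
        unfolding F_def by (simp only: inner)
      then show "(\<Sum>i. F (A i)) = F (\<Union>i. A i)" using swap by simp
    qed
  qed (rule that)
  have fin: "finite_measure M"
  proof (rule finite_measureI)
    have "q (d i) UNIV = 1" for i
      using rinner_delta[of "int_decode i" "d i"] by (simp add: q_def P_UNIV d) (simp add: d_def delta_def)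
    then have "emeasure M UNIV = (\<Sum>i. ennreal (w i))" using em[of UNIV] by (simp add: F_def)
    also have "summable w"
      using summable_Suc_iff[of "\<lambda>i. 1 / (real i)\<^sup>2"] inverse_power_summable[of 2, where 'a = real]
      by (simp add: w_def[abs_def] inverse_eq_divide power_one_over add.commute)
    then have "(\<Sum>i. ennreal (w i)) \<noteq> \<infinity>"
      by (metis (no_types, lifting) ennreal_neq_top infinity_ennreal_def less_imp_le suminf_ennreal2 w)
    finally show "emeasure M (space M) \<noteq> \<infinity>" by (simp add: space)
  qed
  have ac: "absolutely_continuous M (N u)" if u: "u \<in> ell2" for u
    unfolding absolutely_continuous_def
  proof
    fix B assume "B \<in> null_sets M"
    then have B: "B \<in> sets borel" "F B = 0" using em sets by (auto simp: null_sets_def)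
    have "P B u n = 0" for n
    proof -
      define i where "i = int_encode n"
      have "ennreal (w i * q (d i) B) \<le> F B" unfolding F_def
        using sum_le_suminf[of "\<lambda>i. ennreal (w i * q (d i) B)" "{i}"] by simp
      then have "w i * q (d i) B \<le> 0" using B(2) by (simp add: ennreal_eq_0_iff)
      then have "q (d i) B \<le> 0" using w[of i] by (simp add: mult_le_0_iff)
      then have "rinner (P B (d i)) (P B (d i)) = 0" using q_nonneg[OF B(1) d[of i]] q_eq[OF B(1) d[of i]] by simp
      then have 0: "P B (delta n) = (\<lambda>n. 0)"
        using rinner_self_eq_0[of "P B (d i)"] B d by (simp add: d_def i_def)
      \<comment> \<open>\<open>rinner\<close> reads off real parts; the imaginary part follows by
        applying this to \<open>\<i> * u\<close>.\<close>
      have Re0: "Re (P B v n) = 0" if "v \<in> ell2" for v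
        using P_sym[OF B(1) delta_ell2[of n] that] 0 by (simp add: rinner_delta)
      have "P B (\<lambda>n. \<i> * u n) = (\<lambda>n. \<i> * P B u n)"
        using orth[OF B(1)] u unfolding orthogonal_projection_def bounded_op_def by blast
      then show ?thesis using Re0[OF u] Re0[OF ell2_scale[OF u, of \<i>]] by (simp add: complex_eq_iff)
    qed
    then have "q u B = 0" unfolding q_def by (simp add: ext[of "P B u" "\<lambda>n. 0"])
    then show "B \<in> null_sets (N u)" using u B by (simp add: null_sets_def emeasure_N)
  qed
  show thesis
    by (rule that[of M, OF fin sets _ ac]) (use em in \<open>auto simp: F_def w_def d_def\<close>)
qed

end

section \<open>Generalized eigenfunctions and pure point spectrum\<close>

lemma int_encode_le: "int (int_encode n) \<le> 2 * \<bar>n\<bar> + 1"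
  by (auto simp: int_encode_def sum_encode_def)

locale schroedinger_resolution = symmetric_operator T P for T P +
  fixes v :: "int \<Rightarrow> real"
  assumes T_eq: "T u = (\<lambda>n. u (n + 1) + u (n - 1) + complex_of_real (v n) * u n)"
begin

lemma t_diff:
  assumes "a \<in> ell2" "b \<in> ell2"
  shows "t (\<lambda>n. a n - b n) = t a + t b - 2 * rinner a (T b)"
proof -
  have b': "(\<lambda>n. of_real (- 1) * b n) \<in> ell2" by (rule ell2_scale[OF assms(2)])
  have Tb': "T (\<lambda>n. of_real (- 1) * b n) = (\<lambda>n. of_real (- 1) * T b n)" unfolding T_eq by (simp add: algebra_simps)
  have "t (\<lambda>n. of_real (- 1) * b n) = t b"
    unfolding t_def Tb' rinner_scale_right rinner_commute[of "\<lambda>n. of_real (- 1) * b n"] by (simp add: rinner_commute)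
  then show ?thesis using t_add[OF assms(1) b'] unfolding Tb' rinner_scale_right by simp
qed

text \<open>Identities between densities are tested by integration over Borel sets, and they hold
  off one null set since there are countably many sites. That the weighted densities of the unit
  vectors sum to 1 is used twice: it bounds each of them, and it yields a site with nonzero density,
  so that the solution does not vanish. The parallelogram law then bounds the mixed
  densities.\<close>

theorem generalized_eigenfunctions:
  obtains M :: "real measure" where "finite_measure M" "sets M = sets borel"
    "\<And>u. u \<in> ell2 \<Longrightarrow> absolutely_continuous M (N u)"
    "AE x in M. \<exists>\<phi>::int \<Rightarrow> real. \<phi> \<noteq> (\<lambda>n. 0) \<and> (\<forall>j. \<phi> (j + 1) + \<phi> (j - 1) = (x - v j) * \<phi> j)
      \<and> (\<exists>B. \<forall>j. \<bar>\<phi> j\<bar> \<le> B * (1 + \<bar>real_of_int j\<bar>)\<^sup>2)"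
proof (rule exists_measure_class)
  fix M :: "real measure"
  assume fin: "finite_measure M" and sets: "sets M = sets borel"
    and em: "\<And>B. B \<in> sets borel \<Longrightarrow> emeasure M B = (\<Sum>i. ennreal (1 / (real i + 1)\<^sup>2 * q (delta (int_decode i)) B))"
    and ac: "\<And>u. u \<in> ell2 \<Longrightarrow> absolutely_continuous M (N u)"
  interpret M: finite_measure M by (rule fin)
  note [measurable_cong] = sets
  define g where "g u = RN_deriv M (N u)" for u
  \<comment> \<open>\<open>g\<close> takes extended values but is finite almost everywhere for
    \<open>u\<close> in \<open>ell2\<close>; \<open>h\<close> is the real version, whose differences
    make sense.\<close>
  define h where "h u x = enn2real (g u x)" for u x
  have g_meas [measurable]: "g u \<in> borel_measurable M" for u unfolding g_def by simp
  have h_meas [measurable]: "h u \<in> borel_measurable M" for u unfolding h_def by simp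
  have h0: "0 \<le> h u x" for u x by (simp add: h_def)
  have dens: "density M (g u) = N u" if "u \<in> ell2" for u
    unfolding g_def by (rule M.density_RN_deriv[OF ac[OF that]]) (simp add: sets)
  have g_fin: "AE x in M. g u x \<noteq> \<infinity>" if "u \<in> ell2" for u
  proof -
    interpret Nu: finite_measure "N u" by (rule finite_N[OF that])
    show ?thesis unfolding g_def
      by (rule M.RN_deriv_finite[OF Nu.sigma_finite_measure_axioms ac[OF that]]) (simp add: sets)
  qed
  have dens': "density M (\<lambda>x. ennreal (h u x)) = N u" if "u \<in> ell2" for u
  proof -
    have "density M (\<lambda>x. ennreal (h u x)) = density M (g u)"
      by (rule density_cong) (use g_fin[OF that] in \<open>auto simp: h_def less_top[symmetric]\<close>)
    then show ?thesis using dens[OF that] by simp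
  qed
  have h_int_f: "integrable M (\<lambda>x. h u x * f x) \<longleftrightarrow> integrable (N u) f"
    if "u \<in> ell2" "f \<in> borel_measurable borel" for u and f :: "real \<Rightarrow> real"
    unfolding dens'[OF that(1), symmetric] using that(2) sets h0 by (subst integrable_density) auto
  have h_int: "integrable M (h u)" if "u \<in> ell2" for u
  proof -
    interpret Nu: finite_measure "N u" by (rule finite_N[OF that])
    show ?thesis using h_int_f[OF that, of "\<lambda>x. 1"] by simp
  qed
  have h_set: "(\<integral>x\<in>B. h u x * f x \<partial>M) = (\<integral>x\<in>B. f x \<partial>N u)"
    if "u \<in> ell2" "f \<in> borel_measurable borel" "B \<in> sets borel" for u f B
  proof -
    have "(\<integral>x. indicator B x *\<^sub>R f x \<partial>N u) = (\<integral>x. h u x *\<^sub>R (indicator B x *\<^sub>R f x) \<partial>M)"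
      unfolding dens'[OF that(1), symmetric] using that sets h0 by (subst integral_density) auto
    then show ?thesis unfolding set_lebesgue_integral_def by (simp add: mult_ac)
  qed
  have h_q: "(\<integral>x\<in>B. h u x \<partial>M) = q u B" if "u \<in> ell2" "B \<in> sets borel" for u B
  proof -
    interpret Nu: finite_measure "N u" by (rule finite_N[OF that(1)])
    show ?thesis using h_set[OF that(1) _ that(2), of "\<lambda>x. 1"] that
      by (simp add: set_lebesgue_integral_def measure_N)
  qed
  have hx_int: "integrable M (\<lambda>x. x * h u x)" if "u \<in> ell2" for u
  proof -
    have "(\<lambda>x. x * h u x) = (\<lambda>x. h u x * x)" by (rule ext) (rule mult.commute)
    then show ?thesis 
      by (simp only:) (rule iffD2[OF h_int_f[OF that] N_integrable[OF that]], simp)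
  qed
  have hx_t: "(\<integral>x\<in>B. x * h u x \<partial>M) = t (P B u)" if "u \<in> ell2" "B \<in> sets borel" for u B
  proof -
    have "(\<lambda>x. x * h u x) = (\<lambda>x. h u x * x)" by (rule ext) (rule mult.commute)
    then show ?thesis 
      by (simp only:) (rule trans[OF h_set[OF that(1) _ that(2)] t_proj[OF that, symmetric]], simp)
  qed
  define S D where "S n m = (\<lambda>k. delta n k + delta m k)" and "D n m = (\<lambda>k. delta n k - delta m k)" for n m
  have SD [simp]: "S n m \<in> ell2" "D n m \<in> ell2" for n m
    unfolding S_def D_def by (simp_all add: ell2_add ell2_diff)
  \<comment> \<open>By polarization, the density of the real part of the spectral measure of the pair
    \<open>delta n\<close>, \<open>delta m\<close>; as a function of \<open>n\<close> it is the sought solution.\<close>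
  define F where "F n m x = (h (S n m) x - h (D n m) x) / 4" for n m x
  have set_int: "set_integrable M B f" if "integrable M f" "B \<in> sets borel" for f :: "real \<Rightarrow> real" and B
    unfolding set_integrable_def using that sets by (intro integrable_mult_indicator) auto
  have F_int: "integrable M (F n m)" for n m
    unfolding F_def by (intro integrable_divide_zero Bochner_Integration.integrable_diff h_int) auto
  have Fx_int: "integrable M (\<lambda>x. x * F n m x)" for n m
  proof -
    have "integrable M (\<lambda>x. (x * h (S n m) x - x * h (D n m) x) / 4)"
      by (intro integrable_divide_zero Bochner_Integration.integrable_diff hx_int) auto
    then show ?thesis by (simp add: F_def right_diff_distrib)
  qed
  have P_SD: "P B (S n m) = (\<lambda>k. P B (delta n) k + P B (delta m) k)"
    "P B (D n m) = (\<lambda>k. P B (delta n) k - P B (delta m) k)" if "B \<in> sets borel" for n m B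
    unfolding S_def D_def using that by (simp_all add: P_add P_diff)
  have F_set: "(\<integral>x\<in>B. F n m x \<partial>M) = rinner (delta n) (P B (delta m))" if B: "B \<in> sets borel" for n m B
  proof -
    have comm: "rinner (delta m) (P B (delta n)) = rinner (delta n) (P B (delta m))"
      using P_sym[OF B delta_ell2[of m] delta_ell2[of n]] rinner_commute by metis
    have "q (S n m) B = q (delta n) B + q (delta m) B + 2 * rinner (delta n) (P B (delta m))"
      unfolding q_def P_SD[OF B] unfolding S_def using B comm
      by (simp add: rinner_add_left rinner_add_right ell2_add)
    moreover have "q (D n m) B = q (delta n) B + q (delta m) B - 2 * rinner (delta n) (P B (delta m))"
      unfolding q_def P_SD[OF B] unfolding D_def using B comm
      by (simp add: rinner_diff_left rinner_diff_right ell2_diff)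
    moreover have "(\<integral>x\<in>B. F n m x \<partial>M) = (q (S n m) B - q (D n m) B) / 4"
      unfolding F_def using B by (simp add: set_integral_diff set_int h_int h_q)
    ultimately show ?thesis by simp
  qed
  have Fx_set: "(\<integral>x\<in>B. x * F n m x \<partial>M) = rinner (delta n) (T (P B (delta m)))" if B: "B \<in> sets borel" for n m B
  proof -
    have "(\<integral>x\<in>B. x * F n m x \<partial>M) = (\<integral>x\<in>B. (x * h (S n m) x - x * h (D n m) x) / 4 \<partial>M)"
      by (simp add: F_def right_diff_distrib)
    also have "\<dots> = (t (P B (S n m)) - t (P B (D n m))) / 4"
      using B by (simp add: set_integral_diff set_int hx_int hx_t)
    also have "\<dots> = rinner (P B (delta n)) (T (P B (delta m)))"
      unfolding P_SD[OF B] using B by (simp add: t_add t_diff)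
    finally show ?thesis using B by (simp add: T_P)
  qed
  have AE1: "AE x in M. x * F n m x = F (n + 1) m x + F (n - 1) m x + v n * F n m x" for n m
  proof (rule density_unique_real[OF Fx_int])
    show "integrable M (\<lambda>x. F (n + 1) m x + F (n - 1) m x + v n * F n m x)"
      by (intro Bochner_Integration.integrable_add integrable_mult_right F_int)
    fix B assume "B \<in> sets M"
    then have B: "B \<in> sets borel" by (simp add: sets)
    have "(\<integral>x\<in>B. (F (n + 1) m x + F (n - 1) m x + v n * F n m x) \<partial>M)
        = (\<integral>x\<in>B. F (n + 1) m x \<partial>M) + (\<integral>x\<in>B. F (n - 1) m x \<partial>M) + v n * (\<integral>x\<in>B. F n m x \<partial>M)"
      using B by (simp add: set_integral_add set_int F_int)
    \<comment> \<open>Pairing with \<open>delta n\<close> reads off a coordinate, and the coordinate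
      of \<open>T (P B (delta m))\<close> at \<open>n\<close> involves just the sites
      \<open>n - 1\<close>, \<open>n\<close> and \<open>n + 1\<close>.\<close>
    also have "\<dots> = rinner (delta n) (T (P B (delta m)))"
      unfolding F_set[OF B] rinner_delta T_eq by simp
    finally show "(\<integral>x\<in>B. x * F n m x \<partial>M) = (\<integral>x\<in>B. (F (n + 1) m x + F (n - 1) m x + v n * F n m x) \<partial>M)"
      using Fx_set[OF B] by simp
  qed
  have AE2: "AE x in M. F m m x = h (delta m) x" for m
  proof (rule density_unique_real[OF F_int h_int])
    fix B assume "B \<in> sets M"
    then have B: "B \<in> sets borel" by (simp add: sets)
    show "(\<integral>x\<in>B. F m m x \<partial>M) = (\<integral>x\<in>B. h (delta m) x \<partial>M)"
      using F_set[OF B] h_q[OF _ B] by (simp add: q_def)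
  qed simp
  \<comment> \<open>The parallelogram law for the forms \<open>q\<close>, passed to
    densities.\<close>
  have AE3: "AE x in M. h (S n m) x + h (D n m) x = 2 * h (delta n) x + 2 * h (delta m) x" for n m
  proof (rule density_unique_real)
    show "integrable M (\<lambda>x. h (S n m) x + h (D n m) x)" "integrable M (\<lambda>x. 2 * h (delta n) x + 2 * h (delta m) x)"
      by (intro Bochner_Integration.integrable_add integrable_mult_right h_int; simp)+
    fix B assume "B \<in> sets M"
    then have B: "B \<in> sets borel" by (simp add: sets)
    have "q (S n m) B + q (D n m) B = 2 * q (delta n) B + 2 * q (delta m) B"
      unfolding q_def P_SD[OF B] unfolding S_def D_def using B
      by (simp add: rinner_add_left rinner_add_right ell2_add rinner_diff_left rinner_diff_right ell2_diff)
    then show "(\<integral>x\<in>B. (h (S n m) x + h (D n m) x) \<partial>M) = (\<integral>x\<in>B. (2 * h (delta n) x + 2 * h (delta m) x) \<partial>M)"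
      using B by (simp add: set_integral_add set_int h_int h_q)
  qed
  define w :: "nat \<Rightarrow> real" where "w i = 1 / (real i + 1)\<^sup>2" for i
  \<comment> \<open>\<open>M\<close> is the weighted sum of the measures with densities
    \<open>g\<close>, so the weighted sum of these densities is the density of \<open>M\<close> with
    respect to itself.\<close>
  have AE4: "AE x in M. (\<Sum>i. ennreal (w i) * g (delta (int_decode i)) x) = 1"
  proof (rule M.density_unique2)
    fix A assume A: "A \<in> sets M"
    have "(\<integral>\<^sup>+x\<in>A. (\<Sum>i. ennreal (w i) * g (delta (int_decode i)) x) \<partial>M)
        = (\<Sum>i. ennreal (w i) * (\<integral>\<^sup>+x\<in>A. g (delta (int_decode i)) x \<partial>M))"
      unfolding ennreal_suminf_multc[symmetric] using A
      by (subst nn_integral_suminf) (auto simp: mult.assoc nn_integral_cmult)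
    also have "\<dots> = (\<Sum>i. ennreal (w i) * emeasure (N (delta (int_decode i))) A)"
      using A by (simp add: dens[symmetric] emeasure_density)
    also have "\<dots> = emeasure M A"
    proof -
      have A': "A \<in> sets borel" using A by (simp add: sets)
      have "ennreal (w i) * emeasure (N (delta (int_decode i))) A = ennreal (w i * q (delta (int_decode i)) A)" for i
        unfolding emeasure_N[OF delta_ell2 A'] by (rule ennreal_mult'[symmetric]) (simp add: w_def)
      then show ?thesis using em[OF A'] by (simp only: w_def)
    qed
    also have "\<dots> = (\<integral>\<^sup>+x\<in>A. 1 \<partial>M)" using A by simp
    finally show "(\<integral>\<^sup>+x\<in>A. (\<Sum>i. ennreal (w i) * g (delta (int_decode i)) x) \<partial>M) = (\<integral>\<^sup>+x\<in>A. 1 \<partial>M)" .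
  qed auto
  have AE5: "AE x in M. \<forall>i. g (delta (int_decode i)) x \<noteq> \<infinity>"
    by (simp add: AE_all_countable g_fin del: infinity_ennreal_def)
  have "AE x in M. \<forall>n m. x * F n m x = F (n + 1) m x + F (n - 1) m x + v n * F n m x"
    "AE x in M. \<forall>m. F m m x = h (delta m) x"
    "AE x in M. \<forall>n m. h (S n m) x + h (D n m) x = 2 * h (delta n) x + 2 * h (delta m) x"
    using AE1 AE2 AE3 by (simp_all add: AE_all_countable)
  then have "AE x in M. \<exists>\<phi>::int \<Rightarrow> real. \<phi> \<noteq> (\<lambda>n. 0) \<and> (\<forall>j. \<phi> (j + 1) + \<phi> (j - 1) = (x - v j) * \<phi> j)
      \<and> (\<exists>B. \<forall>j. \<bar>\<phi> j\<bar> \<le> B * (1 + \<bar>real_of_int j\<bar>)\<^sup>2)"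
    using AE4 AE5
  proof eventually_elim
    case (elim x)
    have h_le: "h (delta n) x \<le> 4 * (1 + \<bar>real_of_int n\<bar>)\<^sup>2" for n
    proof -
      define i where "i = int_encode n"
      have "ennreal (w i) * g (delta (int_decode i)) x \<le> (\<Sum>i. ennreal (w i) * g (delta (int_decode i)) x)"
        using sum_le_suminf[of "\<lambda>i. ennreal (w i) * g (delta (int_decode i)) x" "{i}"] by simp
      then have "ennreal (w i) * ennreal (h (delta n) x) \<le> 1"
      proof -
        have "g (delta n) x \<noteq> \<infinity>" using elim(5)[rule_format, of i] by (simp add: i_def)
        then have "ennreal (h (delta n) x) = g (delta n) x" by (simp add: h_def less_top)
        then show ?thesis using \<open>ennreal (w i) * g (delta (int_decode i)) x \<le> _\<close> elim(4) by (simp add: i_def)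
      qed
      moreover have "ennreal (w i * h (delta n) x) = ennreal (w i) * ennreal (h (delta n) x)"
        by (rule ennreal_mult) (simp_all add: w_def h0)
      ultimately have "ennreal (w i * h (delta n) x) \<le> ennreal 1" by simp
      then have "w i * h (delta n) x \<le> 1" by (subst (asm) ennreal_le_iff) auto
      then have "h (delta n) x \<le> (real i + 1)\<^sup>2" by (simp add: w_def divide_le_eq)
      also have "\<dots> \<le> (2 * (1 + \<bar>real_of_int n\<bar>))\<^sup>2"
      proof (intro power_mono)
        have "real_of_int (int i) \<le> real_of_int (2 * \<bar>n\<bar> + 1)"
          unfolding i_def of_int_le_iff by (rule int_encode_le)
        then show "real i + 1 \<le> 2 * (1 + \<bar>real_of_int n\<bar>)" by simp
      qed simp
      also have "\<dots> = 4 * (1 + \<bar>real_of_int n\<bar>)\<^sup>2" unfolding power_mult_distrib by simp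
      finally show ?thesis .
    qed
    have "\<exists>i. g (delta (int_decode i)) x \<noteq> 0"
    proof (rule ccontr)
      assume "\<nexists>i. g (delta (int_decode i)) x \<noteq> 0"
      then show False using elim(4) by simp
    qed
    then obtain i where i: "g (delta (int_decode i)) x \<noteq> 0" by blast
    \<comment> \<open>The base site may depend on \<open>x\<close>, since a different unit vector
      may be charged at each energy.\<close>
    define m where "m = int_decode i"
    have hm: "h (delta m) x \<noteq> 0"
      using i elim(5) by (auto simp: h_def m_def enn2real_eq_0_iff)
    define \<phi> where "\<phi> n = F n m x" for n
    have "\<phi> m \<noteq> 0" using hm elim(2) by (simp add: \<phi>_def)
    moreover have "\<phi> (j + 1) + \<phi> (j - 1) = (x - v j) * \<phi> j" for j
    proof -
      have "x * F j m x = F (j + 1) m x + F (j - 1) m x + v j * F j m x" using elim(1) by blast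
      then show ?thesis unfolding \<phi>_def by (simp add: algebra_simps)
    qed
    moreover have "\<bar>\<phi> j\<bar> \<le> (2 + h (delta m) x) * (1 + \<bar>real_of_int j\<bar>)\<^sup>2" for j
    proof -
      have "\<bar>\<phi> j\<bar> \<le> (h (S j m) x + h (D j m) x) / 4"
        unfolding \<phi>_def F_def using h0[of "S j m" x] h0[of "D j m" x] by (simp add: abs_le_iff)
      also have "\<dots> = (h (delta j) x + h (delta m) x) / 2" using elim(3) by simp
      also have "\<dots> \<le> (4 * (1 + \<bar>real_of_int j\<bar>)\<^sup>2 + h (delta m) x) / 2" using h_le[of j] by simp
      also have "\<dots> \<le> 2 * (1 + \<bar>real_of_int j\<bar>)\<^sup>2 + h (delta m) x" using h0[of "delta m" x] by simp
      also have "h (delta m) x \<le> h (delta m) x * (1 + \<bar>real_of_int j\<bar>)\<^sup>2"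
        using mult_left_mono[of 1 "(1 + \<bar>real_of_int j\<bar>)\<^sup>2" "h (delta m) x"] h0[of "delta m" x]
        by (simp add: one_le_power)
      finally show ?thesis by (simp add: distrib_right)
    qed
    ultimately show ?case by (intro exI[of _ \<phi>]) (auto simp: fun_eq_iff)
  qed
  then show thesis using that[OF fin sets ac] by blast
qed

text \<open>At almost every \<open>x\<close> in \<open>S\<close> a polynomially bounded solution
  exists, and by hypothesis it is an eigenfunction. Its spectral measure has an atom at
  \<open>x\<close>, so by absolute continuity \<open>M\<close> has one too. The countable carrier is
  the set of atoms of \<open>M\<close>, the same for all \<open>u\<close>.\<close>

theorem pure_point:
  assumes dec: "\<And>E \<phi> B. E \<in> S \<Longrightarrow> (\<And>j. \<phi> (j + 1) + \<phi> (j - 1) = (E - v j) * \<phi> j) \<Longrightarrow>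
      (\<And>j. \<bar>\<phi> j\<bar> \<le> B * (1 + \<bar>real_of_int j\<bar>)\<^sup>2) \<Longrightarrow> (\<lambda>n. complex_of_real (\<phi> n)) \<in> ell2"
    and u: "u \<in> ell2"
  shows "pure_point_on (N u) S"
proof (rule generalized_eigenfunctions)
  fix M :: "real measure"
  assume fin: "finite_measure M" and sets: "sets M = sets borel"
    and ac: "\<And>u. u \<in> ell2 \<Longrightarrow> absolutely_continuous M (N u)"
    and ae: "AE x in M. \<exists>\<phi>::int \<Rightarrow> real. \<phi> \<noteq> (\<lambda>n. 0) \<and> (\<forall>j. \<phi> (j + 1) + \<phi> (j - 1) = (x - v j) * \<phi> j)
      \<and> (\<exists>B. \<forall>j. \<bar>\<phi> j\<bar> \<le> B * (1 + \<bar>real_of_int j\<bar>)\<^sup>2)"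
  interpret M: finite_measure M by (rule fin)
  define C where "C = {x. measure M {x} \<noteq> 0}"
  have "countable C" unfolding C_def by (rule M.countable_support)
  moreover have "AE x in M. x \<in> S \<longrightarrow> x \<in> C"
    using ae
  proof eventually_elim
    case (elim x)
    show ?case
    proof
      assume x: "x \<in> S"
      obtain \<phi> B where \<phi>: "\<phi> \<noteq> (\<lambda>n. 0)" "\<And>j. \<phi> (j + 1) + \<phi> (j - 1) = (x - v j) * \<phi> j"
        "\<And>j. \<bar>\<phi> j\<bar> \<le> B * (1 + \<bar>real_of_int j\<bar>)\<^sup>2" using elim by blast
      let ?\<phi> = "\<lambda>n. complex_of_real (\<phi> n)"
      have 1: "?\<phi> \<in> ell2" by (rule dec[OF x \<phi>(2,3)])
      have 2: "?\<phi> \<noteq> (\<lambda>n. 0)" using \<phi>(1) by (auto simp: fun_eq_iff)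
      have "T ?\<phi> = (\<lambda>n. complex_of_real x * ?\<phi> n)"
      proof
        fix n
        have "T ?\<phi> n = complex_of_real (\<phi> (n + 1) + \<phi> (n - 1) + v n * \<phi> n)" unfolding T_eq by simp
        also have "\<phi> (n + 1) + \<phi> (n - 1) + v n * \<phi> n = x * \<phi> n" using \<phi>(2)[of n] by (simp add: algebra_simps)
        finally show "T ?\<phi> n = complex_of_real x * ?\<phi> n" by simp
      qed
      then have "emeasure (N ?\<phi>) {x} \<noteq> 0" by (rule eigenvalue_atom[OF 1 2])
      then have "{x} \<notin> null_sets (N ?\<phi>)" by (auto dest: null_setsD1)
      then have "{x} \<notin> null_sets M" using ac[OF 1] unfolding absolutely_continuous_def by blast
      moreover have "{x} \<in> sets M" unfolding sets by simp
      ultimately have "emeasure M {x} \<noteq> 0" by (meson null_setsI)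
      then show "x \<in> C" by (simp add: C_def M.emeasure_eq_measure)
    qed
  qed
  then have "AE x in N u. x \<in> S \<longrightarrow> x \<in> C"
    by (intro absolutely_continuous_AE[OF _ ac[OF u]]) (simp add: sets)
  ultimately show ?thesis unfolding pure_point_on_def by blast
qed

end

section \<open>Localization from decay, for bounded potentials\<close>

lemma bij_int_shift: "bij_betw (\<lambda>n. n + c) UNIV (UNIV :: int set)"
  by (rule bij_betwI[of _ _ _ "\<lambda>n. n - c"]) auto

lemma ell2_shift: "u \<in> ell2 \<Longrightarrow> (\<lambda>n. u (n + c)) \<in> ell2"
  unfolding ell2_def mem_Collect_eq
  using summable_on_reindex_bij_betw[OF bij_int_shift[of c], of "\<lambda>n. (cmod (u n))\<^sup>2"] by simp

lemma rinner_shift: "rinner (\<lambda>n. u (n + c)) v = rinner u (\<lambda>n. v (n - c))"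
  unfolding rinner_def ell2_inner_def
  using infsum_reindex_bij_betw[OF bij_int_shift[of c], of "\<lambda>n. cnj (u n) * v (n - c)"] by simp

lemma ell2_mult_bounded:
  assumes "u \<in> ell2" and "\<And>n. \<bar>v n\<bar> \<le> K"
  shows "(\<lambda>n. complex_of_real (v n) * u n) \<in> ell2"
proof -
  have "(\<lambda>n. K\<^sup>2 * (cmod (u n))\<^sup>2) summable_on UNIV"
    using assms(1) by (intro summable_on_cmult_right) (simp add: ell2_def)
  moreover have "(cmod (complex_of_real (v n) * u n))\<^sup>2 \<le> K\<^sup>2 * (cmod (u n))\<^sup>2" for n
    using power_mono[OF assms(2)[of n], of 2] by (simp add: norm_mult power_mult_distrib mult_right_mono)
  ultimately show ?thesis unfolding ell2_def by (auto intro: summable_on_comparison_test)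
qed

lemma schroedinger_resolution:
  assumes "\<And>n. \<bar>V \<theta> n\<bar> \<le> K" and "spectral_resolution (schroedinger V \<theta>) P"
  shows "schroedinger_resolution (schroedinger V \<theta>) P (V \<theta>)"
proof unfold_locales
  fix u v assume u: "u \<in> ell2"
  have shift: "(\<lambda>n. w (n + 1)) \<in> ell2" "(\<lambda>n. w (n - 1)) \<in> ell2" if "w \<in> ell2" for w
    using ell2_shift[OF that, of 1] ell2_shift[OF that, of "-1"] by simp_all
  have pot: "(\<lambda>n. complex_of_real (V \<theta> n) * w n) \<in> ell2" if "w \<in> ell2" for w
    by (rule ell2_mult_bounded[OF that assms(1)])
  show "schroedinger V \<theta> u \<in> ell2"
    unfolding schroedinger_def using u by (intro ell2_add shift pot)
  assume v: "v \<in> ell2"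
  have "rinner (\<lambda>n. complex_of_real (V \<theta> n) * u n) v = rinner u (\<lambda>n. complex_of_real (V \<theta> n) * v n)"
    by (simp add: rinner_def ell2_inner_def mult_ac)
  then show "rinner (schroedinger V \<theta> u) v = rinner u (schroedinger V \<theta> v)"
    unfolding schroedinger_def
    using u v shift pot rinner_shift[of u 1 v] rinner_shift[of u "-1" v]
    by (simp add: rinner_add_left rinner_add_right ell2_add)
next
  show "spectral_resolution (schroedinger V \<theta>) P" by (rule assms(2))
qed (auto simp: schroedinger_def algebra_simps)

lemma exp_decaying_ell2:
  assumes "exp_decaying u"
  shows "u \<in> ell2"
proof -
  obtain C c where c: "c > 0" and C: "\<And>n. cmod (u n) \<le> C * exp (- c * \<bar>real_of_int n\<bar>)"
    using assms by (auto simp: exp_decaying_def)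
  have C0: "C \<ge> 0" using order_trans[OF norm_ge_zero C[of 0]] by simp
  have le: "norm ((cmod (u (int_decode i)))\<^sup>2) \<le> C\<^sup>2 * exp c * exp (- c) ^ i" for i
  proof -
    define n where "n = int_decode i"
    have "real_of_int (int i) \<le> real_of_int (2 * \<bar>n\<bar> + 1)"
      unfolding of_int_le_iff n_def using int_encode_le[of "int_decode i"] by simp
    then have "c * real i \<le> c * (2 * \<bar>real_of_int n\<bar> + 1)" using c by (intro mult_left_mono) auto
    then have *: "- (2 * c * \<bar>real_of_int n\<bar>) \<le> c - c * real i" by (simp add: algebra_simps)
    have "(cmod (u n))\<^sup>2 \<le> (C * exp (- c * \<bar>real_of_int n\<bar>))\<^sup>2" by (intro power_mono C) auto
    also have "\<dots> = C\<^sup>2 * exp (- (2 * c * \<bar>real_of_int n\<bar>))"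
      by (simp add: power_mult_distrib exp_double[symmetric] mult_ac)
    also have "\<dots> \<le> C\<^sup>2 * exp (c - c * real i)" using * by (intro mult_left_mono) auto
    also have "exp (c - c * real i) = exp c * exp (- c) ^ i"
      by (simp add: exp_diff exp_minus exp_of_nat_mult[symmetric] power_inverse divide_inverse mult.commute)
    finally show ?thesis by (simp add: n_def mult.assoc)
  qed
  have "summable (\<lambda>i. C\<^sup>2 * exp c * exp (- c) ^ i)"
    using c by (intro summable_mult summable_geometric) auto
  then have "summable (\<lambda>i. norm ((cmod (u (int_decode i)))\<^sup>2))"
    by (rule summable_comparison_test[rotated]) (use le in auto)
  then have "(\<lambda>i. (cmod (u (int_decode i)))\<^sup>2) summable_on UNIV"
    by (rule norm_summable_imp_summable_on)
  then show ?thesis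
    unfolding ell2_def using summable_on_reindex_bij_betw[OF bij_int_decode, of "\<lambda>n. (cmod (u n))\<^sup>2"] by simp
qed

lemma ell2_bounded:
  assumes "u \<in> ell2"
  obtains B where "B \<ge> 0" "\<And>n. cmod (u n) \<le> B"
proof -
  have "(cmod (u n))\<^sup>2 \<le> (\<Sum>\<^sub>\<infinity>n. (cmod (u n))\<^sup>2)" for n
    using finite_sum_le_infsum[of "\<lambda>n. (cmod (u n))\<^sup>2" UNIV "{n}"] assms by (auto simp: ell2_def)
  then have "cmod (u n) \<le> sqrt (\<Sum>\<^sub>\<infinity>n. (cmod (u n))\<^sup>2)" for n by (rule real_le_rsqrt)
  then show thesis by (intro that[of "sqrt (\<Sum>\<^sub>\<infinity>n. (cmod (u n))\<^sup>2)"]) (auto intro: infsum_nonneg)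
qed

text \<open>The decay hypothesis serves twice: it makes polynomially bounded solutions
  square-summable, and it applies to eigenfunctions in \<open>ell2\<close> because these are
  bounded. Potential and energy being real, the real and imaginary parts of an eigenfunction are
  solutions themselves.\<close>

lemma anderson_localization_if_decay:
  assumes V: "\<And>n. \<bar>V \<theta> n\<bar> \<le> K"
    and dec: "\<And>E \<phi> B. E \<in> S \<Longrightarrow> (\<And>j. \<phi> (j + 1) + \<phi> (j - 1) = (E - V \<theta> j) * \<phi> j) \<Longrightarrow>
      (\<And>j. \<bar>\<phi> j\<bar> \<le> B * (1 + \<bar>real_of_int j\<bar>)\<^sup>2) \<Longrightarrow>
      \<exists>C c. c > 0 \<and> (\<forall>j. \<bar>\<phi> j\<bar> \<le> C * exp (- c * \<bar>real_of_int j\<bar>))"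
  shows "anderson_localization (schroedinger V \<theta>) S"
  unfolding anderson_localization_def
proof (intro conjI allI impI ballI)
  fix P u assume P: "spectral_resolution (schroedinger V \<theta>) P" and u: "u \<in> ell2"
  interpret schroedinger_resolution "schroedinger V \<theta>" P "V \<theta>"
    by (rule schroedinger_resolution[OF V P])
  show "pure_point_on (spectral_measure P u) S"
  proof (rule pure_point[OF _ u])
    fix E \<phi> B
    assume "E \<in> S" "\<And>j. \<phi> (j + 1) + \<phi> (j - 1) = (E - V \<theta> j) * \<phi> j"
      "\<And>j. \<bar>\<phi> j\<bar> \<le> B * (1 + \<bar>real_of_int j\<bar>)\<^sup>2"
    then have "\<exists>C c. c > 0 \<and> (\<forall>j. \<bar>\<phi> j\<bar> \<le> C * exp (- c * \<bar>real_of_int j\<bar>))" by (rule dec)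
    then have "exp_decaying (\<lambda>n. complex_of_real (\<phi> n))" by (simp add: exp_decaying_def)
    then show "(\<lambda>n. complex_of_real (\<phi> n)) \<in> ell2" by (rule exp_decaying_ell2)
  qed
next
  fix E u assume E: "E \<in> S" and u: "u \<in> ell2" and eq: "schroedinger V \<theta> u = (\<lambda>n. complex_of_real E * u n)"
  have sol: "u (j + 1) + u (j - 1) = complex_of_real (E - V \<theta> j) * u j" for j
    using fun_cong[OF eq, of j] by (simp add: schroedinger_def algebra_simps)
  show "exp_decaying u"
  proof (rule ell2_bounded[OF u])
    fix B :: real assume B: "B \<ge> 0" "\<And>n. cmod (u n) \<le> B"
    have B': "x \<le> B * (1 + \<bar>real_of_int j\<bar>)\<^sup>2" if "x \<le> cmod (u j)" for x j
    proof -
      have "B * 1 \<le> B * (1 + \<bar>real_of_int j\<bar>)\<^sup>2" using B(1) by (intro mult_left_mono one_le_power) auto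
      then show ?thesis using that B(2)[of j] by linarith
    qed
    have "\<exists>C c. c > 0 \<and> (\<forall>j. \<bar>Re (u j)\<bar> \<le> C * exp (- c * \<bar>real_of_int j\<bar>))"
    proof (rule dec[OF E, where B = B])
      fix j show "Re (u (j + 1)) + Re (u (j - 1)) = (E - V \<theta> j) * Re (u j)"
        using arg_cong[OF sol[of j], of Re] by simp
    qed (intro B' abs_Re_le_cmod)
    then obtain C1 c1 where 1: "c1 > 0" "\<And>j. \<bar>Re (u j)\<bar> \<le> C1 * exp (- c1 * \<bar>real_of_int j\<bar>)" by blast
    have "\<exists>C c. c > 0 \<and> (\<forall>j. \<bar>Im (u j)\<bar> \<le> C * exp (- c * \<bar>real_of_int j\<bar>))"
    proof (rule dec[OF E, where B = B])
      fix j show "Im (u (j + 1)) + Im (u (j - 1)) = (E - V \<theta> j) * Im (u j)"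
        using arg_cong[OF sol[of j], of Im] by simp
    qed (intro B' abs_Im_le_cmod)
    then obtain C2 c2 where 2: "c2 > 0" "\<And>j. \<bar>Im (u j)\<bar> \<le> C2 * exp (- c2 * \<bar>real_of_int j\<bar>)" by blast
    have C0: "C1 \<ge> 0" "C2 \<ge> 0"
      using order_trans[OF abs_ge_zero 1(2)[of 0]] order_trans[OF abs_ge_zero 2(2)[of 0]] by simp_all
    have "cmod (u n) \<le> (C1 + C2) * exp (- min c1 c2 * \<bar>real_of_int n\<bar>)" for n
    proof -
      have "C1 * exp (- c1 * \<bar>real_of_int n\<bar>) \<le> C1 * exp (- min c1 c2 * \<bar>real_of_int n\<bar>)"
        "C2 * exp (- c2 * \<bar>real_of_int n\<bar>) \<le> C2 * exp (- min c1 c2 * \<bar>real_of_int n\<bar>)"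
        using C0 by (auto intro!: mult_left_mono mult_right_mono)
      then show ?thesis using cmod_le[of "u n"] 1(2)[of n] 2(2)[of n] unfolding distrib_right by linarith
    qed
    then show "exp_decaying u" unfolding exp_decaying_def using 1(1) 2(1)
      by (intro exI[of _ "C1 + C2"] exI[of _ "min c1 c2"]) auto
  qed
qed

section \<open>Anderson localization\<close>

theorem theorem5p1:
  fixes \<alpha> \<gamma> \<sigma> lam \<tau> \<theta> :: real and V :: "real \<Rightarrow> int \<Rightarrow> real"
  assumes "\<gamma> > 0" and "\<sigma> > 0" and "\<alpha> \<in> DC \<gamma> \<sigma>"
    and "(V = V1 lam \<tau> \<alpha> \<and> \<bar>\<tau>\<bar> < 1) \<or> (V = V2 lam \<alpha> \<and> lam \<noteq> 0)"
    and "\<theta> \<in> Theta \<alpha> \<sigma>"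
  shows "anderson_localization (schroedinger V \<theta>) (Sigma_spec V \<theta> \<inter> {E. lyapunov V E > 0})"
proof -
  have dio: "diophantine \<alpha> \<gamma> \<sigma>" using assms(1-3) by (simp add: diophantine_if_DC)
  obtain \<eta> where nonres: "nonresonant \<alpha> \<theta> \<eta> \<sigma>" using nonresonant_if_Theta[OF assms(5)] .
  have "\<exists>K. \<forall>n. \<bar>V \<theta> n\<bar> \<le> K"
    using assms(4) periodic_bounded[OF gaa_potential_periodic[of lam \<tau>] gaa_potential_continuous[of \<tau> lam]]
    by (metis V1_eq V2_bounded)
  then obtain K where K: "\<And>n. \<bar>V \<theta> n\<bar> \<le> K" by blast
  show ?thesis
  proof (rule anderson_localization_if_decay[of V \<theta>, OF K])
    fix E \<phi> B
    assume E: "E \<in> Sigma_spec V \<theta> \<inter> {E. lyapunov V E > 0}"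
      and sol: "\<And>j. \<phi> (j + 1) + \<phi> (j - 1) = (E - V \<theta> j) * \<phi> j"
      and bnd: "\<And>j. \<bar>\<phi> j\<bar> \<le> B * (1 + \<bar>real_of_int j\<bar>)\<^sup>2"
    from assms(4) show "\<exists>C c. c > 0 \<and> (\<forall>j. \<bar>\<phi> j\<bar> \<le> C * exp (- c * \<bar>real_of_int j\<bar>))"
    proof (elim disjE conjE)
      assume V: "V = V1 lam \<tau> \<alpha>" and \<tau>: "\<bar>\<tau>\<bar> < 1"
      show ?thesis by (rule V1_decay[OF dio nonres \<tau> _ sol[unfolded V] bnd]) (use E V in simp)
    next
      assume V: "V = V2 lam \<alpha>"
      show ?thesis by (rule V2_decay[OF dio nonres _ sol[unfolded V] bnd]) (use E V in simp)
    qed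
  qed
qed

end
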